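(* Let $u_0:\mathbb R\to\mathbb R$ be a Schwartz function whose spectral function $a(k)$ (see context) has no zeros in $\{\operatorname{Im}k\ge0\}$, let $r(k)$ be its reflection coefficient, and let $u(x,t)$ be the solution of $$u_{xt}=u+\tfrac16(u^3)_{xx},\qquad u(x,0)=u_0(x).$$ For real $y$ and $t\ge 0$ consider the Riemann–Hilbert problem of finding a $2\times2$ matrix-valued function $\tilde M(y,t,k)$ such that: (i) $\tilde M(y,t,\cdot)$ is analytic in the open upper and lower half-planes and continuous up to the boundary $k\in\mathbb R$ from each side; (ii) the boundary values $\tilde M_\pm(y,t,k)=\lim_{\epsilon\downarrow0}\tilde M(y,t,k\pm i\epsilon)$ satisfy $\tilde M_+(y,t,k)=\tilde M_-(y,t,k)\tilde J(y,t,k)$, $k\in\mathbb R$, where $$\tilde J(y,t,k)=e^{i(ky-\frac{t}{4k})\sigma_3}\begin{pmatrix}1&r(k)\\ \overline{r(k)}&1+|r(k)|^2\end{pmatrix}e^{-i(ky-\frac{t}{4k})\sigma_3};$$ (iii) $\tilde M(y,t,k)\to\mathbb I$ as $k\to\infty$. Then this Riemann–Hilbert problem has a unique solution, and the solution $u(x,t)$ of the initial value problem is given in parametric form by $u(x,t)=\hat u(y(x,t),t)$, i.e. $u(x(y,t),t)=\hat u(y,t)$, where $$x(y,t)=y+\lim_{k\to0}\frac{\big(\tilde M(y,t,0)^{-1}\tilde M(y,t,k)\big)_{11}-1}{ik},\qquad \hat u(y,t)=\lim_{k\to0}\frac{\big(\tilde M(y,t,0)^{-1}\tilde M(y,t,k)\big)_{21}}{ik},$$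 and $y(x,t)=x-\int_x^{\infty}\big(\sqrt{1+u_x(x',t)^2}-1\big)\,dx'$.
   Context: The solution $u$ is real-valued and smooth, and for every $t\ge0$ the function $u(\cdot,t)$ and its $x$- and $t$-derivatives decay rapidly (Schwartz decay) as $|x|\to\infty$. Spectral functions. Let $\sigma_2=\begin{pmatrix}0&-i\\ i&0\end{pmatrix}$, $\sigma_3=\operatorname{diag}(1,-1)$, $\mathbb I$ the $2\times2$ identity, and for a scalar $\tau$ and a $2\times 2$ matrix $A$ write $e^{\tau\hat\sigma_3}A=e^{\tau\sigma_3}Ae^{-\tau\sigma_3}$. Put $m(x)=1+u_0'(x)^2$, $p(x)=x-\int_x^{\infty}(\sqrt{m(x')}-1)\,dx'$ and $V_1(x)=\frac{i\,u_0''(x)}{2m(x)}\sigma_2$. Let $\mu_1,\mu_2$ be the solutions of the Volterra equations $$\mu_1(x,k)=\mathbb I+\int_{-\infty}^{x}e^{ik[p(x)-p(y)]\hat\sigma_3}\big(V_1(y)\mu_1(y,k)\big)\,dy,\qquad \mu_2(x,k)=\mathbb I-\int_{x}^{\infty}e^{ik[p(x)-p(y)]\hat\sigma_3}\big(V_1(y)\mu_2(y,k)\big)\,dy .$$ For $k\in\mathbb R$ there is a matrix $S(k)$, independent of $x$, with $$\mu_1(x,k)=\mu_2(x,k)\,e^{ikp(x)\hat\sigma_3}S(k),\qquad S(k)=\begin{pmatrix}\overline{a(\bar k)}&b(k)\\-\overline{b(\bar k)}&a(k)\end{pmatrix}.$$ Denoting by $[\mu_j]_i$ the $i$-th column of $\mu_j$,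 one has $a(k)=\det([\mu_2]_1,[\mu_1]_2)$, which is defined for $\operatorname{Im}k\ge0$ and analytic in $\operatorname{Im}k>0$. The reflection coefficient is $r(k)=b(k)/a(k)$, $k\in\mathbb R$. *)

theory Defs
  imports "HOL-Analysis.Analysis"
begin

definition schwartz :: "(real \<Rightarrow> real) \<Rightarrow> bool" where
  "schwartz f \<longleftrightarrow>
     (\<forall>n x. (deriv ^^ n) f differentiable at x) \<and>
     (\<forall>m n. bounded (range (\<lambda>x. x ^ m * (deriv ^^ n) f x)))"


subsection \<open>The initial value problem\<close>

text \<open>Functions of \<open>(x, t)\<close> matter only for \<open>t \<ge> 0\<close>; the time derivative at \<open>t = 0\<close> is one-sided.\<close>

definition pdx :: "(real \<Rightarrow> real \<Rightarrow> real) \<Rightarrow> real \<Rightarrow> real \<Rightarrow> real" where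
  "pdx f x t = deriv (\<lambda>z. f z t) x"

definition pdt :: "(real \<Rightarrow> real \<Rightarrow> real) \<Rightarrow> real \<Rightarrow> real \<Rightarrow> real" where
  "pdt f x t = vector_derivative (f x) (at t within {0..})"

text \<open>All iterated partial derivatives of \<open>u\<close>, in any order, including \<open>u\<close> itself.\<close>

inductive_set partials :: "(real \<Rightarrow> real \<Rightarrow> real) \<Rightarrow> (real \<Rightarrow> real \<Rightarrow> real) set"
  for u :: "real \<Rightarrow> real \<Rightarrow> real" where
  base: "u \<in> partials u"
| dx: "f \<in> partials u \<Longrightarrow> pdx f \<in> partials u"
| dt: "f \<in> partials u \<Longrightarrow> pdt f \<in> partials u"

definition smooth_halfplane :: "(real \<Rightarrow> real \<Rightarrow> real) \<Rightarrow> bool" where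
  "smooth_halfplane u \<longleftrightarrow>
     (\<forall>f\<in>partials u.
        continuous_on (UNIV \<times> {0..}) (\<lambda>(x, t). f x t) \<and>
        (\<forall>x. \<forall>t\<ge>0. (\<lambda>z. f z t) differentiable at x \<and>
                    f x differentiable (at t within {0..})))"

definition short_pulse_solution :: "(real \<Rightarrow> real) \<Rightarrow> (real \<Rightarrow> real \<Rightarrow> real) \<Rightarrow> bool" where
  "short_pulse_solution u0 u \<longleftrightarrow>
     smooth_halfplane u \<and>
     (\<forall>f\<in>partials u. \<forall>t\<ge>0. schwartz (\<lambda>x. f x t)) \<and>
     (\<forall>x. \<forall>t\<ge>0. pdt (pdx u) x t = u x t + 1/6 * pdx (pdx (\<lambda>z s. u z s ^ 3)) x t) \<and>
     (\<forall>x. u x 0 = u0 x)"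


subsection \<open>Spectral functions\<close>

definition sigma2 :: "complex^2^2" where
  "sigma2 = vector [vector [0, - \<i>], vector [\<i>, 0]]"

definition sigma3 :: "complex^2^2" where
  "sigma3 = vector [vector [1, 0], vector [0, -1]]"

text \<open>The matrix exponential of \<open>\<tau> \<sigma>\<^sub>3\<close>, which is diagonal.\<close>

definition exp_sigma3 :: "complex \<Rightarrow> complex^2^2" where
  "exp_sigma3 \<tau> = (\<chi> i j. if i = j then exp (\<tau> * sigma3 $ i $ i) else 0)"

definition hat_sigma3 :: "complex \<Rightarrow> complex^2^2 \<Rightarrow> complex^2^2" where
  "hat_sigma3 \<tau> A = exp_sigma3 \<tau> ** A ** exp_sigma3 (- \<tau>)"

text \<open>The action of \<open>hat_sigma3 \<tau>\<close> on the \<open>j\<close>-th column of a matrix. The Volterra equations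
  decouple into columns; for non-real \<open>k\<close> only one column of each is well posed, so the
  equations are stated column by column.\<close>

definition hat_sigma3_col :: "2 \<Rightarrow> complex \<Rightarrow> complex^2 \<Rightarrow> complex^2" where
  "hat_sigma3_col j \<tau> v = exp (- \<tau> * sigma3 $ j $ j) *s (exp_sigma3 \<tau> *v v)"

lemma column_hat_sigma3:
  "column j (hat_sigma3 \<tau> A) = hat_sigma3_col j \<tau> (column j A)"
  using exhaust_2[of j]
  by (auto simp: vec_eq_iff column_def hat_sigma3_def hat_sigma3_col_def exp_sigma3_def
      matrix_matrix_mult_def matrix_vector_mult_def sum_2 forall_2)

definition m_fun :: "(real \<Rightarrow> real) \<Rightarrow> real \<Rightarrow> real" where
  "m_fun w x = 1 + (deriv w x)\<^sup>2"

text \<open>With \<open>w = u\<^sub>0\<close> this is \<open>p(x)\<close>; with \<open>w = u(\<cdot>,t)\<close> it is \<open>y(x,t)\<close>.\<close>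

definition p_fun :: "(real \<Rightarrow> real) \<Rightarrow> real \<Rightarrow> real" where
  "p_fun w x = x - (LINT x':{x..}|lborel. (sqrt (m_fun w x') - 1))"

definition V1 :: "(real \<Rightarrow> real) \<Rightarrow> real \<Rightarrow> complex^2^2" where
  "V1 u0 x = mat (\<i> * of_real (deriv (deriv u0) x) / of_real (2 * m_fun u0 x)) ** sigma2"

definition volterra_integrand ::
    "(real \<Rightarrow> real) \<Rightarrow> 2 \<Rightarrow> complex \<Rightarrow> (real \<Rightarrow> complex^2) \<Rightarrow> real \<Rightarrow> real \<Rightarrow> complex^2" where
  "volterra_integrand u0 j k f x y =
     hat_sigma3_col j (\<i> * k * of_real (p_fun u0 x - p_fun u0 y)) (V1 u0 y *v f y)"

text \<open>The \<open>j\<close>-th column of \<open>\<mu>\<^sub>1(\<cdot>,k)\<close> and of \<open>\<mu>\<^sub>2(\<cdot>,k)\<close>. Absolute convergence of the integrals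
  singles out one solution for real \<open>k\<close> and, when \<open>Im k > 0\<close>, for the second column of \<open>\<mu>\<^sub>1\<close>
  and the first column of \<open>\<mu>\<^sub>2\<close>.\<close>

definition mu1_col :: "(real \<Rightarrow> real) \<Rightarrow> 2 \<Rightarrow> complex \<Rightarrow> real \<Rightarrow> complex^2" where
  "mu1_col u0 j k = (THE f. \<forall>x.
     set_integrable lborel {..x} (volterra_integrand u0 j k f x) \<and>
     f x = column j (mat 1) + (LINT y:{..x}|lborel. volterra_integrand u0 j k f x y))"

definition mu2_col :: "(real \<Rightarrow> real) \<Rightarrow> 2 \<Rightarrow> complex \<Rightarrow> real \<Rightarrow> complex^2" where
  "mu2_col u0 j k = (THE f. \<forall>x.
     set_integrable lborel {x..} (volterra_integrand u0 j k f x) \<and>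
     f x = column j (mat 1) - (LINT y:{x..}|lborel. volterra_integrand u0 j k f x y))"

definition of_columns :: "complex^2 \<Rightarrow> complex^2 \<Rightarrow> complex^2^2" where
  "of_columns v w = transpose (vector [v, w])"

definition mu1 :: "(real \<Rightarrow> real) \<Rightarrow> complex \<Rightarrow> real \<Rightarrow> complex^2^2" where
  "mu1 u0 k x = of_columns (mu1_col u0 1 k x) (mu1_col u0 2 k x)"

definition mu2 :: "(real \<Rightarrow> real) \<Rightarrow> complex \<Rightarrow> real \<Rightarrow> complex^2^2" where
  "mu2 u0 k x = of_columns (mu2_col u0 1 k x) (mu2_col u0 2 k x)"

definition scattering_matrix :: "(real \<Rightarrow> real) \<Rightarrow> real \<Rightarrow> complex^2^2" where
  "scattering_matrix u0 k = (THE S. \<forall>x.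
     mu1 u0 (of_real k) x =
       mu2 u0 (of_real k) x ** hat_sigma3 (\<i> * of_real k * of_real (p_fun u0 x)) S)"

text \<open>The determinant does not depend on \<open>x\<close>. For real \<open>k\<close> it is the (2,2) entry of the
  scattering matrix.\<close>

definition spectral_a :: "(real \<Rightarrow> real) \<Rightarrow> complex \<Rightarrow> complex" where
  "spectral_a u0 k = (THE a. \<forall>x. det (of_columns (mu2_col u0 1 k x) (mu1_col u0 2 k x)) = a)"

definition spectral_b :: "(real \<Rightarrow> real) \<Rightarrow> real \<Rightarrow> complex" where
  "spectral_b u0 k = scattering_matrix u0 k $ 1 $ 2"

definition reflection :: "(real \<Rightarrow> real) \<Rightarrow> real \<Rightarrow> complex" where
  "reflection u0 k = spectral_b u0 k / spectral_a u0 (of_real k)"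


subsection \<open>The Riemann--Hilbert problem\<close>

text \<open>For \<open>k = 0\<close> the phase \<open>t/(4k)\<close> is 0 by the convention for division. Since \<open>r(0) = 0\<close>, the
  value of the jump matrix there is the identity, which is also its limit as \<open>k \<rightarrow> 0\<close>.\<close>

definition jump :: "(real \<Rightarrow> complex) \<Rightarrow> real \<Rightarrow> real \<Rightarrow> real \<Rightarrow> complex^2^2" where
  "jump r y t k =
     exp_sigma3 (\<i> * of_real (k * y - t / (4 * k))) **
     vector [vector [1, r k], vector [cnj (r k), 1 + of_real ((cmod (r k))\<^sup>2)]] **
     exp_sigma3 (- (\<i> * of_real (k * y - t / (4 * k))))"

definition boundary_plus :: "(complex \<Rightarrow> complex^2^2) \<Rightarrow> real \<Rightarrow> complex^2^2" where
  "boundary_plus M k = Lim (at_right 0) (\<lambda>\<epsilon>. M (of_real k + \<i> * of_real \<epsilon>))"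

definition boundary_minus :: "(complex \<Rightarrow> complex^2^2) \<Rightarrow> real \<Rightarrow> complex^2^2" where
  "boundary_minus M k = Lim (at_right 0) (\<lambda>\<epsilon>. M (of_real k - \<i> * of_real \<epsilon>))"

text \<open>Only the values of \<open>M\<close> off the real axis are constrained.\<close>

definition rhp_solution ::
    "(real \<Rightarrow> complex) \<Rightarrow> real \<Rightarrow> real \<Rightarrow> (complex \<Rightarrow> complex^2^2) \<Rightarrow> bool" where
  "rhp_solution r y t M \<longleftrightarrow>
     (\<forall>i j. (\<lambda>k. M k $ i $ j) holomorphic_on {k. Im k > 0} \<and>
            (\<lambda>k. M k $ i $ j) holomorphic_on {k. Im k < 0}) \<and>
     (\<exists>P. continuous_on {k. Im k \<ge> 0} P \<and> (\<forall>k. Im k > 0 \<longrightarrow> P k = M k)) \<and>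
     (\<exists>N. continuous_on {k. Im k \<le> 0} N \<and> (\<forall>k. Im k < 0 \<longrightarrow> N k = M k)) \<and>
     (\<forall>k. boundary_plus M k = boundary_minus M k ** jump r y t k) \<and>
     (M \<longlongrightarrow> mat 1) (inf at_infinity (principal {k. Im k \<noteq> 0}))"

definition rhp_unique_solution ::
    "(real \<Rightarrow> complex) \<Rightarrow> real \<Rightarrow> real \<Rightarrow> (complex \<Rightarrow> complex^2^2) \<Rightarrow> bool" where
  "rhp_unique_solution r y t M \<longleftrightarrow>
     rhp_solution r y t M \<and>
     (\<forall>M'. rhp_solution r y t M' \<longrightarrow> (\<forall>k. Im k \<noteq> 0 \<longrightarrow> M' k = M k))"

end

theory Submission
  imports Defs "HOL-Complex_Analysis.Complex_Analysis"
begin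

text \<open>
  Since \<open>u\<close> is given, no singular integral equation has to be solved: at each time the solution of the
  Riemann--Hilbert problem is assembled from the Jost solutions of \<open>u(\<cdot>, t)\<close>, as
  \<open>([\<mu>\<^sub>2]\<^sub>1, [\<mu>\<^sub>1]\<^sub>2 / a)\<close> in the upper half-plane. Rotating by half of \<open>arctan u\<^sub>x\<close> turns the spatial equation
  into one whose potential is proportional to \<open>k\<close>; its expansion at \<open>k = 0\<close> gives the reconstruction
  formulas. Uniqueness is Liouville's theorem for \<open>M' M\<^sup>-\<^sup>1\<close>.

  It remains to show that \<open>a\<close> is conserved and \<open>b\<close> is multiplied by \<open>exp (- it/(2k))\<close>. The decay of \<open>u\<close> in
  \<open>x\<close> is not assumed to be uniform in time, so the Jost solutions cannot simply be differentiated in \<open>t\<close>.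
  Instead one differentiates the transfer matrix of an interval \<open>[-L, L]\<close>; by the zero curvature
  equation the error is controlled by the time integrals of \<open>u\<^sup>2 sqrt (1 + u\<^sub>x\<^sup>2)\<close> and \<open>|u|\<close> at \<open>x = \<plusminus>L\<close>. The
  conservation laws with densities \<open>u\<^sup>2\<close> and \<open>sqrt (1 + u\<^sub>x\<^sup>2) - 1\<close> have nonnegative fluxes, which bounds both
  quantities uniformly in time, then \<open>sup |u|\<close>, and then the integral of the second flux
  \<open>u\<^sup>2 sqrt (1 + u\<^sub>x\<^sup>2) / 2\<close> over \<open>[0, t] \<times> \<real>\<close>. The time integral of that flux has an integrable
  \<open>x\<close>-derivative, so it tends to 0 as \<open>x \<rightarrow> \<plusminus>\<infinity>\<close>.
\<close>

section \<open>Integrals over half-lines\<close>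

text \<open>The obstacle is that decay in \<open>x\<close> is known only at each fixed time, so
  fluxes at infinity cannot be discarded. Every conservation law is therefore integrated over the
  time interval first; then nonnegativity of the flux and the decay at the two end times suffice.
  For real \<open>\<kappa>\<close> the Lax system is skew-Hermitian, so propagation in
  \<open>x\<close> is unitary and errors made at the ends of \<open>[-L, L]\<close> are not
  amplified. The time part of the Lax pair has a pole at \<open>\<kappa> = 0\<close>; that point is
  treated separately, since there the spatial system is a pure rotation and \<open>a = 1\<close>,
  \<open>b = 0\<close> at all times. Two symmetries halve the work: \<open>x \<mapsto> - x\<close>
  turns solutions normalised at plus infinity into solutions normalised at minus infinity, and
  \<open>k \<mapsto> - k\<close> turns one column into the other and supplies the values in the
  lower half-plane.\<close>

text \<open>All potentials below are dominated by multiples of \<open>kap\<close>, whose tail integrals are explicit; this keeps the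
  iterated integrals of the Neumann series in closed form.\<close>

definition kap :: "real \<Rightarrow> real" where "kap y = 1 / (1 + y\<^sup>2)"

definition kap_tail :: "real \<Rightarrow> real" where "kap_tail x = pi / 2 - arctan x"

lemma kap_pos: "0 < kap y"
  unfolding kap_def using zero_le_power2[of y] by (intro divide_pos_pos) linarith+

lemma kap_minus [simp]: "kap (- y) = kap y"
  by (simp add: kap_def)

lemma kap_le_1: "kap y \<le> 1"
  unfolding kap_def by (simp add: add_pos_nonneg divide_le_eq)

lemma continuous_kap: "continuous_on A kap"
proof -
  have "1 + y\<^sup>2 \<noteq> 0" for y :: real
    using zero_le_power2[of y] by linarith
  then show ?thesis
    unfolding kap_def[abs_def] by (intro continuous_intros) auto
qed

lemma tendsto_kap: "(kap \<longlongrightarrow> 0) at_top"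
proof -
  have "((\<lambda>x::real. 1 / (1 + x\<^sup>2)) \<longlongrightarrow> 0) at_top"
    by (intro tendsto_divide_0[OF tendsto_const] filterlim_at_top_imp_at_infinity
        filterlim_tendsto_add_at_top[OF tendsto_const] filterlim_pow_at_top filterlim_ident) auto
  then show ?thesis
    by (simp add: kap_def[abs_def])
qed

lemma kap_tail_pos: "0 < kap_tail x"
  using arctan_ubound[of x] by (simp add: kap_tail_def)

lemma kap_tail_le_pi: "kap_tail x \<le> pi"
  using arctan_lbound[of x] by (simp add: kap_tail_def)

lemma kap_tail_tendsto: "(kap_tail \<longlongrightarrow> 0) at_top"
  unfolding kap_tail_def[abs_def] using tendsto_diff[OF tendsto_const tendsto_arctan_at_top, of "pi/2"] by simp

lemma DERIV_kap_tail_power: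
  "((\<lambda>x. - (kap_tail x ^ Suc n / real (Suc n))) has_real_derivative kap x * kap_tail x ^ n) (at x)"
  unfolding kap_tail_def kap_def
  by (rule derivative_eq_intros refl | simp add: inverse_eq_divide del: power_Suc of_nat_Suc)+

text \<open>\<open>kap\<close> is minus the derivative of \<open>kap_tail\<close>, so each
  integration raises the exponent by one and divides by the new exponent. These divisors accumulate
  to the factorial that makes the Neumann series converge.\<close>

lemma tail_integral_kap:
  "has_bochner_integral lborel (\<lambda>y. indicator {a..} y *\<^sub>R (kap y * kap_tail y ^ n)) (kap_tail a ^ Suc n / Suc n)"
proof -
  have cont: "continuous_on UNIV (\<lambda>y. kap y * kap_tail y ^ n)"
    unfolding kap_tail_def by (intro continuous_intros continuous_kap)
  then have m: "(\<lambda>y. kap y * kap_tail y ^ n) \<in> borel_measurable borel"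
    by (rule borel_measurable_continuous_onI)
  have nn: "0 \<le> kap y * kap_tail y ^ n" for y
    using kap_pos[of y] kap_tail_pos[of y] by simp
  have "((\<lambda>x. - (kap_tail x ^ Suc n / real (Suc n))) \<longlongrightarrow> - (0 ^ Suc n / real (Suc n))) at_top"
    by (intro tendsto_intros kap_tail_tendsto) simp
  then have lim: "((\<lambda>x. - (kap_tail x ^ Suc n / real (Suc n))) \<longlongrightarrow> 0) at_top"
    by simp
  have "(\<integral>\<^sup>+x. ennreal (kap x * kap_tail x ^ n) * indicator {a..} x \<partial>lborel) = 0 - (- (kap_tail a ^ Suc n / real (Suc n)))"
    by (rule nn_integral_FTC_atLeast[OF m DERIV_kap_tail_power nn lim])
  moreover have "ennreal (kap x * kap_tail x ^ n) * indicator {a..} x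
      = ennreal (indicator {a..} x *\<^sub>R (kap x * kap_tail x ^ n))" for x
    by (auto simp: indicator_def)
  ultimately have "(\<integral>\<^sup>+x. ennreal (indicator {a..} x *\<^sub>R (kap x * kap_tail x ^ n)) \<partial>lborel) = ennreal (kap_tail a ^ Suc n / real (Suc n))"
    by simp
  then show ?thesis
    using m nn kap_tail_pos[of a]
    by (intro has_bochner_integral_nn_integral) (auto intro!: divide_nonneg_nonneg zero_le_power less_imp_le)
qed

lemma tail_bound:
  fixes h :: "real \<Rightarrow> 'a :: {banach, second_countable_topology}"
  assumes m: "set_borel_measurable lborel {a..} h"
    and b: "\<And>y. y \<ge> a \<Longrightarrow> norm (h y) \<le> C * (kap y * kap_tail y ^ n)"
  shows tail_bound_integrable: "set_integrable lborel {a..} h"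
    and tail_bound_norm: "norm (LINT y:{a..}|lborel. h y) \<le> C * kap_tail a ^ Suc n / Suc n"
proof -
  have hb: "has_bochner_integral lborel (\<lambda>y. C * (indicator {a..} y *\<^sub>R (kap y * kap_tail y ^ n))) (C * (kap_tail a ^ Suc n / Suc n))"
    by (intro has_bochner_integral_mult_right tail_integral_kap)
  have le: "norm (indicator {a..} y *\<^sub>R h y) \<le> C * (indicator {a..} y *\<^sub>R (kap y * kap_tail y ^ n))" for y
    using b[of y] by (auto simp: indicator_def)
  show "set_integrable lborel {a..} h"
    unfolding set_integrable_def
    using has_bochner_integral_iff[THEN iffD1, OF hb] m[unfolded set_borel_measurable_def] le
    by (intro Bochner_Integration.integrable_bound[where g = "\<lambda>y. indicator {a..} y *\<^sub>R h y"
          and f = "\<lambda>y. C * (indicator {a..} y *\<^sub>R (kap y * kap_tail y ^ n))"] AE_I2)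
       (simp, simp, metis abs_ge_self order_trans real_norm_def)
  then have "norm (LINT y:{a..}|lborel. h y) \<le> (\<integral>y. C * (indicator {a..} y *\<^sub>R (kap y * kap_tail y ^ n)) \<partial>lborel)"
    unfolding set_lebesgue_integral_def set_integrable_def
    using has_bochner_integral_iff[THEN iffD1, OF hb] le
    by (intro Bochner_Integration.integral_norm_bound_integral) auto
  also have "\<dots> = C * (kap_tail a ^ Suc n / Suc n)"
    using hb by (rule has_bochner_integral_integral_eq)
  finally show "norm (LINT y:{a..}|lborel. h y) \<le> C * kap_tail a ^ Suc n / Suc n" by simp
qed

lemma set_borel_measurable_continuous_UNIV:
  fixes h :: "real \<Rightarrow> 'a :: {banach, second_countable_topology}"
  assumes "continuous_on UNIV h"
  shows "set_borel_measurable lborel {a..} h"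
  unfolding set_borel_measurable_def
  using borel_measurable_continuous_onI[OF assms] by simp

lemma tail_has_vector_derivative:
  fixes h :: "real \<Rightarrow> 'a :: euclidean_space"
  assumes c: "continuous_on UNIV h" and i: "\<And>a. set_integrable lborel {a..} h"
  shows "((\<lambda>x. LINT y:{x..}|lborel. h y) has_vector_derivative - h x) (at x)"
proof -
  \<comment> \<open>A base point to the left of \<open>x\<close>: near \<open>x\<close> the tail is
    a constant minus an integral over a compact interval.\<close>
  define a where "a = x - 1"
  have eq: "(LINT y:{z..}|lborel. h y) = (LINT y:{a..}|lborel. h y) - integral {a..z} h" if "z \<in> {a<..<x+1}" for z
  proof -
    have "{a..} = {a..<z} \<union> {z..}" using that by auto
    moreover have si: "set_integrable lborel {a..<z} h"
      by (rule set_integrable_subset[OF i[of a]]) auto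
    ultimately have "(LINT y:{a..}|lborel. h y) = (LINT y:{a..<z}|lborel. h y) + (LINT y:{z..}|lborel. h y)"
      using set_integral_Un[of "{a..<z}" "{z..}" lborel h] i[of z]
      by (simp add: ivl_disj_int_one disjoint_iff)
    also have "(LINT y:{a..<z}|lborel. h y) = integral {a..<z} h"
      by (rule set_borel_integral_eq_integral(2)[OF si])
    also have "\<dots> = integral {a..z} h"
      by (rule integral_subset_negligible[OF _ negligible_subset[OF negligible_sing[of z]]]) auto
    finally show ?thesis by simp
  qed
  have "((\<lambda>z. integral {a..z} h) has_vector_derivative h x) (at x within {a..x+1})"
    by (rule integral_has_vector_derivative) (auto simp: a_def intro: continuous_on_subset[OF c])
  moreover have "at x within {a..x+1} = at x"
    by (rule at_within_interior) (auto simp: a_def)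
  ultimately have d: "((\<lambda>z. integral {a..z} h) has_vector_derivative h x) (at x)" by simp
  have "((\<lambda>z. (LINT y:{a..}|lborel. h y) - integral {a..z} h) has_vector_derivative - h x) (at x)"
    using has_vector_derivative_diff[OF has_vector_derivative_const d] by simp
  then show ?thesis
    by (rule has_vector_derivative_transform_within_open[where S = "{a<..<x+1}"])
       (use eq in \<open>auto simp: a_def\<close>)
qed

lemma tail_FTC:
  fixes H :: "real \<Rightarrow> 'a :: euclidean_space"
  assumes d: "\<And>y. y \<ge> x \<Longrightarrow> (H has_vector_derivative h y) (at y)"
    and i: "set_integrable lborel {x..} h" and l: "(H \<longlongrightarrow> L) at_top"
  shows "(LINT y:{x..}|lborel. h y) = L - H x"
proof -
  have "((\<lambda>b. LINT y:{x..b}|lborel. h y) \<longlongrightarrow> (LINT y:{x..}|lborel. h y)) at_top"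
    by (rule tendsto_set_lebesgue_integral_at_top) (use i in auto)
  moreover have "\<forall>\<^sub>F b in at_top. (LINT y:{x..b}|lborel. h y) = H b - H x"
    using eventually_ge_at_top[of x]
  proof eventually_elim
    fix b assume b: "x \<le> b"
    have "set_integrable lborel {x..b} h"
      by (rule set_integrable_subset[OF i]) auto
    then have "(LINT y:{x..b}|lborel. h y) = integral {x..b} h"
      by (rule set_borel_integral_eq_integral)
    also have "\<dots> = H b - H x"
      by (rule integral_unique[OF fundamental_theorem_of_calculus[OF b]])
         (auto intro!: has_vector_derivative_at_within d)
    finally show "(LINT y:{x..b}|lborel. h y) = H b - H x" .
  qed
  ultimately have "((\<lambda>b. H b - H x) \<longlongrightarrow> (LINT y:{x..}|lborel. h y)) at_top"
    by (rule Lim_transform_eventually)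
  moreover have "((\<lambda>b. H b - H x) \<longlongrightarrow> L - H x) at_top"
    by (intro tendsto_intros l)
  ultimately show ?thesis
    by (rule tendsto_unique[OF trivial_limit_at_top_linorder])
qed

lemma tail_dct:
  fixes s :: "nat \<Rightarrow> real \<Rightarrow> 'a :: {banach, second_countable_topology}"
  assumes "\<And>n. set_borel_measurable lborel {a..} (s n)"
    and "\<And>n y. y \<ge> a \<Longrightarrow> norm (s n y) \<le> C * kap y"
    and "\<And>y. y \<ge> a \<Longrightarrow> (\<lambda>n. s n y) \<longlonglongrightarrow> f y"
  shows "(\<lambda>n. LINT y:{a..}|lborel. s n y) \<longlonglongrightarrow> (LINT y:{a..}|lborel. f y)"
proof -
  have lim: "(\<lambda>n. indicator {a..} y *\<^sub>R s n y) \<longlonglongrightarrow> indicator {a..} y *\<^sub>R f y" for y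
    using assms(3)[of y] by (cases "y \<ge> a") auto
  have m: "(\<lambda>y. indicator {a..} y *\<^sub>R s n y) \<in> borel_measurable lborel" for n
    using assms(1)[of n] by (simp add: set_borel_measurable_def)
  have "integrable lborel (\<lambda>y. C * (indicator {a..} y *\<^sub>R (kap y * kap_tail y ^ 0)))"
    using has_bochner_integral_mult_right[OF tail_integral_kap[of a 0], of C] by (simp add: has_bochner_integral_iff)
  then show ?thesis
    unfolding set_lebesgue_integral_def
    using assms(2)
    by (intro integral_dominated_convergence[where w = "\<lambda>y. C * (indicator {a..} y *\<^sub>R (kap y * kap_tail y ^ 0))"]
        m borel_measurable_LIMSEQ_metric[OF m lim] AE_I2 lim) (auto simp: indicator_def)
qed

lemma tail_dct_within:
  fixes s :: "'b :: first_countable_topology \<Rightarrow> real \<Rightarrow> 'a :: {banach, second_countable_topology}"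
  assumes "\<And>z. z \<in> S \<Longrightarrow> set_borel_measurable lborel {a..} (s z)"
    and "\<And>z y. z \<in> S \<Longrightarrow> y \<ge> a \<Longrightarrow> norm (s z y) \<le> C * kap y"
    and "\<And>y. y \<ge> a \<Longrightarrow> ((\<lambda>z. s z y) \<longlongrightarrow> f y) (at z0 within S)"
  shows "((\<lambda>z. LINT y:{a..}|lborel. s z y) \<longlongrightarrow> (LINT y:{a..}|lborel. f y)) (at z0 within S)"
  unfolding tendsto_at_iff_sequentially comp_def
proof (intro allI impI)
  fix X assume X: "\<forall>i. X i \<in> S - {z0}" "X \<longlonglongrightarrow> z0"
  show "(\<lambda>n. LINT y:{a..}|lborel. s (X n) y) \<longlonglongrightarrow> (LINT y:{a..}|lborel. f y)"
    by (rule tail_dct[where C = C])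
       (use X assms in \<open>auto simp: tendsto_at_iff_sequentially comp_def\<close>)
qed

lemma cball_subset_cball_if_dist:
  fixes z :: "'a :: metric_space"
  assumes "dist z v < r" "2 * r \<le> e"
  shows "cball v r \<subseteq> cball z e"
proof
  fix x assume "x \<in> cball v r"
  then show "x \<in> cball z e"
    using dist_triangle[of z x v] assms by simp
qed

text \<open>Cauchy's inequality bounds the \<open>k\<close>-derivative of the integrand near
  \<open>z\<close> by \<open>w y / r\<close>. All difference quotients at \<open>z\<close> are then
  dominated by one integrable function, and dominated convergence yields the complex
  derivative.\<close>

lemma holomorphic_on_lebesgue_integral:
  fixes g :: "complex \<Rightarrow> 'a \<Rightarrow> complex"
  assumes U: "open U" and hol: "\<And>y. (\<lambda>k. g k y) holomorphic_on U"
    and m: "\<And>k. k \<in> U \<Longrightarrow> g k \<in> borel_measurable M"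
    and b: "\<And>k y. k \<in> U \<Longrightarrow> norm (g k y) \<le> w y" and w: "integrable M w"
  shows "(\<lambda>k. \<integral>y. g k y \<partial>M) holomorphic_on U"
proof -
  have "\<exists>D. ((\<lambda>k. \<integral>y. g k y \<partial>M) has_field_derivative D) (at z)" if z: "z \<in> U" for z
  proof -
    obtain e where e: "e > 0" "cball z e \<subseteq> U"
      using U z open_contains_cball by blast
    \<comment> \<open>Half the radius, so that the closed ball of radius \<open>r\<close> around
      every \<open>v\<close> in \<open>ball z r\<close> still lies in \<open>U\<close>, as Cauchy's
      inequality at \<open>v\<close> requires.\<close>
    define r where "r = e / 2"
    have r: "r > 0" "\<And>v. v \<in> ball z r \<Longrightarrow> cball v r \<subseteq> U"
    proof -
      show "r > 0" using e by (simp add: r_def)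
      fix v assume "v \<in> ball z r"
      then have "cball v r \<subseteq> cball z e"
        using cball_subset_cball_if_dist[of z v r e] by (simp add: r_def dist_commute)
      then show "cball v r \<subseteq> U" using e by blast
    qed
    have zr: "ball z r \<subseteq> U"
      using e by (auto simp: r_def subset_iff)
    have D1: "((\<lambda>k. g k y) has_field_derivative deriv (\<lambda>k. g k y) v) (at v)" if "v \<in> ball z r" for v y
      by (rule holomorphic_derivI[OF hol U]) (use that zr in blast)
    have bd: "norm (deriv (\<lambda>k. g k y) v) \<le> w y / r" if "v \<in> ball z r" for v y
    proof -
      have "norm ((deriv ^^ 1) (\<lambda>k. g k y) v) \<le> fact 1 * w y / r ^ 1"
      proof (rule Cauchy_inequality)
        show "(\<lambda>k. g k y) holomorphic_on ball v r"
          using r(2)[OF that] ball_subset_cball by (intro holomorphic_on_subset[OF hol]) blast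
        show "continuous_on (cball v r) (\<lambda>k. g k y)"
          using r(2)[OF that] by (intro holomorphic_on_imp_continuous_on holomorphic_on_subset[OF hol])
        show "norm (g x y) \<le> w y" if "norm (v - x) = r" for x
          using r(2)[OF \<open>v \<in> ball z r\<close>] that by (intro b) (auto simp: dist_norm)
      qed (use r in auto)
      then show ?thesis by simp
    qed
    have lip: "norm (g v y - g z y) \<le> w y / r * norm (v - z)" if "v \<in> ball z r" for v y
      using that r(1) bd D1
      by (intro field_differentiable_bound[where S = "ball z r" and f' = "deriv (\<lambda>k. g k y)"])
         (auto intro: has_field_derivative_at_within)
    have gi: "integrable M (g v)" if "v \<in> U" for v
      by (intro Bochner_Integration.integrable_bound[OF w m[OF that]] AE_I2)
        (metis b[OF that] abs_ge_self order_trans real_norm_def)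
    have "((\<lambda>v. ((\<integral>y. g v y \<partial>M) - (\<integral>y. g z y \<partial>M)) / (v - z)) \<longlongrightarrow> (\<integral>y. deriv (\<lambda>k. g k y) z \<partial>M)) (at z within ball z r)"
      unfolding tendsto_at_iff_sequentially comp_def
    proof (intro allI impI)
      fix X assume X: "\<forall>i. X i \<in> ball z r - {z}" "X \<longlonglongrightarrow> z"
      have eq: "((\<integral>y. g (X n) y \<partial>M) - (\<integral>y. g z y \<partial>M)) / (X n - z) = (\<integral>y. (g (X n) y - g z y) / (X n - z) \<partial>M)" for n
      proof -
        have "X n \<in> U" using X zr by auto
        then have "(\<integral>y. g (X n) y - g z y \<partial>M) = (\<integral>y. g (X n) y \<partial>M) - (\<integral>y. g z y \<partial>M)"
          by (intro Bochner_Integration.integral_diff gi z)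
        then show ?thesis by simp
      qed
      have lim: "(\<lambda>n. (g (X n) y - g z y) / (X n - z)) \<longlonglongrightarrow> deriv (\<lambda>k. g k y) z" for y
      proof -
        have "((\<lambda>v. (g v y - g z y) / (v - z)) \<longlongrightarrow> deriv (\<lambda>k. g k y) z) (at z)"
          using D1[of z y] r(1) by (simp add: has_field_derivative_iff)
        moreover have "\<forall>i. X i \<in> UNIV - {z}" using X(1) by auto
        ultimately show ?thesis
          using X(2) unfolding tendsto_at_iff_sequentially comp_def by blast
      qed
      have mm: "(\<lambda>y. (g (X n) y - g z y) / (X n - z)) \<in> borel_measurable M" for n
        using X zr z by (intro borel_measurable_divide borel_measurable_diff borel_measurable_const m) blast+
      show "(\<lambda>n. ((\<integral>y. g (X n) y \<partial>M) - (\<integral>y. g z y \<partial>M)) / (X n - z)) \<longlonglongrightarrow> (\<integral>y. deriv (\<lambda>k. g k y) z \<partial>M)"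
        unfolding eq
      proof (rule integral_dominated_convergence[where w = "\<lambda>y. w y / r"])
        show "(\<lambda>y. deriv (\<lambda>k. g k y) z) \<in> borel_measurable M"
          by (rule borel_measurable_LIMSEQ_metric[OF mm lim])
        show "AE y in M. norm ((g (X n) y - g z y) / (X n - z)) \<le> w y / r" for n
        proof (rule AE_I2)
          fix y
          have "norm (X n - z) > 0" using X(1) by auto
          moreover have "norm (g (X n) y - g z y) \<le> w y / r * norm (X n - z)"
            using X(1) by (intro lip) auto
          ultimately show "norm ((g (X n) y - g z y) / (X n - z)) \<le> w y / r"
            by (simp add: norm_divide divide_le_eq)
        qed
      qed (use w lim mm in auto)
    qed
    moreover have "at z within ball z r = at z"
      using r(1) by (intro at_within_open) auto
    ultimately show ?thesis
      unfolding has_field_derivative_iff by (metis (full_types))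
  qed
  then show ?thesis
    using U by (auto simp: holomorphic_on_open)
qed

section \<open>The Volterra system\<close>

text \<open>One operator serves both components: the first has no phase
  (\<open>R = (\<lambda>_. 0)\<close>), the second has \<open>R = P\<close>. Monotonicity of
  \<open>R\<close> keeps the exponential bounded by 1 for \<open>y \<ge> x\<close> and
  \<open>Im k \<ge> 0\<close>.\<close>

definition vop ::
    "(real \<Rightarrow> real) \<Rightarrow> (real \<Rightarrow> real) \<Rightarrow> (real \<Rightarrow> complex \<Rightarrow> complex) \<Rightarrow> real \<Rightarrow> complex \<Rightarrow> complex" where
  "vop R q \<phi> x k =
     (LINT y:{x..}|lborel. exp (2 * \<i> * k * of_real (R y - R x)) * of_real (q y) * \<phi> y k)"

lemma norm_phase_le_1:
  assumes "0 \<le> Im k" "0 \<le> c"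
  shows "norm (exp (2 * \<i> * k * of_real c)) \<le> 1"
proof -
  have "Re (2 * \<i> * k * of_real c) = - (2 * (Im k * c))" by simp
  moreover have "0 \<le> Im k * c" using assms by simp
  ultimately show ?thesis unfolding norm_exp_eq_Re by (simp add: mult.commute)
qed

lemma exp_of_real_diff:
  fixes c :: complex
  shows "exp (c * of_real (a - b)) = exp (- (c * of_real b)) * exp (c * of_real a)"
proof -
  have "c * of_real (a - b) = - (c * of_real b) + c * of_real a"
    by (simp add: right_diff_distrib)
  then show ?thesis by (simp only: exp_add)
qed

text \<open>Moves the \<open>x\<close>-dependence of the kernel out of the integral. Only the lower
  limit of the remaining integral depends on \<open>x\<close>, so the fundamental theorem of
  calculus applies.\<close>

lemma vop_factor:
  "vop R q \<phi> x k = exp (- (2 * \<i> * k * of_real (R x))) *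
     (LINT y:{x..}|lborel. exp (2 * \<i> * k * of_real (R y)) * of_real (q y) * \<phi> y k)"
proof -
  have "exp (2 * \<i> * k * of_real (R y - R x)) * of_real (q y) * \<phi> y k =
      exp (- (2 * \<i> * k * of_real (R x))) * (exp (2 * \<i> * k * of_real (R y)) * of_real (q y) * \<phi> y k)" for y
    unfolding exp_of_real_diff by (simp only: mult.assoc)
  then show ?thesis
    unfolding vop_def by (simp only: set_integral_mult_right)
qed

locale volterra =
  fixes q P :: "real \<Rightarrow> real" and C :: real
  assumes cont_q: "continuous_on UNIV q" and q_bound: "\<And>y. \<bar>q y\<bar> \<le> C * kap y"
    and cont_P: "continuous_on UNIV P" and mono_P: "mono P"
begin

lemma C_nonneg: "0 \<le> C"
  using q_bound[of 0] kap_pos[of 0] by (smt (verit) mult_neg_pos)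

text \<open>Size, continuity in each variable and analyticity in \<open>k\<close> are bundled so
  that a single induction carries them through the Neumann series; \<open>n\<close> counts the
  powers of \<open>kap_tail\<close> gained so far.\<close>

definition vclass :: "real \<Rightarrow> nat \<Rightarrow> (real \<Rightarrow> complex \<Rightarrow> complex) \<Rightarrow> bool" where
  "vclass K n \<phi> \<longleftrightarrow>
     (\<forall>k. Im k \<ge> 0 \<longrightarrow> continuous_on UNIV (\<lambda>x. \<phi> x k) \<and> (\<forall>x. norm (\<phi> x k) \<le> K * kap_tail x ^ n)) \<and>
     (\<forall>x. continuous_on {k. Im k \<ge> 0} (\<phi> x)) \<and> (\<forall>x. \<phi> x holomorphic_on {k. Im k > 0})"

lemma vclassD:
  assumes "vclass K n \<phi>"
  shows "Im k \<ge> 0 \<Longrightarrow> continuous_on A (\<lambda>x. \<phi> x k)"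
    and "Im k \<ge> 0 \<Longrightarrow> norm (\<phi> x k) \<le> K * kap_tail x ^ n"
    and "continuous_on {k. Im k \<ge> 0} (\<phi> x)" and "\<phi> x holomorphic_on {k. Im k > 0}"
  using assms unfolding vclass_def by (auto intro: continuous_on_subset)

context
  fixes R :: "real \<Rightarrow> real" and K n \<phi>
  assumes cont_R: "continuous_on UNIV R" and mono_R: "mono R" and \<phi>: "vclass K n \<phi>"
begin

lemma K_nonneg: "0 \<le> K"
proof -
  have "0 \<le> K * kap_tail 0 ^ n"
    using order_trans[OF norm_ge_zero vclassD(2)[OF \<phi>, of 0 0]] by simp
  then show ?thesis
    using kap_tail_pos[of 0] by (simp add: zero_le_mult_iff) (metis less_le_not_le zero_less_power)
qed

lemma integrand_bound:
  assumes "Im k \<ge> 0" "y \<ge> x"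
  shows "norm (exp (2 * \<i> * k * of_real (R y - R x)) * of_real (q y) * \<phi> y k) \<le> C * K * (kap y * kap_tail y ^ n)"
proof -
  have "norm (exp (2 * \<i> * k * of_real (R y - R x)) * of_real (q y) * \<phi> y k)
      \<le> 1 * (C * kap y) * (K * kap_tail y ^ n)"
    unfolding norm_mult using assms mono_R
    by (intro mult_mono norm_phase_le_1 vclassD(2)[OF \<phi>] mult_nonneg_nonneg C_nonneg)
       (auto simp: monoD q_bound less_imp_le[OF kap_pos] C_nonneg)
  then show ?thesis by (simp add: algebra_simps)
qed

lemma integrand_bound':
  assumes "Im k \<ge> 0" "y \<ge> x"
  shows "norm (exp (2 * \<i> * k * of_real (R y - R x)) * of_real (q y) * \<phi> y k) \<le> C * K * pi ^ n * kap y"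
proof -
  have "C * K * (kap y * kap_tail y ^ n) \<le> C * K * (kap y * pi ^ n)"
    using C_nonneg K_nonneg kap_pos[of y] kap_tail_pos[of y] kap_tail_le_pi[of y]
    by (intro mult_left_mono power_mono) auto
  with integrand_bound[OF assms] show ?thesis by (simp add: mult_ac)
qed

lemma integrand_continuous:
  assumes "Im k \<ge> 0"
  shows "continuous_on UNIV (\<lambda>y. exp (2 * \<i> * k * of_real (R y - c)) * of_real (q y) * \<phi> y k)"
  by (intro continuous_intros cont_R cont_q vclassD(1)[OF \<phi>] assms)

lemma integrand_integrable:
  assumes "Im k \<ge> 0"
  shows "set_integrable lborel {x..} (\<lambda>y. exp (2 * \<i> * k * of_real (R y - R x)) * of_real (q y) * \<phi> y k)"
  using integrand_bound[OF assms]
  by (intro tail_bound_integrable[where C = "C * K" and n = n] set_borel_measurable_continuous_UNIV integrand_continuous assms)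

lemma integrand_integrable':
  assumes "Im k \<ge> 0"
  shows "set_integrable lborel {x..} (\<lambda>y. exp (2 * \<i> * k * of_real (R y)) * of_real (q y) * \<phi> y k)"
proof -
  have eq: "exp (2 * \<i> * k * of_real (R y)) * of_real (q y) * \<phi> y k = exp (2 * \<i> * k * of_real (R x)) *
      (exp (2 * \<i> * k * of_real (R y - R x)) * of_real (q y) * \<phi> y k)" for y
    unfolding exp_of_real_diff by (simp add: exp_minus)
  show ?thesis
    unfolding eq by (intro set_integrable_mult_right integrand_integrable assms)
qed

lemma tail_integral_has_vector_derivative:
  assumes "Im k \<ge> 0"
  shows "((\<lambda>x. LINT y:{x..}|lborel. exp (2 * \<i> * k * of_real (R y)) * of_real (q y) * \<phi> y k)
     has_vector_derivative - (exp (2 * \<i> * k * of_real (R x)) * of_real (q x) * \<phi> x k)) (at x)"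
  using tail_has_vector_derivative[OF _ integrand_integrable'[OF assms]] integrand_continuous[OF assms, of 0]
  by simp

lemma vop_norm:
  assumes "Im k \<ge> 0"
  shows "norm (vop R q \<phi> x k) \<le> K * C / Suc n * kap_tail x ^ Suc n"
proof -
  have "norm (vop R q \<phi> x k) \<le> (C * K) * kap_tail x ^ Suc n / Suc n"
    unfolding vop_def using integrand_bound[OF assms]
    by (intro tail_bound_norm[where C = "C * K" and n = n] set_borel_measurable_continuous_UNIV integrand_continuous assms)
  then show ?thesis by (simp add: mult_ac)
qed

text \<open>The size comes from \<open>tail_bound_norm\<close>, continuity in \<open>k\<close> from
  dominated convergence with a multiple of \<open>kap\<close>, analyticity from differentiation
  under the integral.\<close>

lemma vop_vclass: "vclass (K * C / Suc n) (Suc n) (vop R q \<phi>)"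
  unfolding vclass_def
proof (intro conjI allI impI)
  fix k :: complex assume k: "0 \<le> Im k"
  have "continuous_on UNIV (\<lambda>x. LINT y:{x..}|lborel. exp (2 * \<i> * k * of_real (R y)) * of_real (q y) * \<phi> y k)"
    using tail_integral_has_vector_derivative[OF k]
    by (auto simp: continuous_on_eq_continuous_within intro: has_vector_derivative_continuous)
  then show "continuous_on UNIV (\<lambda>x. vop R q \<phi> x k)"
    unfolding vop_factor by (intro continuous_intros cont_R)
  show "norm (vop R q \<phi> x k) \<le> K * C / Suc n * kap_tail x ^ Suc n" for x
    by (rule vop_norm[OF k])
next
  fix x
  show "continuous_on {k. 0 \<le> Im k} (vop R q \<phi> x)"
    unfolding continuous_on_def
  proof
    fix k0 assume k0: "k0 \<in> {k. 0 \<le> Im k}"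
    show "(vop R q \<phi> x \<longlongrightarrow> vop R q \<phi> x k0) (at k0 within {k. 0 \<le> Im k})"
      unfolding vop_def
    proof (rule tail_dct_within[where C = "C * K * pi ^ n"])
      fix y
      have "continuous_on {k. 0 \<le> Im k} (\<lambda>k. exp (2 * \<i> * k * of_real (R y - R x)) * of_real (q y) * \<phi> y k)"
        by (intro continuous_intros vclassD(3)[OF \<phi>])
      then show "((\<lambda>k. exp (2 * \<i> * k * of_real (R y - R x)) * of_real (q y) * \<phi> y k) \<longlongrightarrow>
          exp (2 * \<i> * k0 * of_real (R y - R x)) * of_real (q y) * \<phi> y k0) (at k0 within {k. 0 \<le> Im k})"
        using k0 by (simp add: continuous_on_def)
    qed (auto intro!: integrand_bound' set_borel_measurable_continuous_UNIV integrand_continuous simp del: of_real_diff)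
  qed
next
  fix x
  have "(\<lambda>k. \<integral>y. indicator {x..} y *\<^sub>R (exp (2 * \<i> * k * of_real (R y - R x)) * of_real (q y) * \<phi> y k) \<partial>lborel)
      holomorphic_on {k. 0 < Im k}"
  proof (rule holomorphic_on_lebesgue_integral[where w = "\<lambda>y. C * K * pi ^ n * (indicator {x..} y *\<^sub>R (kap y * kap_tail y ^ 0))"])
    show "open {k. 0 < Im k}" by (simp add: open_halfspace_Im_gt)
    show "integrable lborel (\<lambda>y. C * K * pi ^ n * (indicator {x..} y *\<^sub>R (kap y * kap_tail y ^ 0)))"
      using has_bochner_integral_mult_right[OF tail_integral_kap[of x 0], of "C * K * pi ^ n"]
      by (simp add: has_bochner_integral_iff)
    show "(\<lambda>k. indicator {x..} y *\<^sub>R (exp (2 * \<i> * k * of_real (R y - R x)) * of_real (q y) * \<phi> y k))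
        holomorphic_on {k. 0 < Im k}" for y
      unfolding scaleR_conv_of_real by (intro holomorphic_intros vclassD(4)[OF \<phi>])
  next
    fix k y assume k: "k \<in> {k. 0 < Im k}"
    show "norm (indicator {x..} y *\<^sub>R (exp (2 * \<i> * k * of_real (R y - R x)) * of_real (q y) * \<phi> y k))
        \<le> C * K * pi ^ n * (indicator {x..} y *\<^sub>R (kap y * kap_tail y ^ 0))"
      using integrand_bound'[of k x y] k by (auto simp: indicator_def)
  next
    fix k assume k: "k \<in> {k. 0 < Im k}"
    show "(\<lambda>y. indicator {x..} y *\<^sub>R (exp (2 * \<i> * k * of_real (R y - R x)) * of_real (q y) * \<phi> y k))
        \<in> borel_measurable lborel"
      using set_borel_measurable_continuous_UNIV[OF integrand_continuous[of k "R x"], of x] k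
      by (auto simp: set_borel_measurable_def)
  qed
  then show "vop R q \<phi> x holomorphic_on {k. 0 < Im k}"
    unfolding vop_def set_lebesgue_integral_def .
qed

end

lemma const_vclass: "vclass (norm c) 0 (\<lambda>x k. c)"
  by (auto simp: vclass_def)

lemma vclass_minus: "vclass K n \<phi> \<Longrightarrow> vclass K n (\<lambda>x k. - \<phi> x k)"
  by (auto simp: vclass_def intro!: continuous_intros holomorphic_intros)

text \<open>The Boolean selects the first (\<open>True\<close>) or second (\<open>False\<close>) component of the terms of the Neumann series.\<close>

primrec jterm :: "nat \<Rightarrow> bool \<Rightarrow> real \<Rightarrow> complex \<Rightarrow> complex" where
  "jterm 0 b = (\<lambda>x k. if b then 1 else 0)"
| "jterm (Suc n) b = (\<lambda>x k. if b then - vop (\<lambda>_. 0) q (jterm n False) x k else vop P q (jterm n True) x k)"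

definition jsum :: "bool \<Rightarrow> real \<Rightarrow> complex \<Rightarrow> complex" where
  "jsum b x k = (\<Sum>n. jterm n b x k)"

lemma vclass_mono:
  assumes "vclass K n \<phi>" "K \<le> K'"
  shows "vclass K' n \<phi>"
proof -
  have "K * kap_tail x ^ n \<le> K' * kap_tail x ^ n" for x
    using assms(2) kap_tail_pos[of x] by (intro mult_right_mono) auto
  then show ?thesis
    using assms(1) unfolding vclass_def by (meson order_trans)
qed

text \<open>Each application of \<open>vop\<close> contributes a factor \<open>C / Suc n\<close>,
  and these multiply to \<open>C ^ n / fact n\<close>.\<close>

lemma jterm_vclass: "vclass (C ^ n / fact n) n (jterm n b)"
proof (induction n arbitrary: b)
  case 0
  have "vclass (norm (if b then 1 else 0 :: complex)) 0 (jterm 0 b)"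
    using const_vclass[of "if b then 1 else 0"] by simp
  then show ?case by (rule vclass_mono) simp
next
  case (Suc n)
  have eq: "C ^ n / fact n * C / real (Suc n) = C ^ Suc n / fact (Suc n)" by (simp add: field_simps)
  show ?case
  proof (cases b)
    case True
    have "vclass (C ^ n / fact n * C / real (Suc n)) (Suc n) (vop (\<lambda>_. 0) q (jterm n False))"
      by (rule vop_vclass[OF _ _ Suc]) (auto simp: mono_def)
    from vclass_minus[OF this] show ?thesis using True unfolding eq by simp
  next
    case False
    have "vclass (C ^ n / fact n * C / real (Suc n)) (Suc n) (vop P q (jterm n True))"
      by (rule vop_vclass[OF cont_P mono_P Suc])
    then show ?thesis using False unfolding eq by simp
  qed
qed

lemma jterm_bound:
  assumes "Im k \<ge> 0" shows "norm (jterm n b x k) \<le> (C * pi) ^ n / fact n"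
proof -
  have "norm (jterm n b x k) \<le> C ^ n / fact n * kap_tail x ^ n"
    by (rule vclassD(2)[OF jterm_vclass assms])
  also have "\<dots> \<le> C ^ n / fact n * pi ^ n"
    using C_nonneg kap_tail_pos[of x] kap_tail_le_pi[of x] by (intro mult_left_mono power_mono) auto
  finally show ?thesis by (simp add: power_mult_distrib)
qed

lemma exp_bound_sums: "(\<lambda>n. (C * pi) ^ n / fact n) sums exp (C * pi)"
  using exp_converges[of "C * pi"] by (simp add: divide_inverse mult_ac)

lemma jterm_summable: "Im k \<ge> 0 \<Longrightarrow> summable (\<lambda>n. jterm n b x k)"
  by (rule summable_comparison_test'[OF sums_summable[OF exp_bound_sums] jterm_bound])

lemma jterm_partial_sum_bound:
  assumes "Im k \<ge> 0" shows "norm (\<Sum>n<N. jterm n b x k) \<le> exp (C * pi)"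
proof -
  have "norm (\<Sum>n<N. jterm n b x k) \<le> (\<Sum>n<N. (C * pi) ^ n / fact n)"
    by (intro sum_norm_le jterm_bound assms)
  also have "\<dots> \<le> (\<Sum>n. (C * pi) ^ n / fact n)"
    using C_nonneg by (intro sum_le_suminf sums_summable[OF exp_bound_sums]) auto
  also have "\<dots> = exp (C * pi)"
    using exp_bound_sums by (rule sums_unique[symmetric])
  finally show ?thesis .
qed

lemma jsum_LIMSEQ: "Im k \<ge> 0 \<Longrightarrow> (\<lambda>N. \<Sum>n<N. jterm n b x k) \<longlonglongrightarrow> jsum b x k"
  unfolding jsum_def by (rule summable_LIMSEQ[OF jterm_summable])

text \<open>The majorant depends on neither \<open>x\<close> nor \<open>k\<close>. Uniformity in
  both gives continuity in \<open>x\<close> and in \<open>k\<close> and, by Weierstrass' theorem,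
  analyticity in \<open>k\<close>.\<close>

lemma jsum_uniform_limit:
  "uniform_limit (UNIV \<times> {k. Im k \<ge> 0}) (\<lambda>N z. \<Sum>n<N. jterm n b (fst z) (snd z)) (\<lambda>z. jsum b (fst z) (snd z)) sequentially"
  unfolding jsum_def
  by (rule Weierstrass_m_test[where M = "\<lambda>n. (C * pi) ^ n / fact n"])
     (auto intro!: jterm_bound sums_summable[OF exp_bound_sums])

lemma jsum_vclass: "vclass (exp (C * pi)) 0 (jsum b)"
  unfolding vclass_def
proof (intro conjI allI impI)
  fix k :: complex assume k: "0 \<le> Im k"
  have u: "uniform_limit UNIV (\<lambda>N x. \<Sum>n<N. jterm n b x k) (\<lambda>x. jsum b x k) sequentially"
    using jsum_uniform_limit[of b] k by (force simp: uniform_limit_iff elim: eventually_mono)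
  show "continuous_on UNIV (\<lambda>x. jsum b x k)"
    by (rule uniform_limit_theorem[OF _ u])
       (auto intro!: continuous_intros always_eventually vclassD(1)[OF jterm_vclass] k)
  show "norm (jsum b x k) \<le> exp (C * pi) * kap_tail x ^ 0" for x
    using Lim_bounded[OF tendsto_norm[OF jsum_LIMSEQ[OF k, of b x]]] jterm_partial_sum_bound[OF k, of b x] by simp
next
  fix x
  have u: "uniform_limit {k. 0 \<le> Im k} (\<lambda>N k. \<Sum>n<N. jterm n b x k) (\<lambda>k. jsum b x k) sequentially"
    using jsum_uniform_limit[of b] by (force simp: uniform_limit_iff elim: eventually_mono)
  show "continuous_on {k. 0 \<le> Im k} (jsum b x)"
    by (rule uniform_limit_theorem[OF _ u])
       (auto intro!: continuous_intros always_eventually vclassD(3)[OF jterm_vclass])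
  show "jsum b x holomorphic_on {k. 0 < Im k}"
  proof (rule holomorphic_uniform_sequence[where f = "\<lambda>N k. \<Sum>n<N. jterm n b x k"])
    show "open {k. 0 < Im k}" by (simp add: open_halfspace_Im_gt)
    show "(\<lambda>k. \<Sum>n<N. jterm n b x k) holomorphic_on {k. 0 < Im k}" for N
      by (intro holomorphic_intros vclassD(4)[OF jterm_vclass])
    fix k assume "k \<in> {k. 0 < Im k}"
    then obtain d where "0 < d" "cball k d \<subseteq> {k. 0 < Im k}"
      using open_halfspace_Im_gt[of 0] unfolding open_contains_cball by blast
    moreover from this have "uniform_limit (cball k d) (\<lambda>N k. \<Sum>n<N. jterm n b x k) (jsum b x) sequentially"
      by (intro uniform_limit_on_subset[OF u]) auto
    ultimately show "\<exists>d>0. cball k d \<subseteq> {k. 0 < Im k} \<and>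
        uniform_limit (cball k d) (\<lambda>N k. \<Sum>n<N. jterm n b x k) (jsum b x) sequentially"
      by blast
  qed
qed

lemma vop_jsum:
  assumes R: "continuous_on UNIV R" "mono R" and k: "Im k \<ge> 0"
  shows "(\<lambda>n. vop R q (jterm n b) x k) sums vop R q (jsum b) x k"
proof -
  let ?e = "\<lambda>y. exp (2 * \<i> * k * of_real (R y - R x)) * of_real (q y)"
  have int: "set_integrable lborel {x..} (\<lambda>y. ?e y * jterm n b y k)" for n
    by (rule integrand_integrable[OF R jterm_vclass k])
  have int': "set_integrable lborel {x..} (\<lambda>y. ?e y * (\<Sum>n<N. jterm n b y k))" for N
  proof (induction N)
    case (Suc N)
    then show ?case
      using set_integral_add(1)[OF Suc int[of N]] by (simp only: sum.lessThan_Suc distrib_left)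
  qed (simp add: set_integrable_def)
  have eq: "(LINT y:{x..}|lborel. ?e y * (\<Sum>n<N. jterm n b y k)) = (\<Sum>n<N. vop R q (jterm n b) x k)" for N
  proof (induction N)
    case (Suc N)
    have "(LINT y:{x..}|lborel. ?e y * (\<Sum>n<Suc N. jterm n b y k)) =
        (LINT y:{x..}|lborel. ?e y * (\<Sum>n<N. jterm n b y k) + ?e y * jterm N b y k)"
      by (simp add: distrib_left)
    also have "\<dots> = (LINT y:{x..}|lborel. ?e y * (\<Sum>n<N. jterm n b y k)) + (LINT y:{x..}|lborel. ?e y * jterm N b y k)"
      by (rule set_integral_add(2)[OF int' int])
    finally show ?case by (simp only: Suc sum.lessThan_Suc vop_def)
  qed simp
  have "(\<lambda>N. LINT y:{x..}|lborel. ?e y * (\<Sum>n<N. jterm n b y k)) \<longlonglongrightarrow> (LINT y:{x..}|lborel. ?e y * jsum b y k)"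
  proof (rule tail_dct[where C = "C * exp (C * pi)"])
    show "set_borel_measurable lborel {x..} (\<lambda>y. ?e y * (\<Sum>n<N. jterm n b y k))" for N
      using int'[of N] by (simp add: set_integrable_def set_borel_measurable_def)
    show "norm (?e y * (\<Sum>n<N. jterm n b y k)) \<le> C * exp (C * pi) * kap y" if "x \<le> y" for N y
    proof -
      have "norm (?e y * (\<Sum>n<N. jterm n b y k)) \<le> 1 * (C * kap y) * exp (C * pi)"
        unfolding norm_mult using that R k jterm_partial_sum_bound[OF k, of b y N]
        by (intro mult_mono norm_phase_le_1 mult_nonneg_nonneg C_nonneg)
           (auto simp: monoD q_bound less_imp_le[OF kap_pos] C_nonneg)
      then show ?thesis by (simp add: mult_ac)
    qed
    show "(\<lambda>N. ?e y * (\<Sum>n<N. jterm n b y k)) \<longlonglongrightarrow> ?e y * jsum b y k" for y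
      by (intro tendsto_intros jsum_LIMSEQ k)
  qed
  then show ?thesis
    unfolding eq sums_def vop_def .
qed

lemma jsum_eq:
  assumes k: "Im k \<ge> 0"
  shows jsum_True_eq: "jsum True x k = 1 - vop (\<lambda>_. 0) q (jsum False) x k"
    and jsum_False_eq: "jsum False x k = vop P q (jsum True) x k"
proof -
  have s: "(\<Sum>n. jterm (Suc n) b x k) = jsum b x k - jterm 0 b x k" for b
    unfolding jsum_def by (rule suminf_split_head[OF jterm_summable[OF k]])
  have "(\<lambda>n. jterm (Suc n) True x k) sums - vop (\<lambda>_. 0) q (jsum False) x k"
    using sums_minus[OF vop_jsum[of "\<lambda>_. 0" k False x]] k by (simp add: mono_def)
  from trans[OF sums_unique[OF this] s]
  have "jsum True x k - 1 = - vop (\<lambda>_. 0) q (jsum False) x k" by simp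
  then have "jsum True x k = - vop (\<lambda>_. 0) q (jsum False) x k + 1"
    by (simp only: diff_eq_eq)
  then show "jsum True x k = 1 - vop (\<lambda>_. 0) q (jsum False) x k" by simp
  have "(\<lambda>n. jterm (Suc n) False x k) sums vop P q (jsum True) x k"
    using vop_jsum[OF cont_P mono_P k, of True x] by simp
  from sums_unique[OF this] show "jsum False x k = vop P q (jsum True) x k"
    using s[of False] by simp
qed

lemma jsum_bounds:
  assumes k: "Im k \<ge> 0"
  shows "norm (jsum True x k - 1) \<le> exp (C * pi) * C * kap_tail x"
    and "norm (jsum False x k) \<le> exp (C * pi) * C * kap_tail x"
  using vop_norm[OF _ _ jsum_vclass k, of "\<lambda>_. 0" False x] vop_norm[OF cont_P mono_P jsum_vclass k, of True x]
  by (simp_all add: jsum_eq[OF k] mono_def)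

lemma jsum_tendsto:
  assumes k: "Im k \<ge> 0"
  shows "((\<lambda>x. jsum True x k) \<longlongrightarrow> 1) at_top" and "((\<lambda>x. jsum False x k) \<longlongrightarrow> 0) at_top"
proof -
  have "((\<lambda>x. exp (C * pi) * C * kap_tail x) \<longlongrightarrow> exp (C * pi) * C * 0) at_top"
    by (intro tendsto_intros kap_tail_tendsto)
  then have t: "((\<lambda>x. exp (C * pi) * C * kap_tail x) \<longlongrightarrow> 0) at_top" by simp
  show "((\<lambda>x. jsum False x k) \<longlongrightarrow> 0) at_top"
    by (rule Lim_null_comparison[OF always_eventually t]) (auto intro: jsum_bounds k)
  show "((\<lambda>x. jsum True x k) \<longlongrightarrow> 1) at_top"
    unfolding LIM_zero_iff[of "\<lambda>x. jsum True x k", symmetric]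
    by (rule Lim_null_comparison[OF always_eventually t]) (auto intro: jsum_bounds k)
qed

text \<open>The differences \<open>D1\<close>, \<open>D2\<close> solve the homogeneous system, but
  only integrability of the integrands is known. This alone bounds \<open>D1\<close> on a half-line;
  inserting the bound into the two equations in turn gains one more power of
  \<open>C * kap_tail\<close> and one more factor of the factorial each time, so \<open>D1\<close>
  vanishes.\<close>

lemma jsum_unique:
  assumes k: "Im k \<ge> 0"
    and iF: "\<And>x. set_integrable lborel {x..} (\<lambda>y. of_real (q y) * G y)"
    and iG: "\<And>x. set_integrable lborel {x..} (\<lambda>y. exp (2 * \<i> * k * of_real (P y - P x)) * of_real (q y) * F y)"
    and F: "\<And>x. F x = 1 - (LINT y:{x..}|lborel. of_real (q y) * G y)"
    and G: "\<And>x. G x = (LINT y:{x..}|lborel. exp (2 * \<i> * k * of_real (P y - P x)) * of_real (q y) * F y)"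
  shows "F x = jsum True x k \<and> G x = jsum False x k"
proof -
  define a where "a = x"
  define D1 where "D1 x = F x - jsum True x k" for x
  define D2 where "D2 x = G x - jsum False x k" for x
  define E where "E x y = exp (2 * \<i> * k * of_real (P y - P x))" for x y
  have E1: "norm (E x y) \<le> 1" if "x \<le> y" for x y
    unfolding E_def using that mono_P k by (intro norm_phase_le_1) (auto simp: monoD)
  have i1: "set_integrable lborel {x..} (\<lambda>y. of_real (q y) * D2 y)" for x
  proof -
    have "set_integrable lborel {x..} (\<lambda>y. of_real (q y) * jsum False y k)"
      using integrand_integrable[of "\<lambda>_. 0", OF _ _ jsum_vclass k] by (simp add: mono_def)
    from set_integral_diff(1)[OF iF this] show ?thesis by (simp add: D2_def algebra_simps)
  qed
  have i2: "set_integrable lborel {x..} (\<lambda>y. E x y * of_real (q y) * D1 y)" for x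
  proof -
    have "set_integrable lborel {x..} (\<lambda>y. E x y * of_real (q y) * jsum True y k)"
      unfolding E_def by (rule integrand_integrable[OF cont_P mono_P jsum_vclass k])
    from set_integral_diff(1)[OF iG[folded E_def] this] show ?thesis by (simp add: D1_def algebra_simps)
  qed
  have D1: "D1 x = - (LINT y:{x..}|lborel. of_real (q y) * D2 y)" for x
  proof -
    have i: "set_integrable lborel {x..} (\<lambda>y. of_real (q y) * jsum False y k)"
      using integrand_integrable[of "\<lambda>_. 0", OF _ _ jsum_vclass k] by (simp add: mono_def)
    show ?thesis
      unfolding D1_def D2_def right_diff_distrib set_integral_diff(2)[OF iF i]
      by (simp add: F jsum_True_eq[OF k] vop_def)
  qed
  have D2: "D2 x = (LINT y:{x..}|lborel. E x y * of_real (q y) * D1 y)" for x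
  proof -
    have i: "set_integrable lborel {x..} (\<lambda>y. E x y * of_real (q y) * jsum True y k)"
      unfolding E_def by (rule integrand_integrable[OF cont_P mono_P jsum_vclass k])
    show ?thesis
      unfolding D1_def D2_def right_diff_distrib set_integral_diff(2)[OF iG[folded E_def] i]
      by (simp add: G jsum_False_eq[OF k] vop_def E_def)
  qed
  \<comment> \<open>The total mass of the first integrand beyond \<open>a\<close>; it bounds
    \<open>D1\<close> there without any prior bound on \<open>F\<close> or \<open>G\<close>.\<close>
  define B where "B = (LINT y:{a..}|lborel. norm (of_real (q y) * D2 y))"
  have nD2: "norm (LINT y:{x..}|lborel. of_real (q y) * D2 y) \<le> B" if "x \<ge> a" for x
  proof -
    have "norm (LINT y:{x..}|lborel. of_real (q y) * D2 y) \<le> (LINT y:{x..}|lborel. norm (of_real (q y) * D2 y))"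
      by (rule set_integral_norm_bound[OF i1])
    also have "\<dots> \<le> B"
      unfolding B_def set_lebesgue_integral_def
      using set_integrable_norm[OF i1[of x]] set_integrable_norm[OF i1[of a]] that
      by (intro integral_mono) (auto simp: set_integrable_def indicator_def)
    finally show ?thesis .
  qed
  have B1: "norm (D1 x) \<le> B" if "x \<ge> a" for x
    using nD2[OF that] by (simp add: D1)
  have B0: "0 \<le> B" using B1[of a] norm_ge_zero[of "D1 a"] by linarith
  have b2: "norm (D2 x) \<le> B * C ^ Suc n / fact (Suc n) * kap_tail x ^ Suc n"
    if "x \<ge> a" and "\<And>y. y \<ge> a \<Longrightarrow> norm (D1 y) \<le> B * C ^ n / fact n * kap_tail y ^ n" for x n
  proof -
    have "norm (D2 x) \<le> (B * C ^ Suc n / fact n) * kap_tail x ^ Suc n / Suc n"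
      unfolding D2
    proof (rule tail_bound_norm)
      show "set_borel_measurable lborel {x..} (\<lambda>y. E x y * of_real (q y) * D1 y)"
        using i2[of x] by (simp add: set_integrable_def set_borel_measurable_def)
      fix y assume "y \<ge> x"
      then have "norm (E x y * of_real (q y) * D1 y) \<le> 1 * (C * kap y) * (B * C ^ n / fact n * kap_tail y ^ n)"
        unfolding norm_mult using that
        by (intro mult_mono mult_nonneg_nonneg C_nonneg E1) (auto simp: q_bound less_imp_le[OF kap_pos] C_nonneg)
      then show "norm (E x y * of_real (q y) * D1 y) \<le> B * C ^ Suc n / fact n * (kap y * kap_tail y ^ n)"
        by (simp add: mult_ac)
    qed
    then show ?thesis by (simp add: field_simps)
  qed
  have b1: "norm (D1 x) \<le> B * C ^ Suc n / fact (Suc n) * kap_tail x ^ Suc n"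
    if "x \<ge> a" and "\<And>y. y \<ge> a \<Longrightarrow> norm (D2 y) \<le> B * C ^ n / fact n * kap_tail y ^ n" for x n
  proof -
    have "norm (LINT y:{x..}|lborel. of_real (q y) * D2 y) \<le> (B * C ^ Suc n / fact n) * kap_tail x ^ Suc n / Suc n"
    proof (rule tail_bound_norm)
      show "set_borel_measurable lborel {x..} (\<lambda>y. of_real (q y) * D2 y)"
        using i1[of x] by (simp add: set_integrable_def set_borel_measurable_def)
      fix y assume "y \<ge> x"
      then have "norm (of_real (q y) * D2 y) \<le> (C * kap y) * (B * C ^ n / fact n * kap_tail y ^ n)"
        unfolding norm_mult using that
        by (intro mult_mono mult_nonneg_nonneg C_nonneg) (auto simp: q_bound less_imp_le[OF kap_pos] C_nonneg)
      then show "norm (of_real (q y) * D2 y) \<le> B * C ^ Suc n / fact n * (kap y * kap_tail y ^ n)"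
        by (simp add: mult_ac)
    qed
    then show ?thesis by (simp add: D1 field_simps)
  qed
  \<comment> \<open>One round through both equations advances the exponent by two.\<close>
  have even: "(\<forall>y\<ge>a. norm (D1 y) \<le> B * C ^ (2 * m) / fact (2 * m) * kap_tail y ^ (2 * m))" for m
  proof (induction m)
    case (Suc m)
    have "\<forall>y\<ge>a. norm (D2 y) \<le> B * C ^ Suc (2 * m) / fact (Suc (2 * m)) * kap_tail y ^ Suc (2 * m)"
      using b2 Suc by blast
    then have "\<forall>y\<ge>a. norm (D1 y) \<le> B * C ^ Suc (Suc (2 * m)) / fact (Suc (Suc (2 * m))) * kap_tail y ^ Suc (Suc (2 * m))"
      using b1 by blast
    then show ?case by (simp only: mult_Suc_right add_2_eq_Suc)
  qed (use B1 in simp)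
  have D1z: "D1 y = 0" if y: "y \<ge> a" for y
  proof -
    have "(\<lambda>n. (C * kap_tail y) ^ n / fact n) \<longlonglongrightarrow> 0"
      using summable_LIMSEQ_zero[OF sums_summable[OF exp_converges[of "C * kap_tail y"]]]
      by (simp add: divide_inverse mult_ac)
    then have "(\<lambda>m. (C * kap_tail y) ^ (2 * m) / fact (2 * m)) \<longlonglongrightarrow> 0"
      by (rule LIMSEQ_subseq_LIMSEQ[where f = "\<lambda>m. 2 * m", unfolded comp_def]) (simp add: strict_mono_def)
    from tendsto_mult_left[OF this, of B]
    have l: "(\<lambda>m. B * ((C * kap_tail y) ^ (2 * m) / fact (2 * m))) \<longlonglongrightarrow> 0" by (simp only: mult_zero_right)
    have "norm (D1 y) \<le> 0"
      by (rule LIMSEQ_le_const[OF l]) (use even y in \<open>auto simp: power_mult_distrib mult_ac\<close>)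
    then show ?thesis by simp
  qed
  have "D2 a = (LINT y:{a..}|lborel. 0)"
    unfolding D2 by (intro set_lebesgue_integral_cong) (auto simp: D1z)
  then have "D2 a = 0" by (simp add: set_lebesgue_integral_def)
  with D1z[of a] show ?thesis by (simp add: D1_def D2_def a_def)
qed

lemma vop_has_vector_derivative:
  assumes R: "continuous_on UNIV R" "mono R" and \<phi>: "vclass K n \<phi>" and k: "Im k \<ge> 0"
    and d: "(R has_real_derivative r) (at x)"
  shows "((\<lambda>x. vop R q \<phi> x k) has_vector_derivative
     - (of_real (q x) * \<phi> x k) - 2 * \<i> * k * of_real r * vop R q \<phi> x k) (at x)"
proof -
  let ?T = "\<lambda>x. LINT y:{x..}|lborel. exp (2 * \<i> * k * of_real (R y)) * of_real (q y) * \<phi> y k"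
  let ?E = "exp (- (2 * \<i> * k * of_real (R x)))"
  have "((\<lambda>x. complex_of_real (R x)) has_vector_derivative of_real r) (at x)"
    using d has_vector_derivative_of_real[of R r] by (simp add: has_real_derivative_iff_has_vector_derivative)
  then have e: "((\<lambda>x. exp (- (2 * \<i> * k * of_real (R x)))) has_vector_derivative
      of_real r * ((- (2 * \<i> * k)) * ?E)) (at x)"
    by (rule field_vector_diff_chain_at[where g = "\<lambda>z. exp (- (2 * \<i> * k * z))", unfolded comp_def])
       (auto intro!: derivative_eq_intros)
  have "((\<lambda>x. vop R q \<phi> x k) has_vector_derivative
      ?E * (- (exp (2 * \<i> * k * of_real (R x)) * of_real (q x) * \<phi> x k)) + of_real r * ((- (2 * \<i> * k)) * ?E) * ?T x) (at x)"
    unfolding vop_factor by (rule has_vector_derivative_mult[OF e tail_integral_has_vector_derivative[OF R \<phi> k]])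
  also have "?E * (- (exp (2 * \<i> * k * of_real (R x)) * of_real (q x) * \<phi> x k)) + of_real r * ((- (2 * \<i> * k)) * ?E) * ?T x
     = - (of_real (q x) * \<phi> x k) - 2 * \<i> * k * of_real r * vop R q \<phi> x k"
    unfolding vop_factor by (simp add: exp_minus)
  finally show ?thesis .
qed

end

section \<open>Jost solutions\<close>

lemma has_vector_derivative_complex_of_real:
  assumes "(R has_real_derivative r) (at x)"
  shows "((\<lambda>x. complex_of_real (R x)) has_vector_derivative of_real r) (at x)"
  by (rule has_vector_derivative_of_real) (use assms in \<open>simp add: has_real_derivative_iff_has_vector_derivative\<close>)

lemma has_vector_derivative_exp:
  fixes c :: complex
  assumes "(R has_real_derivative r) (at y)"
  shows "((\<lambda>y. exp (c * of_real (R y - d))) has_vector_derivative c * of_real r * exp (c * of_real (R y - d))) (at y)"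
proof -
  have "((\<lambda>y. R y - d) has_real_derivative r) (at y)"
    using DERIV_diff[OF assms DERIV_const[of d]] by simp
  from has_vector_derivative_complex_of_real[OF this]
  have "((\<lambda>y. exp (c * of_real (R y - d))) has_vector_derivative
      of_real r * (c * exp (c * of_real (R y - d)))) (at y)"
    by (rule field_vector_diff_chain_at[where g = "\<lambda>z. exp (c * z)", unfolded comp_def])
       (auto intro!: derivative_eq_intros)
  then show ?thesis by (simp add: mult_ac)
qed

text \<open>The derivatives and the phase are parameters, and \<open>P\<close> is prescribed only
  through its derivative, so that the potential reflected at the origin, with phase
  \<open>- P (- x)\<close>, is an instance as well.\<close>

locale jost =
  fixes w w1 w2 w3 P :: "real \<Rightarrow> real" and C0 :: real
  assumes dw: "\<And>x. (w has_real_derivative w1 x) (at x)"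
    and dw1: "\<And>x. (w1 has_real_derivative w2 x) (at x)"
    and dw2: "\<And>x. (w2 has_real_derivative w3 x) (at x)"
    and cont_w3: "continuous_on UNIV w3"
    and bw: "\<And>x. \<bar>w x\<bar> \<le> C0 * kap x" and bw1: "\<And>x. \<bar>w1 x\<bar> \<le> C0 * kap x"
    and bw2: "\<And>x. \<bar>w2 x\<bar> \<le> C0 * kap x" and bw3: "\<And>x. \<bar>w3 x\<bar> \<le> C0 * kap x"
    and dP: "\<And>x. (P has_real_derivative sqrt (1 + (w1 x)\<^sup>2)) (at x)"
begin

definition h :: "real \<Rightarrow> real" where "h x = sqrt (1 + (w1 x)\<^sup>2)"
definition q :: "real \<Rightarrow> real" where "q x = w2 x / (2 * (1 + (w1 x)\<^sup>2))"

lemma h_ge_1: "1 \<le> h x" by (simp add: h_def)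

lemma h_sq: "(h x)\<^sup>2 = 1 + (w1 x)\<^sup>2" by (simp add: h_def add_nonneg_nonneg)

lemma q_alt: "q x = w2 x / (2 * (h x)\<^sup>2)" by (simp add: q_def h_sq)

lemma cont_w1: "continuous_on A w1" and cont_w2: "continuous_on A w2"
  using dw1 dw2 by (meson DERIV_isCont continuous_at_imp_continuous_on)+

lemma cont_h: "continuous_on A h"
  unfolding h_def by (intro continuous_intros cont_w1)

lemma C0_nonneg: "0 \<le> C0"
  using bw[of 0] kap_pos[of 0] by (smt (verit) mult_neg_pos)

lemma h_minus_1: "\<bar>h x - 1\<bar> \<le> C0 * kap x"
proof -
  have "h x \<le> 1 + \<bar>w1 x\<bar>"
    unfolding h_def by (rule real_le_lsqrt) (auto simp: power2_eq_square algebra_simps)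
  with h_ge_1[of x] bw1[of x] show ?thesis by simp
qed

lemma q_le: "\<bar>q x\<bar> \<le> C0 * kap x"
proof -
  have "\<bar>q x\<bar> = \<bar>w2 x\<bar> / (2 * (1 + (w1 x)\<^sup>2))" by (simp add: q_def abs_mult)
  also have "\<dots> \<le> \<bar>w2 x\<bar> / 1" by (intro divide_left_mono) (auto simp: add_pos_nonneg)
  finally show ?thesis using bw2[of x] by simp
qed

lemma w1_tendsto: "(w1 \<longlongrightarrow> 0) at_top" and w_tendsto: "(w \<longlongrightarrow> 0) at_top"
proof -
  have t: "((\<lambda>x. C0 * kap x) \<longlongrightarrow> 0) at_top"
    using tendsto_mult_left[OF tendsto_kap, of C0] by simp
  show "(w1 \<longlongrightarrow> 0) at_top"
    by (rule Lim_null_comparison[OF always_eventually t]) (use bw1 in simp)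
  show "(w \<longlongrightarrow> 0) at_top"
    by (rule Lim_null_comparison[OF always_eventually t]) (use bw in simp)
qed

sublocale volterra q P C0
proof
  show "continuous_on UNIV q"
    unfolding q_def
    by (intro continuous_intros cont_w1 cont_w2) (auto simp: add_nonneg_eq_0_iff)
  show "\<bar>q y\<bar> \<le> C0 * kap y" for y by (rule q_le)
  show "continuous_on UNIV P"
    using dP by (meson DERIV_isCont continuous_at_imp_continuous_on)
  show "mono P"
  proof (rule monoI)
    fix x y :: real assume "x \<le> y"
    then show "P x \<le> P y"
      by (rule DERIV_nonneg_imp_nondecreasing) (use dP in \<open>auto intro!: exI simp: add_nonneg_nonneg\<close>)
  qed
qed

abbreviation f :: "real \<Rightarrow> complex \<Rightarrow> complex" where "f \<equiv> jsum True"
abbreviation g :: "real \<Rightarrow> complex \<Rightarrow> complex" where "g \<equiv> jsum False"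

lemma deriv_f:
  assumes k: "Im k \<ge> 0"
  shows "((\<lambda>x. f x k) has_vector_derivative of_real (q x) * g x k) (at x)"
proof -
  have "((\<lambda>x. vop (\<lambda>_. 0) q g x k) has_vector_derivative
     - (of_real (q x) * g x k) - 2 * \<i> * k * of_real 0 * vop (\<lambda>_. 0) q g x k) (at x)"
    by (rule vop_has_vector_derivative[OF _ _ jsum_vclass k]) (auto simp: mono_def)
  from has_vector_derivative_diff[OF has_vector_derivative_const[of 1] this]
  show ?thesis by (simp add: jsum_True_eq[OF k, abs_def])
qed

lemma deriv_g:
  assumes k: "Im k \<ge> 0"
  shows "((\<lambda>x. g x k) has_vector_derivative - (of_real (q x) * f x k) - 2 * \<i> * k * of_real (h x) * g x k) (at x)"
  using vop_has_vector_derivative[OF cont_P mono_P jsum_vclass[of True] k dP[of x]]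
  by (simp add: jsum_False_eq[OF k, abs_def, symmetric] h_def)

lemma dh: "(h has_real_derivative w1 x * w2 x / h x) (at x)"
proof -
  have p: "0 < 1 + (w1 x)\<^sup>2" by (simp add: add_pos_nonneg)
  have "((\<lambda>x. 1 + (w1 x)\<^sup>2) has_real_derivative 2 * w1 x * w2 x) (at x)"
    by (auto intro!: derivative_eq_intros dw1)
  from DERIV_chain2[OF DERIV_real_sqrt[OF p] this]
  have "(h has_real_derivative inverse (h x) / 2 * (2 * w1 x * w2 x)) (at x)"
    by (simp only: h_def[abs_def])
  moreover have "inverse (h x) / 2 * (2 * w1 x * w2 x) = w1 x * w2 x / h x"
    by (simp add: field_simps)
  ultimately show ?thesis by simp
qed

subsection \<open>Large spectral parameter\<close>

text \<open>The quotient \<open>q / h\<close>. It arises when the phase, whose derivative is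
  proportional to \<open>h\<close>, is integrated by parts against \<open>q\<close>.\<close>

definition s :: "real \<Rightarrow> real" where "s x = w2 x / (2 * (h x) ^ 3)"
definition s1 :: "real \<Rightarrow> real" where
  "s1 x = w3 x / (2 * (h x) ^ 3) - 3 * w1 x * (w2 x)\<^sup>2 / (2 * (h x) ^ 5)"

lemma ds: "(s has_real_derivative s1 x) (at x)"
proof -
  have h: "h x \<noteq> 0" using h_ge_1[of x] by simp
  show ?thesis
    unfolding s_def s1_def using h
    by (auto intro!: derivative_eq_intros dw2 dh simp: field_simps power2_eq_square eval_nat_numeral)
qed

lemma div_le_self:
  fixes c d :: real
  assumes "1 \<le> d" shows "\<bar>c / d\<bar> \<le> \<bar>c\<bar>"
proof -
  have "\<bar>c / d\<bar> = \<bar>c\<bar> / d" using assms by simp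
  also have "\<dots> \<le> \<bar>c\<bar> / 1" using assms by (intro divide_left_mono) auto
  finally show ?thesis by simp
qed

lemma h_pow: "1 \<le> 2 * (h x) ^ n"
  using one_le_power[OF h_ge_1, of x n] by simp

lemma bs: "\<bar>s x\<bar> \<le> C0 * kap x"
  unfolding s_def by (rule order_trans[OF div_le_self[OF h_pow] bw2])

lemma bs1: "\<bar>s1 x\<bar> \<le> (C0 + 3 * C0 ^ 3) * kap x"
proof -
  have k1: "kap x \<le> 1" "0 \<le> kap x" using kap_le_1[of x] kap_pos[of x] by auto
  have c: "C0 * kap x \<le> C0" using k1 C0_nonneg by (simp add: mult_left_le)
  have w12: "\<bar>w1 x\<bar> \<le> C0" "\<bar>w2 x\<bar> \<le> C0" using c bw1[of x] bw2[of x] by auto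
  have "\<bar>3 * w1 x * (w2 x)\<^sup>2\<bar> = 3 * (\<bar>w1 x\<bar> * \<bar>w2 x\<bar> * \<bar>w2 x\<bar>)"
    by (simp add: abs_mult power2_eq_square)
  also have "\<dots> \<le> 3 * (C0 * C0 * (C0 * kap x))"
    using w12 bw2[of x] C0_nonneg by (intro mult_left_mono mult_mono) auto
  finally have "\<bar>3 * w1 x * (w2 x)\<^sup>2\<bar> \<le> 3 * C0 ^ 3 * kap x" by (simp add: power3_eq_cube)
  moreover have "\<bar>s1 x\<bar> \<le> \<bar>w3 x\<bar> + \<bar>3 * w1 x * (w2 x)\<^sup>2\<bar>"
    unfolding s1_def using div_le_self[OF h_pow[of x 3], of "w3 x"] div_le_self[OF h_pow[of x 5], of "3 * w1 x * (w2 x)\<^sup>2"]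
    by linarith
  ultimately show ?thesis using bw3[of x] by (simp add: algebra_simps)
qed

lemma h_s: "h x * s x = q x"
  using h_ge_1[of x] by (simp add: s_def q_alt power2_eq_square power3_eq_cube)

lemma cont_s: "continuous_on A s" and cont_s1: "continuous_on A s1"
proof -
  show "continuous_on A s"
    using ds by (meson DERIV_isCont continuous_at_imp_continuous_on)
  have "h x \<noteq> 0" for x using h_ge_1[of x] by simp
  then show "continuous_on A s1"
    unfolding s1_def
    by (intro continuous_intros cont_h cont_w1 cont_w2 continuous_on_subset[OF cont_w3]) auto
qed

definition B :: real where "B = exp (C0 * pi)"

lemma B_pos: "0 < B" by (simp add: B_def)

lemma jsum_le_B: "Im k \<ge> 0 \<Longrightarrow> norm (jsum b x k) \<le> B"
  using vclassD(2)[OF jsum_vclass, of k b x] by (simp add: B_def)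

lemma jsum_cont: "Im k \<ge> 0 \<Longrightarrow> continuous_on A (\<lambda>x. jsum b x k)"
  by (rule vclassD(1)[OF jsum_vclass])

lemma jsum_cont_k: "continuous_on {k. Im k \<ge> 0} (jsum b x)"
  by (rule vclassD(3)[OF jsum_vclass])

lemma jsum_hol: "jsum b x holomorphic_on {k. Im k > 0}"
  by (rule vclassD(4)[OF jsum_vclass])

text \<open>The first summand bounds the boundary term of the integration by parts in
  \<open>g_large\<close>; the second bounds the remaining integral, \<open>pi\<close> being the
  bound of \<open>kap_tail\<close>.\<close>

definition KL :: real where
  "KL = C0 * B + ((C0 + 3 * C0 ^ 3) * B + C0 * C0 * B) * pi"

lemma KL_nonneg: "0 \<le> KL"
  unfolding KL_def using C0_nonneg B_pos by (intro add_nonneg_nonneg mult_nonneg_nonneg) auto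

text \<open>Integration by parts against the oscillating phase: because \<open>q = h * s\<close>,
  the integrand \<open>2 * \<i> * k * E * q * f\<close> is the derivative of
  \<open>E * s * f\<close> minus a remainder that is dominated uniformly in
  \<open>k\<close>.\<close>

lemma g_large:
  assumes k: "Im k \<ge> 0"
  shows "norm (2 * k) * norm (g x k) \<le> KL"
proof -
  let ?E = "\<lambda>y. exp (2 * \<i> * k * of_real (P y - P x))"
  let ?G = "\<lambda>y. ?E y * (of_real (s1 y) * f y k + of_real (s y) * of_real (q y) * g y k)"
  let ?K = "(C0 + 3 * C0 ^ 3) * B + C0 * C0 * B"
  have E1: "norm (?E y) \<le> 1" if "y \<ge> x" for y
    using that mono_P k by (intro norm_phase_le_1) (auto simp: monoD)
  have d: "((\<lambda>y. ?E y * (of_real (s y) * f y k)) has_vector_derivative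
      2 * \<i> * k * (?E y * of_real (q y) * f y k) + ?G y) (at y)" for y
  proof -
    have ds': "((\<lambda>y. complex_of_real (s y)) has_vector_derivative of_real (s1 y)) (at y)"
      by (rule has_vector_derivative_complex_of_real[OF ds])
    have "((\<lambda>y. ?E y * (of_real (s y) * f y k)) has_vector_derivative
       ?E y * (of_real (s y) * (of_real (q y) * g y k) + of_real (s1 y) * f y k)
       + 2 * \<i> * k * of_real (h y) * ?E y * (of_real (s y) * f y k)) (at y)"
      using dP[of y, folded h_def]
      by (intro has_vector_derivative_mult has_vector_derivative_exp ds' deriv_f k)
    moreover have "?E y * (of_real (s y) * (of_real (q y) * g y k) + of_real (s1 y) * f y k)
       + 2 * \<i> * k * of_real (h y) * ?E y * (of_real (s y) * f y k) = 2 * \<i> * k * (?E y * of_real (q y) * f y k) + ?G y"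
      unfolding h_s[of y, symmetric] of_real_mult by algebra
    ultimately show ?thesis by simp
  qed
  have bG: "norm (?G y) \<le> ?K * (kap y * kap_tail y ^ 0)" if "y \<ge> x" for y
  proof -
    have k1: "kap y \<le> 1" "0 \<le> kap y" using kap_le_1[of y] kap_pos[of y] by auto
    have "norm (of_real (s1 y) * f y k) \<le> (C0 + 3 * C0 ^ 3) * kap y * B"
      unfolding norm_mult using bs1[of y] jsum_le_B[OF k, of True y] C0_nonneg k1
      by (intro mult_mono) auto
    moreover have "norm (of_real (s y) * of_real (q y) * g y k) \<le> (C0 * kap y) * C0 * B"
    proof -
      have "C0 * kap y \<le> C0" using k1 C0_nonneg by (simp add: mult_left_le)
      then have "\<bar>q y\<bar> \<le> C0" using q_le[of y] by linarith
      then show ?thesis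
        unfolding norm_mult using bs[of y] jsum_le_B[OF k, of False y] C0_nonneg k1 B_pos
        by (intro mult_mono) auto
    qed
    ultimately have "norm (of_real (s1 y) * f y k + of_real (s y) * of_real (q y) * g y k) \<le> ?K * kap y"
      by (intro norm_triangle_le) (simp add: algebra_simps)
    with E1[OF that] have "norm (?E y) * norm (of_real (s1 y) * f y k + of_real (s y) * of_real (q y) * g y k) \<le> 1 * (?K * kap y)"
      by (intro mult_mono) auto
    then show ?thesis by (simp add: norm_mult)
  qed
  have cG: "continuous_on UNIV ?G"
    by (intro continuous_intros cont_P cont_s cont_s1 cont_q jsum_cont k)
  have iG: "set_integrable lborel {x..} ?G"
    by (rule tail_bound_integrable[OF set_borel_measurable_continuous_UNIV[OF cG] bG])
  have iq: "set_integrable lborel {x..} (\<lambda>y. 2 * \<i> * k * (?E y * of_real (q y) * f y k))"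
    by (intro set_integrable_mult_right integrand_integrable[OF cont_P mono_P jsum_vclass k])
  have t: "((\<lambda>y. C0 * B * kap y) \<longlongrightarrow> 0) at_top"
    using tendsto_mult_left[OF tendsto_kap, of "C0 * B"] by simp
  have lim: "((\<lambda>y. ?E y * (of_real (s y) * f y k)) \<longlongrightarrow> 0) at_top"
  proof (rule Lim_null_comparison[OF _ t])
    show "\<forall>\<^sub>F y in at_top. norm (?E y * (of_real (s y) * f y k)) \<le> C0 * B * kap y"
      using eventually_ge_at_top[of x]
    proof eventually_elim
      fix y assume "x \<le> y"
      then have "norm (?E y * (of_real (s y) * f y k)) \<le> 1 * ((C0 * kap y) * B)"
        unfolding norm_mult using bs[of y] jsum_le_B[OF k, of True y] C0_nonneg kap_pos[of y]
        by (intro mult_mono E1) auto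
      then show "norm (?E y * (of_real (s y) * f y k)) \<le> C0 * B * kap y" by (simp add: mult_ac)
    qed
  qed
  have "(LINT y:{x..}|lborel. 2 * \<i> * k * (?E y * of_real (q y) * f y k) + ?G y) = 0 - ?E x * (of_real (s x) * f x k)"
    by (rule tail_FTC[OF d set_integral_add(1)[OF iq iG] lim])
  then have "2 * \<i> * k * vop P q f x k + (LINT y:{x..}|lborel. ?G y) = 0 - ?E x * (of_real (s x) * f x k)"
    by (simp only: set_integral_add(2)[OF iq iG] set_integral_mult_right vop_def)
  then have "2 * \<i> * k * g x k = - (of_real (s x) * f x k) - (LINT y:{x..}|lborel. ?G y)"
    by (simp add: jsum_False_eq[OF k] eq_diff_eq)
  then have "norm (2 * \<i> * k * g x k) \<le> norm (of_real (s x) * f x k) + norm (LINT y:{x..}|lborel. ?G y)"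
    using norm_triangle_ineq4[of "- (of_real (s x) * f x k)" "LINT y:{x..}|lborel. ?G y"] by simp
  also have "norm (of_real (s x) * f x k) \<le> C0 * B"
  proof -
    have "C0 * kap x \<le> C0" using kap_le_1[of x] C0_nonneg by (simp add: mult_left_le)
    then have "\<bar>s x\<bar> \<le> C0" using bs[of x] by linarith
    then show ?thesis
      unfolding norm_mult using jsum_le_B[OF k, of True x] C0_nonneg by (intro mult_mono) auto
  qed
  also have "norm (LINT y:{x..}|lborel. ?G y) \<le> ?K * kap_tail x ^ Suc 0 / Suc 0"
    by (rule tail_bound_norm[OF set_borel_measurable_continuous_UNIV[OF cG] bG])
  also have "\<dots> \<le> ?K * pi"
    using kap_tail_le_pi[of x] C0_nonneg B_pos by (simp add: mult_left_mono)
  finally show ?thesis by (simp add: KL_def norm_mult)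
qed

text \<open>\<open>1 - f\<close> is the tail integral of \<open>q * g\<close>, so the decay of
  \<open>g\<close> in \<open>k\<close> is inherited.\<close>

lemma f_large:
  assumes k: "Im k \<ge> 0"
  shows "norm (2 * k) * norm (f x k - 1) \<le> C0 * pi * KL"
proof -
  have "norm (LINT y:{x..}|lborel. of_real (norm (2 * k)) * (of_real (q y) * g y k)) \<le> (C0 * KL) * kap_tail x ^ Suc 0 / Suc 0"
  proof (rule tail_bound_norm)
    show "set_borel_measurable lborel {x..} (\<lambda>y. of_real (norm (2 * k)) * (of_real (q y) * g y k))"
      by (intro set_borel_measurable_continuous_UNIV continuous_intros cont_q jsum_cont k)
    fix y
    have "norm (of_real (norm (2 * k)) * (of_real (q y) * g y k)) = \<bar>q y\<bar> * (norm (2 * k) * norm (g y k))"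
      by (simp add: norm_mult)
    also have "\<dots> \<le> (C0 * kap y) * KL"
      using q_le[of y] g_large[OF k, of y] C0_nonneg kap_pos[of y] by (intro mult_mono) auto
    finally show "norm (of_real (norm (2 * k)) * (of_real (q y) * g y k)) \<le> C0 * KL * (kap y * kap_tail y ^ 0)"
      by (simp add: mult_ac)
  qed
  also have "\<dots> \<le> C0 * KL * pi"
    using kap_tail_le_pi[of x] C0_nonneg KL_nonneg by (simp add: mult_left_mono)
  also have "(LINT y:{x..}|lborel. of_real (norm (2 * k)) * (of_real (q y) * g y k)) = of_real (norm (2 * k)) * (1 - f x k)"
    by (simp add: jsum_True_eq[OF k] vop_def)
  finally show ?thesis by (simp add: norm_mult norm_minus_commute mult_ac)
qed

subsection \<open>Vanishing spectral parameter\<close>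

definition hc :: "real \<Rightarrow> real" where "hc x = cos (arctan (w1 x) / 2)"
definition hs :: "real \<Rightarrow> real" where "hs x = sin (arctan (w1 x) / 2)"

lemma d_half_angle: "((\<lambda>x. arctan (w1 x) / 2) has_real_derivative q x) (at x)"
proof -
  have "1 + (w1 x)\<^sup>2 \<noteq> 0" by (smt (verit) zero_le_power2)
  then show ?thesis
    by (auto intro!: derivative_eq_intros dw1 simp: q_def field_simps)
qed

lemma dhc: "(hc has_real_derivative - hs x * q x) (at x)"
  and dhs: "(hs has_real_derivative hc x * q x) (at x)"
  unfolding hc_def[abs_def] hs_def[abs_def]
  using DERIV_chain2[OF DERIV_cos d_half_angle[of x]] DERIV_chain2[OF DERIV_sin d_half_angle[of x]] by simp_all

lemma hc_hs: "(hc x)\<^sup>2 + (hs x)\<^sup>2 = 1"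
  by (simp add: hc_def hs_def)

lemma hc_le: "\<bar>hc x\<bar> \<le> 1" and hs_le: "\<bar>hs x\<bar> \<le> 1"
  by (simp_all add: hc_def hs_def)

lemma hc_tendsto: "(hc \<longlongrightarrow> 1) at_top" and hs_tendsto: "(hs \<longlongrightarrow> 0) at_top"
proof -
  have t: "((\<lambda>x. arctan (w1 x) / 2) \<longlongrightarrow> 0) at_top"
    using tendsto_divide[OF tendsto_arctan[OF w1_tendsto] tendsto_const[of 2]] by simp
  show "(hc \<longlongrightarrow> 1) at_top" "(hs \<longlongrightarrow> 0) at_top"
    unfolding hc_def[abs_def] hs_def[abs_def] using tendsto_cos[OF t] tendsto_sin[OF t] by simp_all
qed

text \<open>In the original Lax gauge the potential is a multiple of the spectral parameter; these two
  identities carry out the change of gauge.\<close>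

lemma gauge_identities:
  shows "(1 - h x) * hc x + w1 x * hs x = 0" and "w1 x * hc x = (1 + h x) * hs x"
proof -
  have h0: "h x \<noteq> 0" using h_ge_1[of x] by simp
  have "cos (2 * (arctan (w1 x) / 2)) = 1 / h x" "sin (2 * (arctan (w1 x) / 2)) = w1 x / h x"
    by (simp_all add: h_def cos_arctan sin_arctan)
  then have c1: "h x * (1 - 2 * (hs x)\<^sup>2) = 1" and s: "w1 x = h x * (2 * hs x * hc x)"
    using h0 unfolding cos_double_sin sin_double by (simp_all add: hc_def hs_def field_simps)
  have c2: "h x * (2 * (hc x)\<^sup>2 - 1) = 1" using c1 hc_hs[of x] by algebra
  show "(1 - h x) * hc x + w1 x * hs x = 0" using c1 s by algebra
  show "w1 x * hc x = (1 + h x) * hs x" using c2 s by algebra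
qed

text \<open>At \<open>k = 0\<close> the system is \<open>f' = q * g\<close>,
  \<open>g' = - q * f\<close>, a rotation whose angular speed \<open>q\<close> is, by
  \<open>d_half_angle\<close>, the derivative of half of \<open>arctan w1\<close>. Uniqueness of the
  Volterra solution identifies it.\<close>

lemma jsum_at_0: "f x 0 = of_real (hc x)" "g x 0 = of_real (- hs x)"
proof -
  have i: "set_integrable lborel {x..} (\<lambda>y. complex_of_real (q y * c y))"
    if "continuous_on UNIV c" "\<And>y. \<bar>c y\<bar> \<le> 1" for c x
  proof (rule tail_bound_integrable)
    show "set_borel_measurable lborel {x..} (\<lambda>y. complex_of_real (q y * c y))"
      by (intro set_borel_measurable_continuous_UNIV continuous_intros cont_q that)
    show "norm (complex_of_real (q y * c y)) \<le> C0 * (kap y * kap_tail y ^ 0)" for y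
      using mult_mono[OF q_le[of y] that(2)[of y]] C0_nonneg kap_pos[of y] by (simp add: norm_mult)
  qed
  have cc: "continuous_on UNIV hc" "continuous_on UNIV hs"
    using dhc dhs by (meson DERIV_isCont continuous_at_imp_continuous_on)+
  note i1 = i[OF cc(1) hc_le] and i2 = i[OF cc(2) hs_le]
  have c: "(LINT y:{x..}|lborel. complex_of_real (q y * hs y)) = of_real (hc x) - 1" for x
  proof -
    have "(LINT y:{x..}|lborel. complex_of_real (q y * hs y)) = of_real (- 1) - of_real (- hc x)"
      by (rule tail_FTC[where H = "\<lambda>x. of_real (- hc x)", OF has_vector_derivative_complex_of_real i2 tendsto_of_real])
         (auto intro!: derivative_eq_intros dhc hc_tendsto tendsto_minus)
    then show ?thesis by simp
  qed
  have s: "(LINT y:{x..}|lborel. complex_of_real (q y * hc y)) = of_real (- hs x)" for x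
  proof -
    have "(LINT y:{x..}|lborel. complex_of_real (q y * hc y)) = of_real 0 - of_real (hs x)"
      by (rule tail_FTC[where H = "\<lambda>x. of_real (hs x)", OF has_vector_derivative_complex_of_real i1 tendsto_of_real])
         (use dhs in \<open>auto simp: mult.commute intro: hs_tendsto\<close>)
    then show ?thesis by simp
  qed
  have "of_real (hc x) = f x 0 \<and> of_real (- hs x) = g x 0"
  proof (rule jsum_unique)
    show "of_real (hc x) = 1 - (LINT y:{x..}|lborel. of_real (q y) * of_real (- hs y) :: complex)" for x
    proof -
      have "(LINT y:{x..}|lborel. of_real (q y) * of_real (- hs y) :: complex) =
          (LINT y:{x..}|lborel. - 1 * complex_of_real (q y * hs y))"
        by (rule set_lebesgue_integral_cong) auto
      also have "\<dots> = - 1 * (of_real (hc x) - 1)"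
        by (simp only: set_integral_mult_right c)
      finally show ?thesis by simp
    qed
    show "of_real (- hs x) = (LINT y:{x..}|lborel. exp (2 * \<i> * 0 * of_real (P y - P x)) * of_real (q y) * of_real (hc y) :: complex)" for x
      using s[of x] by simp
    show "set_integrable lborel {x..} (\<lambda>y. of_real (q y) * of_real (- hs y) :: complex)" for x
      using set_integrable_mult_right[of "- 1" lborel "{x..}", OF i2[of x]] by simp
    show "set_integrable lborel {x..} (\<lambda>y. exp (2 * \<i> * 0 * of_real (P y - P x)) * of_real (q y) * of_real (hc y) :: complex)" for x
      using i1[of x] by simp
  qed simp
  then show "f x 0 = of_real (hc x)" "g x 0 = of_real (- hs x)" by simp_all
qed

text \<open>The Jost solution \<open>(f, g)\<close> in the original Lax gauge, obtained by rotating by half of \<open>arctan w1\<close>.\<close>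

definition n1 :: "real \<Rightarrow> complex \<Rightarrow> complex" where
  "n1 x k = of_real (hc x) * f x k - of_real (hs x) * g x k"
definition n2 :: "real \<Rightarrow> complex \<Rightarrow> complex" where
  "n2 x k = of_real (hs x) * f x k + of_real (hc x) * g x k"

lemma n_at_0: "n1 x 0 = 1" "n2 x 0 = 0"
proof -
  have "of_real (hc x) * of_real (hc x) + of_real (hs x) * of_real (hs x) = (1 :: complex)"
    using hc_hs[of x] by (metis of_real_1 of_real_add of_real_mult power2_eq_square)
  then show "n1 x 0 = 1" "n2 x 0 = 0" by (simp_all add: n1_def n2_def jsum_at_0)
qed

text \<open>Differentiating the rotation cancels every \<open>q\<close> term. The two gauge
  identities turn what remains, a multiple of \<open>k * h * g\<close>, into a combination of
  \<open>n1\<close> and \<open>n2\<close>.\<close>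

lemma deriv_n:
  assumes k: "Im k \<ge> 0"
  shows "((\<lambda>x. n1 x k) has_vector_derivative \<i> * k * (of_real (1 - h x) * n1 x k + of_real (w1 x) * n2 x k)) (at x)"
    and "((\<lambda>x. n2 x k) has_vector_derivative \<i> * k * (of_real (w1 x) * n1 x k - of_real (1 + h x) * n2 x k)) (at x)"
proof -
  note dc = has_vector_derivative_complex_of_real[OF dhc] and ds' = has_vector_derivative_complex_of_real[OF dhs]
  let ?r = complex_of_real
  have e1: "(1 - ?r (h x)) * ?r (hc x) + ?r (w1 x) * ?r (hs x) = 0"
    and e2: "?r (w1 x) * ?r (hc x) = (1 + ?r (h x)) * ?r (hs x)"
    using gauge_identities(1)[of x, THEN arg_cong[where f = ?r]] gauge_identities(2)[of x, THEN arg_cong[where f = ?r]]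
    by simp_all
  have 1: "((\<lambda>x. n1 x k) has_vector_derivative
      (?r (hc x) * (?r (q x) * g x k) + ?r (- hs x * q x) * f x k)
      - (?r (hs x) * (- (?r (q x) * f x k) - 2 * \<i> * k * ?r (h x) * g x k) + ?r (hc x * q x) * g x k)) (at x)"
    unfolding n1_def by (intro has_vector_derivative_diff has_vector_derivative_mult dc ds' deriv_f deriv_g k)
  have 2: "((\<lambda>x. n2 x k) has_vector_derivative
      (?r (hs x) * (?r (q x) * g x k) + ?r (hc x * q x) * f x k)
      + (?r (hc x) * (- (?r (q x) * f x k) - 2 * \<i> * k * ?r (h x) * g x k) + ?r (- hs x * q x) * g x k)) (at x)"
    unfolding n2_def by (intro has_vector_derivative_add has_vector_derivative_mult dc ds' deriv_f deriv_g k)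
  have "(?r (hc x) * (?r (q x) * g x k) + ?r (- hs x * q x) * f x k)
      - (?r (hs x) * (- (?r (q x) * f x k) - 2 * \<i> * k * ?r (h x) * g x k) + ?r (hc x * q x) * g x k)
     = \<i> * k * (of_real (1 - h x) * n1 x k + of_real (w1 x) * n2 x k)"
    unfolding n1_def n2_def of_real_mult of_real_minus of_real_diff of_real_1 using e1 e2 by algebra
  with 1 show "((\<lambda>x. n1 x k) has_vector_derivative \<i> * k * (of_real (1 - h x) * n1 x k + of_real (w1 x) * n2 x k)) (at x)"
    by simp
  have "(?r (hs x) * (?r (q x) * g x k) + ?r (hc x * q x) * f x k)
      + (?r (hc x) * (- (?r (q x) * f x k) - 2 * \<i> * k * ?r (h x) * g x k) + ?r (- hs x * q x) * g x k)
     = \<i> * k * (of_real (w1 x) * n1 x k - of_real (1 + h x) * n2 x k)"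
    unfolding n1_def n2_def of_real_mult of_real_minus of_real_add of_real_1 using e1 e2 by algebra
  with 2 show "((\<lambda>x. n2 x k) has_vector_derivative \<i> * k * (of_real (w1 x) * n1 x k - of_real (1 + h x) * n2 x k)) (at x)"
    by simp
qed

lemma n_bounds:
  assumes k: "Im k \<ge> 0"
  shows "norm (n1 x k) \<le> 2 * B" "norm (n2 x k) \<le> 2 * B"
proof -
  have le: "norm (of_real r * jsum b x k) \<le> B" if "\<bar>r\<bar> \<le> 1" for r b
    using mult_mono[OF that jsum_le_B[OF k, of b x]] by (simp add: norm_mult)
  show "norm (n1 x k) \<le> 2 * B"
    unfolding n1_def using norm_triangle_ineq4[of "of_real (hc x) * f x k" "of_real (hs x) * g x k"]
      le[OF hc_le[of x], of True] le[OF hs_le[of x], of False] by simp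
  show "norm (n2 x k) \<le> 2 * B"
    unfolding n2_def using norm_triangle_ineq[of "of_real (hs x) * f x k" "of_real (hc x) * g x k"]
      le[OF hs_le[of x], of True] le[OF hc_le[of x], of False] by simp
qed

lemma n_tendsto:
  assumes k: "Im k \<ge> 0"
  shows "((\<lambda>x. n1 x k) \<longlongrightarrow> 1) at_top" "((\<lambda>x. n2 x k) \<longlongrightarrow> 0) at_top"
proof -
  have "((\<lambda>x. n1 x k) \<longlongrightarrow> of_real 1 * 1 - of_real 0 * 0) at_top"
    "((\<lambda>x. n2 x k) \<longlongrightarrow> of_real 0 * 1 + of_real 1 * 0) at_top"
    unfolding n1_def n2_def by (intro tendsto_intros hc_tendsto hs_tendsto jsum_tendsto k)+
  then show "((\<lambda>x. n1 x k) \<longlongrightarrow> 1) at_top" "((\<lambda>x. n2 x k) \<longlongrightarrow> 0) at_top" by simp_all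
qed

lemma n_cont: "Im k \<ge> 0 \<Longrightarrow> continuous_on UNIV (\<lambda>x. n1 x k)" "Im k \<ge> 0 \<Longrightarrow> continuous_on UNIV (\<lambda>x. n2 x k)"
proof -
  show "Im k \<ge> 0 \<Longrightarrow> continuous_on UNIV (\<lambda>x. n1 x k)"
    using has_vector_derivative_continuous[OF deriv_n(1)] by (simp add: continuous_at_imp_continuous_on)
  show "Im k \<ge> 0 \<Longrightarrow> continuous_on UNIV (\<lambda>x. n2 x k)"
    using has_vector_derivative_continuous[OF deriv_n(2)] by (simp add: continuous_at_imp_continuous_on)
qed

lemma n_tendsto_k:
  "((\<lambda>k. n1 x k) \<longlongrightarrow> 1) (at 0 within {k. Im k \<ge> 0})" "((\<lambda>k. n2 x k) \<longlongrightarrow> 0) (at 0 within {k. Im k \<ge> 0})"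
proof -
  have c: "continuous_on {k. Im k \<ge> 0} (\<lambda>k. n1 x k)" "continuous_on {k. Im k \<ge> 0} (\<lambda>k. n2 x k)"
    unfolding n1_def n2_def by (intro continuous_intros jsum_cont_k)+
  show "((\<lambda>k. n1 x k) \<longlongrightarrow> 1) (at 0 within {k. Im k \<ge> 0})" "((\<lambda>k. n2 x k) \<longlongrightarrow> 0) (at 0 within {k. Im k \<ge> 0})"
    using c[unfolded continuous_on_def, THEN bspec[where x = 0]] n_at_0[of x] by simp_all
qed

text \<open>The integrating factor \<open>exp (\<i> * k * Z)\<close> removes the \<open>n2\<close>
  term from the second equation. Hence \<open>n2\<close> is \<open>- \<i> * k\<close> times a tail
  integral whose integrand tends to \<open>w1\<close> as \<open>k\<close> tends to 0, and the
  integral of \<open>w1\<close> over \<open>{x..}\<close> is \<open>- w x\<close>.\<close>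

lemma n2_small: "((\<lambda>k. n2 x k / (\<i> * k)) \<longlongrightarrow> of_real (w x)) (at 0 within {k. Im k \<ge> 0})"
proof -
  define Z where "Z y = y + P y" for y
  let ?E = "\<lambda>k y. exp (\<i> * k * of_real (Z y - Z x))"
  have dZ: "(Z has_real_derivative 1 + h y) (at y)" for y
    unfolding Z_def h_def by (intro derivative_intros dP)
  have E1: "norm (?E k y) \<le> 1" if "y \<ge> x" "Im k \<ge> 0" for k y
  proof -
    have "0 \<le> Z y - Z x" using add_mono[OF that(1) monoD[OF mono_P that(1)]] by (simp add: Z_def)
    \<comment> \<open>The phase here is \<open>\<i> * k\<close> instead of
      \<open>2 * \<i> * k\<close>, whence the parameter \<open>k / 2\<close>.\<close>
    then show ?thesis using norm_phase_le_1[of "k / 2" "Z y - Z x"] that by simp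
  qed
  have contZ: "continuous_on UNIV Z"
    unfolding Z_def by (intro continuous_intros cont_P)
  have b: "norm (?E k y * of_real (w1 y) * n1 y k) \<le> C0 * (2 * B) * kap y" if "k \<in> {k. Im k \<ge> 0}" "y \<ge> x" for k y
  proof -
    have "norm (?E k y * of_real (w1 y) * n1 y k) \<le> 1 * (C0 * kap y) * (2 * B)"
      unfolding norm_mult using that bw1[of y] C0_nonneg B_pos kap_pos[of y] n_bounds[of k y]
      by (intro mult_mono E1) auto
    then show ?thesis by (simp add: mult_ac)
  qed
  have m: "set_borel_measurable lborel {x..} (\<lambda>y. ?E k y * of_real (w1 y) * n1 y k)" if "k \<in> {k. Im k \<ge> 0}" for k
    using that by (intro set_borel_measurable_continuous_UNIV continuous_intros contZ cont_w1 n_cont) auto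
  have eq: "n2 x k / (\<i> * k) = - (LINT y:{x..}|lborel. ?E k y * of_real (w1 y) * n1 y k)" if "k \<noteq> 0" "Im k \<ge> 0" for k
  proof -
    have i: "set_integrable lborel {x..} (\<lambda>y. ?E k y * of_real (w1 y) * n1 y k)"
      using b[of k] that by (intro tail_bound_integrable[where n = 0, OF m]) auto
    have "(LINT y:{x..}|lborel. \<i> * k * (?E k y * of_real (w1 y) * n1 y k)) = 0 - ?E k x * n2 x k"
    proof (rule tail_FTC[where H = "\<lambda>y. ?E k y * n2 y k"])
      fix y
      have "((\<lambda>y. ?E k y * n2 y k) has_vector_derivative
        ?E k y * (\<i> * k * (of_real (w1 y) * n1 y k - of_real (1 + h y) * n2 y k)) + \<i> * k * of_real (1 + h y) * ?E k y * n2 y k) (at y)"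
        by (intro has_vector_derivative_mult has_vector_derivative_exp dZ deriv_n that)
      then show "((\<lambda>y. ?E k y * n2 y k) has_vector_derivative \<i> * k * (?E k y * of_real (w1 y) * n1 y k)) (at y)"
        by (simp add: algebra_simps)
    next
      show "set_integrable lborel {x..} (\<lambda>y. \<i> * k * (?E k y * of_real (w1 y) * n1 y k))"
        by (intro set_integrable_mult_right i)
      show "((\<lambda>y. ?E k y * n2 y k) \<longlongrightarrow> 0) at_top"
      proof (rule Lim_null_comparison[OF _ tendsto_norm_zero[OF n_tendsto(2)[OF that(2)]]])
        show "\<forall>\<^sub>F y in at_top. norm (?E k y * n2 y k) \<le> norm (n2 y k)"
          using eventually_ge_at_top[of x]
          by eventually_elim (use that E1 in \<open>auto simp: norm_mult intro!: mult_left_le_one_le\<close>)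
      qed
    qed
    then have "\<i> * k * (LINT y:{x..}|lborel. ?E k y * of_real (w1 y) * n1 y k) = - n2 x k" by simp
    then show ?thesis using that by (simp add: field_simps)
  qed
  have "((\<lambda>k. LINT y:{x..}|lborel. ?E k y * of_real (w1 y) * n1 y k) \<longlongrightarrow> (LINT y:{x..}|lborel. of_real (w1 y))) (at 0 within {k. Im k \<ge> 0})"
  proof (rule tail_dct_within[OF m b])
    fix y
    have "((\<lambda>k. ?E k y * of_real (w1 y) * n1 y k) \<longlongrightarrow> ?E 0 y * of_real (w1 y) * 1) (at 0 within {k. Im k \<ge> 0})"
      by (intro tendsto_intros n_tendsto_k)
    then show "((\<lambda>k. ?E k y * of_real (w1 y) * n1 y k) \<longlongrightarrow> of_real (w1 y)) (at 0 within {k. Im k \<ge> 0})" by simp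
  qed
  also have "(LINT y:{x..}|lborel. complex_of_real (w1 y)) = of_real 0 - of_real (w x)"
  proof (rule tail_FTC[OF has_vector_derivative_complex_of_real[OF dw] _ tendsto_of_real[OF w_tendsto]])
    show "set_integrable lborel {x..} (\<lambda>y. complex_of_real (w1 y))"
      using bw1 by (intro tail_bound_integrable[where n = 0 and C = C0] set_borel_measurable_continuous_UNIV continuous_intros cont_w1) auto
  qed
  finally have "((\<lambda>k. - (LINT y:{x..}|lborel. ?E k y * of_real (w1 y) * n1 y k)) \<longlongrightarrow> of_real (w x)) (at 0 within {k. Im k \<ge> 0})"
    using tendsto_minus by fastforce
  then show ?thesis
    by (rule Lim_transform_eventually) (simp add: eventually_at_filter eq)
qed

text \<open>\<open>n1 - 1\<close> is \<open>- \<i> * k\<close> times a tail integral, so only the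
  limit of the integrand at \<open>k = 0\<close> matters, where \<open>n1 = 1\<close> and
  \<open>n2 = 0\<close>.\<close>

lemma n1_small:
  "((\<lambda>k. (n1 x k - 1) / (\<i> * k)) \<longlongrightarrow> of_real (LINT y:{x..}|lborel. h y - 1)) (at 0 within {k. Im k \<ge> 0})"
proof -
  let ?G = "\<lambda>k y. of_real (1 - h y) * n1 y k + of_real (w1 y) * n2 y k"
  have b: "norm (?G k y) \<le> C0 * (4 * B) * kap y" if "k \<in> {k. Im k \<ge> 0}" "y \<ge> x" for k y
  proof -
    have "norm (of_real (1 - h y) * n1 y k) \<le> (C0 * kap y) * (2 * B)"
      unfolding norm_mult norm_of_real using that h_minus_1[of y] C0_nonneg B_pos kap_pos[of y] n_bounds[of k y]
      by (intro mult_mono) auto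
    moreover have "norm (of_real (w1 y) * n2 y k) \<le> (C0 * kap y) * (2 * B)"
      unfolding norm_mult norm_of_real using that bw1[of y] C0_nonneg B_pos kap_pos[of y] n_bounds[of k y]
      by (intro mult_mono) auto
    ultimately show ?thesis by (intro norm_triangle_le) (simp add: algebra_simps)
  qed
  have m: "set_borel_measurable lborel {x..} (?G k)" if "k \<in> {k. Im k \<ge> 0}" for k
    using that by (intro set_borel_measurable_continuous_UNIV continuous_intros cont_h cont_w1 n_cont) auto
  have eq: "(n1 x k - 1) / (\<i> * k) = - (LINT y:{x..}|lborel. ?G k y)" if "k \<noteq> 0" "Im k \<ge> 0" for k
  proof -
    have i: "set_integrable lborel {x..} (?G k)"
      using b[of k] that by (intro tail_bound_integrable[where n = 0, OF m]) auto
    have "(LINT y:{x..}|lborel. \<i> * k * ?G k y) = 1 - n1 x k"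
      by (rule tail_FTC[OF deriv_n(1)[OF that(2)] set_integrable_mult_right[OF i] n_tendsto(1)[OF that(2)]])
    then have "\<i> * k * (LINT y:{x..}|lborel. ?G k y) = 1 - n1 x k" by simp
    then show ?thesis using that by (simp add: field_simps)
  qed
  have "((\<lambda>k. LINT y:{x..}|lborel. ?G k y) \<longlongrightarrow> (LINT y:{x..}|lborel. of_real (1 - h y))) (at 0 within {k. Im k \<ge> 0})"
  proof (rule tail_dct_within[OF m b])
    fix y
    have "((\<lambda>k. ?G k y) \<longlongrightarrow> of_real (1 - h y) * 1 + of_real (w1 y) * 0) (at 0 within {k. Im k \<ge> 0})"
      by (intro tendsto_intros n_tendsto_k)
    then show "((\<lambda>k. ?G k y) \<longlongrightarrow> of_real (1 - h y)) (at 0 within {k. Im k \<ge> 0})" by simp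
  qed
  then have "((\<lambda>k. - (LINT y:{x..}|lborel. ?G k y)) \<longlongrightarrow> - (LINT y:{x..}|lborel. of_real (1 - h y))) (at 0 within {k. Im k \<ge> 0})"
    by (rule tendsto_minus)
  also have "- (LINT y:{x..}|lborel. complex_of_real (1 - h y)) = of_real (LINT y:{x..}|lborel. h y - 1)"
  proof -
    have "(LINT y:{x..}|lborel. h y - 1) = (LINT y:{x..}|lborel. - 1 * (1 - h y))"
      by (rule set_lebesgue_integral_cong) auto
    also have "\<dots> = - 1 * (LINT y:{x..}|lborel. 1 - h y)"
      by (rule set_integral_mult_right)
    finally have "(LINT y:{x..}|lborel. h y - 1) = - (LINT y:{x..}|lborel. 1 - h y)" by simp
    then show ?thesis by (simp only: set_integral_complex_of_real of_real_minus)
  qed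
  finally have "((\<lambda>k. - (LINT y:{x..}|lborel. ?G k y)) \<longlongrightarrow> of_real (LINT y:{x..}|lborel. h y - 1)) (at 0 within {k. Im k \<ge> 0})" .
  then show ?thesis
    by (rule Lim_transform_eventually) (simp add: eventually_at_filter eq)
qed

end

section \<open>Scattering data\<close>

lemma has_vector_derivative_mirror:
  fixes \<phi> :: "real \<Rightarrow> 'a :: real_normed_vector"
  assumes "(\<phi> has_vector_derivative d) (at (- x))"
  shows "((\<lambda>x. \<phi> (- x)) has_vector_derivative - d) (at x)"
proof -
  have "((\<lambda>x. - x) has_vector_derivative (- 1 :: real)) (at x)"
    by (auto intro!: derivative_eq_intros)
  from vector_diff_chain_at[OF this assms] show ?thesis by (simp add: comp_def)
qed

lemma has_vector_derivative_zero_UNIV: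
  fixes \<phi> :: "real \<Rightarrow> 'a :: real_normed_vector"
  assumes "\<And>x. (\<phi> has_vector_derivative 0) (at x)"
  shows "\<phi> x = \<phi> y"
  using has_vector_derivative_zero_constant[of UNIV \<phi>] assms by (metis UNIV_I convex_UNIV)

context jost
begin

text \<open>Derivatives of odd order change sign; the phase becomes \<open>- P (- x)\<close> so that
  it stays increasing.\<close>

lemma mirror: "jost (\<lambda>x. w (- x)) (\<lambda>x. - w1 (- x)) (\<lambda>x. w2 (- x)) (\<lambda>x. - w3 (- x)) (\<lambda>x. - P (- x)) C0"
proof
  show "((\<lambda>x. w (- x)) has_real_derivative - w1 (- x)) (at x)" for x
    using dw[of "- x"] unfolding DERIV_mirror .
  show "((\<lambda>x. - w1 (- x)) has_real_derivative w2 (- x)) (at x)" for x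
    using DERIV_minus[OF dw1[of "- x", unfolded DERIV_mirror]] by simp
  show "((\<lambda>x. w2 (- x)) has_real_derivative - w3 (- x)) (at x)" for x
    using dw2[of "- x"] unfolding DERIV_mirror .
  show "continuous_on UNIV (\<lambda>x. - w3 (- x))"
    by (intro continuous_intros continuous_on_compose2[OF cont_w3]) auto
  show "((\<lambda>x. - P (- x)) has_real_derivative sqrt (1 + (- w1 (- x))\<^sup>2)) (at x)" for x
    using DERIV_minus[OF dP[of "- x", unfolded DERIV_mirror]] by simp
qed (use bw[of "- x" for x] bw1[of "- x" for x] bw2[of "- x" for x] bw3[of "- x" for x] in simp_all)

text \<open>\<open>q\<close> and \<open>P\<close> are real, so conjugation maps the Volterra system
  at \<open>k\<close> to the one at \<open>- cnj k\<close>, and uniqueness applies.\<close>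

lemma jsum_cnj:
  assumes k: "Im k \<ge> 0"
  shows "cnj (jsum b x k) = jsum b x (- cnj k)"
proof -
  have k': "Im (- cnj k) \<ge> 0" using k by simp
  have e: "cnj (exp (2 * \<i> * k * of_real c)) = exp (2 * \<i> * (- cnj k) * of_real c)" for c
    by (simp add: exp_cnj)
  have I: "cnj (LINT y:{x..}|lborel. H y) = (LINT y:{x..}|lborel. cnj (H y))" for H :: "real \<Rightarrow> complex" and x
    unfolding set_lebesgue_integral_def by (simp flip: Bochner_Integration.integral_cnj)
  have J: "set_integrable lborel {x..} (\<lambda>y. cnj (H y))" if "set_integrable lborel {x..} H" for H :: "real \<Rightarrow> complex" and x
    using integrable_cnj[OF that[unfolded set_integrable_def]] by (simp add: set_integrable_def)
  have i1: "set_integrable lborel {x..} (\<lambda>y. of_real (q y) * g y k)" for x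
    using integrand_integrable[of "\<lambda>_. 0", OF _ _ jsum_vclass[of False] k] by (simp add: mono_def)
  have i2: "set_integrable lborel {x..} (\<lambda>y. exp (2 * \<i> * k * of_real (P y - P x)) * of_real (q y) * f y k)" for x
    by (rule integrand_integrable[OF cont_P mono_P jsum_vclass k])
  have "cnj (f x k) = f x (- cnj k) \<and> cnj (g x k) = g x (- cnj k)"
  proof (rule jsum_unique[OF k'])
    fix x
    show "set_integrable lborel {x..} (\<lambda>y. of_real (q y) * cnj (g y k))"
      using J[OF i1[of x]] by simp
    show "set_integrable lborel {x..} (\<lambda>y. exp (2 * \<i> * (- cnj k) * of_real (P y - P x)) * of_real (q y) * cnj (f y k))"
      using J[OF i2[of x]] by (simp only: complex_cnj_mult e complex_cnj_complex_of_real)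
    have "f x k = 1 - (LINT y:{x..}|lborel. of_real (q y) * g y k)"
      using jsum_True_eq[OF k, of x] by (simp add: vop_def)
    from arg_cong[OF this, of cnj] show "cnj (f x k) = 1 - (LINT y:{x..}|lborel. of_real (q y) * cnj (g y k))"
      by (simp add: I)
    have "g x k = (LINT y:{x..}|lborel. exp (2 * \<i> * k * of_real (P y - P x)) * of_real (q y) * f y k)"
      using jsum_False_eq[OF k, of x] by (simp add: vop_def)
    from arg_cong[OF this, of cnj]
    show "cnj (g x k) = (LINT y:{x..}|lborel. exp (2 * \<i> * (- cnj k) * of_real (P y - P x)) * of_real (q y) * cnj (f y k))"
      by (simp only: I complex_cnj_mult e complex_cnj_complex_of_real)
  qed
  then show ?thesis by (cases b) auto
qed

text \<open>The left-hand side is the determinant of the columns \<open>(f, g)\<close> at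
  \<open>k\<close> and \<open>(- g, f)\<close> at \<open>- k\<close>, that is of \<open>mu2\<close>.
  It is constant in \<open>x\<close> and tends to 1 at plus infinity.\<close>

lemma det_one:
  assumes k: "Im k = 0"
  shows "f x k * f x (- k) + g x k * g x (- k) = 1"
proof -
  let ?D = "\<lambda>x. f x k * f x (- k) + g x k * g x (- k)"
  have k1: "Im k \<ge> 0" "Im (- k) \<ge> 0" using k by simp_all
  have "(?D has_vector_derivative
     (f x k * (of_real (q x) * g x (- k)) + of_real (q x) * g x k * f x (- k)) +
     (g x k * (- (of_real (q x) * f x (- k)) - 2 * \<i> * (- k) * of_real (h x) * g x (- k))
      + (- (of_real (q x) * f x k) - 2 * \<i> * k * of_real (h x) * g x k) * g x (- k))) (at x)" for x
    by (intro has_vector_derivative_add has_vector_derivative_mult deriv_f deriv_g k1)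
  moreover have "(f x k * (of_real (q x) * g x (- k)) + of_real (q x) * g x k * f x (- k)) +
     (g x k * (- (of_real (q x) * f x (- k)) - 2 * \<i> * (- k) * of_real (h x) * g x (- k))
      + (- (of_real (q x) * f x k) - 2 * \<i> * k * of_real (h x) * g x k) * g x (- k)) = 0" for x
    by algebra
  ultimately have const: "?D x = ?D y" for y
    using has_vector_derivative_zero_UNIV[of ?D] by simp
  have "((\<lambda>y. ?D y) \<longlongrightarrow> ?D x) at_top"
    by (rule Lim_transform_eventually[OF tendsto_const always_eventually]) (rule allI, rule const)
  moreover have "((\<lambda>y. ?D y) \<longlongrightarrow> 1 * 1 + 0 * 0) at_top"
    by (intro tendsto_intros jsum_tendsto k1)
  ultimately have "?D x = 1 * 1 + 0 * 0"
    by (rule tendsto_unique[OF trivial_limit_at_top_linorder])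
  then show ?thesis by simp
qed

end

text \<open>A copy of \<open>jost\<close>, so that the reflected instance, itself a
  \<open>jost\<close>, is not reflected again.\<close>

locale scatter = jost

sublocale scatter \<subseteq> m: jost "\<lambda>x. w (- x)" "\<lambda>x. - w1 (- x)" "\<lambda>x. w2 (- x)" "\<lambda>x. - w3 (- x)" "\<lambda>x. - P (- x)" C0
  by (rule mirror)

context scatter
begin

text \<open>Reflecting \<open>x\<close> exchanges the two ends of the line: \<open>(G, F)\<close> is the second column of \<open>\<mu>\<^sub>1\<close>,
  whereas \<open>(f, g)\<close> is the first column of \<open>\<mu>\<^sub>2\<close>.\<close>

definition F :: "real \<Rightarrow> complex \<Rightarrow> complex" where "F x k = m.f (- x) k"
definition G :: "real \<Rightarrow> complex \<Rightarrow> complex" where "G x k = m.g (- x) k"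

lemma m_q: "m.q y = q (- y)" and m_h: "m.h y = h (- y)" and m_hc: "m.hc y = hc (- y)" and m_hs: "m.hs y = - hs (- y)"
  by (simp_all add: m.q_def q_def m.h_def h_def m.hc_def hc_def m.hs_def hs_def arctan_minus)

lemma deriv_F:
  assumes k: "Im k \<ge> 0"
  shows "((\<lambda>x. F x k) has_vector_derivative - (of_real (q x) * G x k)) (at x)"
  using has_vector_derivative_mirror[OF m.deriv_f[OF k, of "- x"]] by (simp add: F_def G_def m_q)

lemma deriv_G:
  assumes k: "Im k \<ge> 0"
  shows "((\<lambda>x. G x k) has_vector_derivative of_real (q x) * F x k + 2 * \<i> * k * of_real (h x) * G x k) (at x)"
  using has_vector_derivative_mirror[OF m.deriv_g[OF k, of "- x"]] by (simp add: F_def G_def m_q m_h algebra_simps)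

text \<open>The determinant of the columns \<open>(f, g)\<close> and \<open>(G, F)\<close>, that is
  the spectral function \<open>a\<close>. The choice \<open>x = 0\<close> is immaterial by
  \<open>ja_eq\<close>.\<close>

definition ja :: "complex \<Rightarrow> complex" where
  "ja k = f 0 k * F 0 k - g 0 k * G 0 k"

lemma ja_eq:
  assumes k: "Im k \<ge> 0"
  shows "f x k * F x k - g x k * G x k = ja k"
proof -
  have "((\<lambda>x. f x k * F x k - g x k * G x k) has_vector_derivative
      (f x k * (- (of_real (q x) * G x k)) + of_real (q x) * g x k * F x k)
      - (g x k * (of_real (q x) * F x k + 2 * \<i> * k * of_real (h x) * G x k)
         + (- (of_real (q x) * f x k) - 2 * \<i> * k * of_real (h x) * g x k) * G x k)) (at x)" for x
    by (intro has_vector_derivative_diff has_vector_derivative_mult deriv_f deriv_g deriv_F deriv_G k)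
  moreover have "(f x k * (- (of_real (q x) * G x k)) + of_real (q x) * g x k * F x k)
      - (g x k * (of_real (q x) * F x k + 2 * \<i> * k * of_real (h x) * G x k)
         + (- (of_real (q x) * f x k) - 2 * \<i> * k * of_real (h x) * g x k) * G x k) = 0" for x
    by algebra
  ultimately show ?thesis
    unfolding ja_def using has_vector_derivative_zero_UNIV[of "\<lambda>x. f x k * F x k - g x k * G x k" x 0] by simp
qed

text \<open>Cramer's rule for \<open>(G, F)\<close> in the basis of the columns of
  \<open>mu2\<close>, with the phase taken out. For real \<open>k\<close> this is the spectral
  function \<open>b\<close>, and the choice \<open>x = 0\<close> is immaterial by
  \<open>jb_eq\<close>.\<close>

definition jb :: "complex \<Rightarrow> complex" where
  "jb k = exp (- 2 * \<i> * k * of_real (P 0)) * (G 0 k * f 0 (- k) + g 0 (- k) * F 0 k)"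

lemma jb_eq:
  assumes k: "Im k = 0"
  shows "exp (- 2 * \<i> * k * of_real (P x)) * (G x k * f x (- k) + g x (- k) * F x k) = jb k"
proof -
  have k1: "Im k \<ge> 0" "Im (- k) \<ge> 0" using k by simp_all
  let ?E = "\<lambda>x. exp (- 2 * \<i> * k * of_real (P x))"
  let ?D = "\<lambda>x. ?E x * (G x k * f x (- k) + g x (- k) * F x k)"
  have e: "(?E has_vector_derivative - 2 * \<i> * k * of_real (h x) * ?E x) (at x)" for x
    using has_vector_derivative_exp[OF dP, of "- 2 * \<i> * k" 0 x] by (simp add: h_def)
  have "(?D has_vector_derivative
      ?E x * ((G x k * (of_real (q x) * g x (- k)) + (of_real (q x) * F x k + 2 * \<i> * k * of_real (h x) * G x k) * f x (- k))
        + (g x (- k) * (- (of_real (q x) * G x k)) + (- (of_real (q x) * f x (- k)) - 2 * \<i> * (- k) * of_real (h x) * g x (- k)) * F x k))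
      + - 2 * \<i> * k * of_real (h x) * ?E x * (G x k * f x (- k) + g x (- k) * F x k)) (at x)" for x
    by (intro has_vector_derivative_add has_vector_derivative_mult e deriv_f deriv_g deriv_F deriv_G k1)
  moreover have "?E x * ((G x k * (of_real (q x) * g x (- k)) + (of_real (q x) * F x k + 2 * \<i> * k * of_real (h x) * G x k) * f x (- k))
        + (g x (- k) * (- (of_real (q x) * G x k)) + (- (of_real (q x) * f x (- k)) - 2 * \<i> * (- k) * of_real (h x) * g x (- k)) * F x k))
      + - 2 * \<i> * k * of_real (h x) * ?E x * (G x k * f x (- k) + g x (- k) * F x k) = 0" for x
    by algebra
  ultimately have "(?D has_vector_derivative 0) (at x)" for x by simp
  from has_vector_derivative_zero_UNIV[of ?D, OF this] show ?thesis
    unfolding jb_def by metis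
qed

lemma F_cnj: "Im k \<ge> 0 \<Longrightarrow> cnj (F x k) = F x (- cnj k)" and G_cnj: "Im k \<ge> 0 \<Longrightarrow> cnj (G x k) = G x (- cnj k)"
  by (simp_all add: F_def G_def m.jsum_cnj)

lemma ja_cnj: "Im k \<ge> 0 \<Longrightarrow> cnj (ja k) = ja (- cnj k)"
  by (simp add: ja_def jsum_cnj F_cnj G_cnj)

lemma F_cont_k: "continuous_on {k. Im k \<ge> 0} (F x)" and G_cont_k: "continuous_on {k. Im k \<ge> 0} (G x)"
  and F_hol: "F x holomorphic_on {k. Im k > 0}" and G_hol: "G x holomorphic_on {k. Im k > 0}"
  using m.jsum_cont_k m.jsum_hol by (simp_all add: F_def[abs_def] G_def[abs_def])

lemma ja_cont: "continuous_on {k. Im k \<ge> 0} ja" and ja_hol: "ja holomorphic_on {k. Im k > 0}"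
  unfolding ja_def[abs_def]
  by (intro continuous_intros holomorphic_intros jsum_cont_k jsum_hol F_cont_k G_cont_k F_hol G_hol)+

definition KJ :: real where "KJ = C0 * pi * (KL + m.KL) + KL + m.KL"

lemma large_k:
  assumes k: "Im k \<ge> 0"
  shows "norm (2 * k) * norm (f x k - 1) \<le> KJ" "norm (2 * k) * norm (g x k) \<le> KJ"
    "norm (2 * k) * norm (F x k - 1) \<le> KJ" "norm (2 * k) * norm (G x k) \<le> KJ"
proof -
  have nn: "0 \<le> C0 * pi * KL" "0 \<le> C0 * pi * m.KL" "0 \<le> KL" "0 \<le> m.KL"
    using C0_nonneg KL_nonneg m.KL_nonneg by simp_all
  then show "norm (2 * k) * norm (f x k - 1) \<le> KJ" "norm (2 * k) * norm (g x k) \<le> KJ"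
    "norm (2 * k) * norm (F x k - 1) \<le> KJ" "norm (2 * k) * norm (G x k) \<le> KJ"
    using f_large[OF k, of x] g_large[OF k, of x] m.f_large[OF k, of "- x"] m.g_large[OF k, of "- x"]
    unfolding KJ_def F_def G_def distrib_left by linarith+
qed

lemma large_k_tendsto:
  fixes \<phi> :: "complex \<Rightarrow> complex"
  assumes "\<And>k. Im k \<ge> 0 \<Longrightarrow> norm (2 * k) * norm (\<phi> k - l) \<le> K"
  shows "(\<phi> \<longlongrightarrow> l) (inf at_infinity (principal {k. Im k \<ge> 0}))"
proof -
  have "((\<lambda>k. K / norm (2 * k)) \<longlongrightarrow> 0) (at_infinity :: complex filter)"
    by (intro tendsto_divide_0[OF tendsto_const] filterlim_at_top_imp_at_infinity
        filterlim_compose[OF filterlim_at_infinity_imp_norm_at_top tendsto_mult_filterlim_at_infinity[OF tendsto_const _ filterlim_ident]])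
       (auto intro: filterlim_ident)
  then have t: "((\<lambda>k. K / norm (2 * k)) \<longlongrightarrow> 0) (inf (at_infinity :: complex filter) (principal {k. Im k \<ge> 0}))"
    by (rule tendsto_mono[rotated]) simp
  have "\<forall>\<^sub>F k in inf at_infinity (principal {k. Im k \<ge> 0}). norm (\<phi> k - l) \<le> K / norm (2 * k)"
    unfolding eventually_inf_principal using eventually_not_equal_at_infinity[of 0]
    by eventually_elim (use assms in \<open>auto simp: field_simps\<close>)
  from Lim_null_comparison[OF this t] show ?thesis by (simp add: LIM_zero_iff)
qed

abbreviation up_inf :: "complex filter" where "up_inf \<equiv> inf at_infinity (principal {k. Im k \<ge> 0})"

lemma up_inf_tendsto:
  "((\<lambda>k. f x k) \<longlongrightarrow> 1) up_inf" "((\<lambda>k. g x k) \<longlongrightarrow> 0) up_inf"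
  "((\<lambda>k. F x k) \<longlongrightarrow> 1) up_inf" "((\<lambda>k. G x k) \<longlongrightarrow> 0) up_inf" "(ja \<longlongrightarrow> 1) up_inf"
proof -
  show t: "((\<lambda>k. f x k) \<longlongrightarrow> 1) up_inf" "((\<lambda>k. g x k) \<longlongrightarrow> 0) up_inf"
    "((\<lambda>k. F x k) \<longlongrightarrow> 1) up_inf" "((\<lambda>k. G x k) \<longlongrightarrow> 0) up_inf" for x
    by (rule large_k_tendsto[where K = KJ], use large_k[of _ x] in simp)+
  have "((\<lambda>k. f 0 k * F 0 k - g 0 k * G 0 k) \<longlongrightarrow> 1 * 1 - 0 * 0) up_inf"
    by (intro tendsto_intros t)
  then show "(ja \<longlongrightarrow> 1) up_inf" by (simp add: ja_def[abs_def])
qed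

text \<open>The solution \<open>(G, F)\<close> in the gauge of \<open>(n1, n2)\<close>.\<close>

definition e1 :: "real \<Rightarrow> complex \<Rightarrow> complex" where "e1 x k = of_real (hc x) * G x k - of_real (hs x) * F x k"
definition e2 :: "real \<Rightarrow> complex \<Rightarrow> complex" where "e2 x k = of_real (hc x) * F x k + of_real (hs x) * G x k"

lemma e_eq_m: "e1 x k = m.n2 (- x) k" "e2 x k = m.n1 (- x) k"
  by (simp_all add: e1_def e2_def m.n1_def m.n2_def F_def G_def m_hc m_hs)

lemma hc_hs_complex: "(of_real (hc x))\<^sup>2 + (of_real (hs x))\<^sup>2 = (1 :: complex)"
  using hc_hs[of x, THEN arg_cong[where f = complex_of_real]] by simp

text \<open>The change of gauge is a rotation and preserves determinants.\<close>

lemma ja_n: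
  assumes k: "Im k \<ge> 0"
  shows "ja k = n1 x k * e2 x k - n2 x k * e1 x k"
  unfolding ja_eq[OF k, of x, symmetric] n1_def n2_def e1_def e2_def using hc_hs_complex[of x] by algebra

abbreviation "at0 \<equiv> at (0 :: complex) within {k. Im k \<ge> 0}"

lemma e_tendsto_0: "((\<lambda>k. e1 x k) \<longlongrightarrow> 0) at0" "((\<lambda>k. e2 x k) \<longlongrightarrow> 1) at0"
    "((\<lambda>k. e1 x k / (\<i> * k)) \<longlongrightarrow> of_real (w x)) at0"
  unfolding e_eq_m using m.n_tendsto_k[of "- x"] m.n2_small[of "- x"] by simp_all

lemma ja_tendsto_0: "(ja \<longlongrightarrow> 1) at0"
proof -
  have "((\<lambda>k. n1 0 k * e2 0 k - n2 0 k * e1 0 k) \<longlongrightarrow> 1 * 1 - 0 * 0) at0"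
    by (intro tendsto_intros n_tendsto_k e_tendsto_0)
  then have "((\<lambda>k. n1 0 k * e2 0 k - n2 0 k * e1 0 k) \<longlongrightarrow> 1) at0" by simp
  then show ?thesis
    by (rule Lim_transform_eventually) (simp add: eventually_at_filter ja_n[of _ 0])
qed

lemma e1_ja_small: "((\<lambda>k. e1 x k / ja k / (\<i> * k)) \<longlongrightarrow> of_real (w x)) at0"
proof -
  have "((\<lambda>k. e1 x k / (\<i> * k) / ja k) \<longlongrightarrow> of_real (w x) / 1) at0"
    by (intro tendsto_intros e_tendsto_0 ja_tendsto_0) simp
  then show ?thesis by (simp add: field_simps)
qed

text \<open>\<open>ja_n\<close> gives \<open>e2 - ja = n2 * e1 - (n1 - 1) * e2\<close>. Dividing by
  \<open>ja\<close> thus trades the expansion of \<open>e2\<close>, which would involve the left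
  half-line, for that of \<open>n1\<close> on the right half-line.\<close>

lemma e2_ja_small:
  assumes nz: "\<And>k. Im k \<ge> 0 \<Longrightarrow> ja k \<noteq> 0"
  shows "((\<lambda>k. (e2 x k / ja k - 1) / (\<i> * k)) \<longlongrightarrow> - of_real (LINT y:{x..}|lborel. h y - 1)) at0"
proof -
  have "((\<lambda>k. ((n2 x k / (\<i> * k)) * e1 x k - ((n1 x k - 1) / (\<i> * k)) * e2 x k) / ja k)
      \<longlongrightarrow> (of_real (w x) * 0 - of_real (LINT y:{x..}|lborel. h y - 1) * 1) / 1) at0"
    by (intro tendsto_intros n1_small n2_small e_tendsto_0 ja_tendsto_0) simp
  then have "((\<lambda>k. ((n2 x k / (\<i> * k)) * e1 x k - ((n1 x k - 1) / (\<i> * k)) * e2 x k) / ja k)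
      \<longlongrightarrow> - of_real (LINT y:{x..}|lborel. h y - 1)) at0" by simp
  then show ?thesis
  proof (rule Lim_transform_eventually)
    have "((n2 x k / (\<i> * k)) * e1 x k - ((n1 x k - 1) / (\<i> * k)) * e2 x k) / ja k = (e2 x k / ja k - 1) / (\<i> * k)"
      if k: "Im k \<ge> 0" "k \<noteq> 0" for k
      using nz[OF k(1)] k by (simp add: field_simps ja_n[OF k(1), of x])
    then show "\<forall>\<^sub>F k in at0. ((n2 x k / (\<i> * k)) * e1 x k - ((n1 x k - 1) / (\<i> * k)) * e2 x k) / ja k = (e2 x k / ja k - 1) / (\<i> * k)"
      by (simp add: eventually_at_filter)
  qed
qed

end

section \<open>The Riemann--Hilbert problem\<close>

definition mat2 :: "complex \<Rightarrow> complex \<Rightarrow> complex \<Rightarrow> complex \<Rightarrow> complex^2^2" where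
  "mat2 a b c d = vector [vector [a, b], vector [c, d]]"

lemma mat2_nth [simp]:
  "mat2 a b c d $ 1 $ 1 = a" "mat2 a b c d $ 1 $ 2 = b" "mat2 a b c d $ 2 $ 1 = c" "mat2 a b c d $ 2 $ 2 = d"
  by (simp_all add: mat2_def)

lemma mat2_eq_iff: "A = mat2 a b c d \<longleftrightarrow> A $ 1 $ 1 = a \<and> A $ 1 $ 2 = b \<and> A $ 2 $ 1 = c \<and> A $ 2 $ 2 = d"
  by (auto simp: vec_eq_iff forall_2)

lemma mat2_mult: "mat2 a b c d ** mat2 a' b' c' d' = mat2 (a * a' + b * c') (a * b' + b * d') (c * a' + d * c') (c * b' + d * d')"
  by (simp add: mat2_eq_iff matrix_matrix_mult_def sum_2)

lemma mat2_one: "mat 1 = mat2 1 0 0 1"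
  by (simp add: mat2_eq_iff mat_def)

lemma mat2_eta: "A = mat2 (A $ 1 $ 1) (A $ 1 $ 2) (A $ 2 $ 1) (A $ 2 $ 2)"
  by (simp add: mat2_eq_iff)

lemma exp_sigma3_mat2: "exp_sigma3 \<tau> = mat2 (exp \<tau>) 0 0 (exp (- \<tau>))"
  by (simp add: mat2_eq_iff exp_sigma3_def sigma3_def)

lemma continuous_on_mat2:
  assumes "continuous_on S a" "continuous_on S b" "continuous_on S c" "continuous_on S d"
  shows "continuous_on S (\<lambda>x. mat2 (a x) (b x) (c x) (d x))"
proof -
  have "mat2 (a x) (b x) (c x) (d x) = (\<chi> i j. if i = 1 then if j = 1 then a x else b x else if j = 1 then c x else d x)" for x
    by (simp add: vec_eq_iff forall_2)
  moreover have "continuous_on S (\<lambda>x. if i = 1 then if j = 1 then a x else b x else if j = 1 then c x else d x)" for i j :: 2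
    using assms by (cases "i = 1"; cases "j = 1") simp_all
  ultimately show ?thesis by (simp add: continuous_on_vec_lambda)
qed

lemma tendsto_mat2:
  assumes "(a \<longlongrightarrow> a') F" "(b \<longlongrightarrow> b') F" "(c \<longlongrightarrow> c') F" "(d \<longlongrightarrow> d') F"
  shows "((\<lambda>x. mat2 (a x) (b x) (c x) (d x)) \<longlongrightarrow> mat2 a' b' c' d') F"
proof (intro vec_tendstoI)
  fix i j :: 2
  show "((\<lambda>x. mat2 (a x) (b x) (c x) (d x) $ i $ j) \<longlongrightarrow> mat2 a' b' c' d' $ i $ j) F"
    using assms exhaust_2[of i] exhaust_2[of j] by auto
qed

text \<open>Conjugation with \<open>exp_sigma3\<close> keeps the diagonal and doubles the phase off
  it. The jump is governed by the single number \<open>\<rho>\<close>, and its determinant is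
  visibly 1.\<close>

lemma jump_mat2:
  assumes "\<rho> = r k * exp (2 * \<i> * of_real (k * y - t / (4 * k)))"
  shows "jump r y t k = mat2 1 \<rho> (cnj \<rho>) (1 + \<rho> * cnj \<rho>)"
proof -
  define \<theta> where "\<theta> = \<i> * complex_of_real (k * y - t / (4 * k))"
  have c: "cnj (exp \<theta>) = exp (- \<theta>)" by (simp add: \<theta>_def exp_cnj)
  have e: "exp \<theta> * exp (- \<theta>) = 1" by (simp add: exp_minus)
  have \<rho>: "\<rho> = r k * (exp \<theta> * exp \<theta>)"
  proof -
    have "2 * \<i> * complex_of_real (k * y - t / (4 * k)) = \<theta> + \<theta>" by (simp add: \<theta>_def algebra_simps)
    then show ?thesis by (simp only: assms exp_add)
  qed
  have \<rho>': "cnj \<rho> = cnj (r k) * (exp (- \<theta>) * exp (- \<theta>))" by (simp add: \<rho> c)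
  have rr: "complex_of_real ((cmod (r k))\<^sup>2) = r k * cnj (r k)" by (rule complex_norm_square)
  have "jump r y t k = mat2 (exp \<theta>) 0 0 (exp (- \<theta>)) ** mat2 1 (r k) (cnj (r k)) (1 + r k * cnj (r k)) ** mat2 (exp (- \<theta>)) 0 0 (exp \<theta>)"
    unfolding jump_def exp_sigma3_mat2 \<theta>_def[symmetric] mat2_def[symmetric] rr by simp
  also have "\<dots> = mat2 1 \<rho> (cnj \<rho>) (1 + \<rho> * cnj \<rho>)"
    unfolding mat2_mult unfolding mat2_eq_iff mat2_nth using e \<rho> \<rho>' by (intro conjI; algebra)
  finally show ?thesis .
qed

lemma boundary_plus_eq:
  assumes "continuous_on {k. Im k \<ge> 0} P" "\<And>k. Im k > 0 \<Longrightarrow> P k = M k"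
  shows "boundary_plus M k = P (of_real k)"
  unfolding boundary_plus_def
proof (rule tendsto_Lim)
  have "(P \<longlongrightarrow> P (of_real k)) (at (of_real k) within {k. Im k \<ge> 0})"
    using assms(1) by (simp add: continuous_on_def)
  moreover have "filterlim (\<lambda>\<epsilon>. of_real k + \<i> * of_real \<epsilon>) (at (of_real k) within {k. Im k \<ge> 0}) (at_right 0)"
    unfolding filterlim_at
  proof
    have "((\<lambda>\<epsilon>. of_real k + \<i> * of_real \<epsilon>) \<longlongrightarrow> of_real k + \<i> * of_real 0) (at_right 0)"
      by (intro tendsto_intros)
    then show "((\<lambda>\<epsilon>. of_real k + \<i> * of_real \<epsilon>) \<longlongrightarrow> of_real k) (at_right 0)" by simp
  qed (auto simp: eventually_at_right_less eventually_at_filter)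
  ultimately have "((\<lambda>\<epsilon>. P (of_real k + \<i> * of_real \<epsilon>)) \<longlongrightarrow> P (of_real k)) (at_right 0)"
    by (rule filterlim_compose)
  then show "((\<lambda>\<epsilon>. M (of_real k + \<i> * of_real \<epsilon>)) \<longlongrightarrow> P (of_real k)) (at_right 0)"
    by (rule Lim_transform_eventually) (auto simp: assms(2) eventually_at_filter)
qed simp

text \<open>The substitution \<open>k \<mapsto> - k\<close> exchanges the half-planes and reduces
  this to \<open>boundary_plus_eq\<close>.\<close>

lemma boundary_minus_eq:
  assumes "continuous_on {k. Im k \<le> 0} N" "\<And>k. Im k < 0 \<Longrightarrow> N k = M k"
  shows "boundary_minus M k = N (of_real k)"
proof -
  have "continuous_on {k. Im k \<ge> 0} (\<lambda>k. N (- k))"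
    by (rule continuous_on_compose2[OF assms(1)]) (auto intro!: continuous_intros)
  from boundary_plus_eq[OF this, of "\<lambda>k. M (- k)" "- k"] assms(2)
  have "Lim (at_right 0) (\<lambda>\<epsilon>. M (- (of_real (- k) + \<i> * of_real \<epsilon>))) = N (of_real k)"
    by (simp add: boundary_plus_def)
  then show ?thesis by (simp add: boundary_minus_def)
qed

text \<open>The adjugate, which is the inverse for determinant 1. Its entries are those of
  \<open>A\<close> up to sign, so continuity, limits and analyticity carry over at once.\<close>

definition adj2 :: "complex^2^2 \<Rightarrow> complex^2^2" where
  "adj2 A = mat2 (A $ 2 $ 2) (- A $ 1 $ 2) (- A $ 2 $ 1) (A $ 1 $ 1)"

lemma adj2_mult: "adj2 (A ** B) = adj2 B ** adj2 A"
  by (subst (1 2) mat2_eta[of A], subst (1 2) mat2_eta[of B], simp only: mat2_mult adj2_def mat2_nth)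
     (simp add: mat2_eq_iff algebra_simps)

lemma adj2_right: "A ** adj2 A = mat2 (det A) 0 0 (det A)" and adj2_left: "adj2 A ** A = mat2 (det A) 0 0 (det A)"
  by (simp_all add: mat2_eq_iff adj2_def matrix_matrix_mult_def sum_2 det_2 algebra_simps)

lemma continuous_on_matrix_mult:
  fixes A B :: "'a :: topological_space \<Rightarrow> complex^2^2"
  assumes "continuous_on S A" "continuous_on S B"
  shows "continuous_on S (\<lambda>x. A x ** B x)"
  unfolding matrix_matrix_mult_def using assms by (intro continuous_intros) auto

lemma tendsto_matrix_mult:
  fixes A B :: "'a \<Rightarrow> complex^2^2"
  assumes "(A \<longlongrightarrow> a) F" "(B \<longlongrightarrow> b) F"
  shows "((\<lambda>x. A x ** B x) \<longlongrightarrow> a ** b) F"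
  unfolding matrix_matrix_mult_def using assms by (intro tendsto_intros)

lemma tendsto_adj2: "(A \<longlongrightarrow> a) F \<Longrightarrow> ((\<lambda>x. adj2 (A x)) \<longlongrightarrow> adj2 a) F"
  unfolding adj2_def by (intro tendsto_mat2 tendsto_intros)

lemma continuous_on_adj2: "continuous_on S A \<Longrightarrow> continuous_on S (\<lambda>x. adj2 (A x))"
  unfolding adj2_def by (intro continuous_on_mat2 continuous_intros)

text \<open>Continuity across the real line and analyticity on both sides make \<open>E\<close>
  entire. The limit at infinity is known off the real line only; a real \<open>k\<close> is
  approached by points above it, whose modulus is not smaller.\<close>

lemma Liouville_off_line:
  fixes E :: "complex \<Rightarrow> complex"
  assumes c: "continuous_on UNIV E" and h: "E holomorphic_on {k. Im k > 0}" "E holomorphic_on {k. Im k < 0}"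
    and l: "(E \<longlongrightarrow> l) (inf at_infinity (principal {k. Im k \<noteq> 0}))"
  shows "E k = l"
proof (rule Liouville_weak[where f = E])
  have i: "\<i> \<bullet> z = Im z" for z by (simp add: inner_complex_def)
  show "E holomorphic_on UNIV"
    by (rule holomorphic_on_paste_across_line[where d = \<i> and k = 0]) (use c h in \<open>auto simp: i\<close>)
  show "(E \<longlongrightarrow> l) at_infinity"
  proof (rule tendstoI)
    fix e :: real assume e: "e > 0"
    have "\<forall>\<^sub>F k in inf at_infinity (principal {k. Im k \<noteq> 0}). dist (E k) l < e / 2"
      by (rule tendstoD[OF l]) (use e in simp)
    then obtain R where R: "\<And>k. R \<le> norm k \<Longrightarrow> Im k \<noteq> 0 \<Longrightarrow> dist (E k) l < e / 2"
      unfolding eventually_inf_principal eventually_at_infinity by blast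
    have "dist (E k) l < e" if k: "R \<le> norm k" for k
    proof (cases "Im k = 0")
      case True
      have "(\<lambda>n. k + \<i> * of_real (1 / real (Suc n))) \<longlonglongrightarrow> k + \<i> * of_real 0"
        by (intro tendsto_intros LIMSEQ_Suc[OF lim_1_over_n])
      then have "(\<lambda>n. k + \<i> * of_real (1 / real (Suc n))) \<longlonglongrightarrow> k" by simp
      from continuous_on_tendsto_compose[OF c this]
      have "(\<lambda>n. dist (E (k + \<i> * of_real (1 / real (Suc n)))) l) \<longlonglongrightarrow> dist (E k) l"
        by (intro tendsto_intros) auto
      moreover have "dist (E (k + \<i> * of_real (1 / real (Suc n)))) l \<le> e / 2" for n
      proof -
        have "norm k = \<bar>Re k\<bar>" using True by (simp add: cmod_def)
        also have "\<dots> \<le> norm (k + \<i> * of_real (1 / real (Suc n)))"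
          using abs_Re_le_cmod[of "k + \<i> * of_real (1 / real (Suc n))"] by simp
        finally have "R \<le> norm (k + \<i> * of_real (1 / real (Suc n)))" using k by linarith
        moreover have "Im (k + \<i> * of_real (1 / real (Suc n))) \<noteq> 0" using True by simp
        ultimately show ?thesis using R by (simp add: less_imp_le)
      qed
      ultimately have "dist (E k) l \<le> e / 2"
        by (intro LIMSEQ_le_const2) auto
      then show ?thesis using e by simp
    qed (use R[of k] k e in auto)
    then show "\<forall>\<^sub>F k in at_infinity. dist (E k) l < e"
      unfolding eventually_at_infinity by blast
  qed
qed

lemma closed_halfplanes: "closed {k. Im k \<ge> 0}" "closed {k. Im k \<le> 0}"
  by (simp_all add: closed_halfspace_Im_ge closed_halfspace_Im_le)

lemma rhp_unique:
  assumes M: "rhp_solution r y t M" and M': "rhp_solution r y t M'"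
    and det: "\<And>k. Im k \<noteq> 0 \<Longrightarrow> det (M k) = 1" and k: "Im k \<noteq> 0"
  shows "M' k = M k"
proof -
  obtain P where P: "continuous_on {k. Im k \<ge> 0} P" "\<And>k. Im k > 0 \<Longrightarrow> P k = M k"
    using M unfolding rhp_solution_def by metis
  obtain P' where P': "continuous_on {k. Im k \<ge> 0} P'" "\<And>k. Im k > 0 \<Longrightarrow> P' k = M' k"
    using M' unfolding rhp_solution_def by metis
  obtain N where N: "continuous_on {k. Im k \<le> 0} N" "\<And>k. Im k < 0 \<Longrightarrow> N k = M k"
    using M unfolding rhp_solution_def by metis
  obtain N' where N': "continuous_on {k. Im k \<le> 0} N'" "\<And>k. Im k < 0 \<Longrightarrow> N' k = M' k"
    using M' unfolding rhp_solution_def by metis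
  \<comment> \<open>Off the axis \<open>det (M k) = 1\<close>, so this is \<open>M'\<close> times
    the inverse of \<open>M\<close>; the continuous extensions \<open>P\<close>, \<open>N\<close>
    give it values on the axis.\<close>
  define E where "E k = (if Im k \<ge> 0 then P' k ** adj2 (P k) else N' k ** adj2 (N k))" for k
  \<comment> \<open>The jump has determinant 1, so its adjugate cancels it: \<open>E\<close> has no
    jump.\<close>
  have J: "jump r y t k ** adj2 (jump r y t k) = mat 1" for k
    by (simp add: jump_mat2[OF refl] adj2_right mat2_one det_2)
  have real: "P' k ** adj2 (P k) = N' k ** adj2 (N k)" if "Im k = 0" for k
  proof -
    obtain x where x: "k = of_real x" using \<open>Im k = 0\<close> by (metis complex_is_Real_iff Reals_cases)
    have "P k = N k ** jump r y t x" "P' k = N' k ** jump r y t x"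
      using M M' boundary_plus_eq[OF P, of x] boundary_plus_eq[OF P', of x] boundary_minus_eq[OF N, of x] boundary_minus_eq[OF N', of x]
      by (simp_all add: rhp_solution_def x)
    then have "P' k ** adj2 (P k) = N' k ** (jump r y t x ** adj2 (jump r y t x)) ** adj2 (N k)"
      by (simp add: adj2_mult matrix_mul_assoc)
    then show ?thesis by (simp add: J)
  qed
  have cE: "continuous_on UNIV E"
  proof -
    have "continuous_on ({k. Im k \<ge> 0} \<union> {k. Im k \<le> 0}) E"
      unfolding E_def
      by (intro continuous_on_cases closed_halfplanes continuous_on_matrix_mult continuous_on_adj2 P P' N N')
         (auto intro: real)
    moreover have "{k. Im k \<ge> 0} \<union> {k. Im k \<le> 0} = UNIV" by auto
    ultimately show ?thesis by simp
  qed
  have EM: "E k = M' k ** adj2 (M k)" if "Im k \<noteq> 0" for k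
    using that P(2)[of k] P'(2)[of k] N(2)[of k] N'(2)[of k] by (simp add: E_def)
  have hol: "(\<lambda>k. E k $ i $ j) holomorphic_on S"
    if S: "S = {k. Im k > 0} \<or> S = {k. Im k < 0}" for i j S
  proof -
    have H: "(\<lambda>k. M k $ i $ j) holomorphic_on S" "(\<lambda>k. M' k $ i $ j) holomorphic_on S" for i j
      using M M' S unfolding rhp_solution_def by auto
    have "(\<lambda>k. adj2 (M k) $ i $ j) holomorphic_on S" for i j
      using exhaust_2[of i] exhaust_2[of j] by (auto simp: adj2_def intro!: holomorphic_intros H)
    then have "(\<lambda>k. (M' k ** adj2 (M k)) $ i $ j) holomorphic_on S"
      unfolding matrix_matrix_mult_def by (auto simp: sum_2 intro!: holomorphic_intros H)
    then show ?thesis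
      by (rule holomorphic_transform) (use S EM in auto)
  qed
  have lim: "(E \<longlongrightarrow> mat 1) (inf at_infinity (principal {k. Im k \<noteq> 0}))"
  proof -
    have "((\<lambda>k. M' k ** adj2 (M k)) \<longlongrightarrow> mat 1 ** adj2 (mat 1)) (inf at_infinity (principal {k. Im k \<noteq> 0}))"
      using M M' unfolding rhp_solution_def by (intro tendsto_matrix_mult tendsto_adj2) auto
    then have "((\<lambda>k. M' k ** adj2 (M k)) \<longlongrightarrow> mat 1) (inf at_infinity (principal {k. Im k \<noteq> 0}))"
      by (simp add: adj2_right mat2_one[symmetric])
    then show ?thesis
      by (rule Lim_transform_eventually) (simp add: eventually_inf_principal EM)
  qed
  have "E k $ i $ j = mat 1 $ i $ j" for i j
    by (rule Liouville_off_line)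
       (intro continuous_intros cE hol tendsto_vec_nth lim disjI1 disjI2 refl)+
  then have "M' k ** adj2 (M k) = mat 1" by (simp add: vec_eq_iff EM[OF k, symmetric])
  then have "M' k ** (adj2 (M k) ** M k) = M k" by (simp add: matrix_mul_assoc)
  then show ?thesis by (simp add: adj2_left det[OF k] mat2_one[symmetric])
qed

section \<open>The Riemann-Hilbert solution built from Jost solutions\<close>

context scatter
begin

text \<open>The boundary value from below is expressed by data at \<open>- k\<close>, since \<open>k \<mapsto> - k\<close> exchanges the two columns
  of each \<open>\<mu>\<^sub>j\<close> up to signs.\<close>

definition Mp :: "real \<Rightarrow> complex \<Rightarrow> complex^2^2" where
  "Mp x k = mat2 (f x k) (G x k / ja k) (g x k) (F x k / ja k)"
definition Mm :: "real \<Rightarrow> complex \<Rightarrow> complex^2^2" where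
  "Mm x k = mat2 (F x (- k) / ja (- k)) (- g x (- k)) (- G x (- k) / ja (- k)) (f x (- k))"
definition jM :: "real \<Rightarrow> complex \<Rightarrow> complex^2^2" where
  "jM x k = (if Im k > 0 then Mp x k else Mm x k)"

context
  assumes nz: "\<And>k. Im k \<ge> 0 \<Longrightarrow> ja k \<noteq> 0"
begin

lemma det_jM: "det (jM x k) = 1"
proof -
  have "(f x k * F x k - g x k * G x k) / ja k = 1" if "Im k \<ge> 0" for k
    using ja_eq[OF that, of x] nz[OF that] by simp
  from this[of k] this[of "- k"] show ?thesis
    by (auto simp: jM_def Mp_def Mm_def det_2 diff_divide_distrib mult_ac)
qed

lemma Mp_cont: "continuous_on {k. Im k \<ge> 0} (Mp x)"
  unfolding Mp_def
  by (intro continuous_on_mat2 continuous_intros jsum_cont_k F_cont_k G_cont_k ja_cont) (use nz in auto)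

lemma Mm_cont: "continuous_on {k. Im k \<le> 0} (Mm x)"
proof -
  have u: "continuous_on {k. Im k \<le> 0} (\<lambda>k. \<phi> (- k))" if "continuous_on {k. Im k \<ge> 0} \<phi>" for \<phi> :: "complex \<Rightarrow> complex"
    by (rule continuous_on_compose2[OF that]) (auto intro!: continuous_intros)
  show ?thesis
    unfolding Mm_def
    by (intro continuous_on_mat2 continuous_intros u jsum_cont_k F_cont_k G_cont_k ja_cont) (use nz in auto)
qed

text \<open>The scattering relation between the columns of \<open>mu1\<close> and
  \<open>mu2\<close>, rearranged. It follows algebraically from the determinant identities for
  \<open>ja k\<close>, \<open>ja (- k)\<close> and \<open>det_one\<close>, and from the values of
  \<open>\<rho>\<close> and its conjugate.\<close>

lemma Mp_eq_Mm_mult: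
  assumes k: "Im k = 0" and \<rho>: "\<rho> = jb k / ja k * exp (2 * \<i> * k * of_real (P x))"
  shows "Mp x k = Mm x k ** mat2 1 \<rho> (cnj \<rho>) (1 + \<rho> * cnj \<rho>)"
proof -
  have k1: "Im k \<ge> 0" "Im (- k) \<ge> 0" using k by simp_all
  have ck: "- cnj k = - k" "- cnj (- k) = k" using k by (simp_all add: complex_eq_iff)
  have E: "exp (- 2 * \<i> * k * of_real (P x)) * exp (2 * \<i> * k * of_real (P x)) = 1"
    by (simp add: exp_minus)
  have r: "\<rho> * ja k = G x k * f x (- k) + g x (- k) * F x k"
  proof -
    have "\<rho> * ja k = jb k * exp (2 * \<i> * k * of_real (P x))" using nz[OF k1(1)] by (simp add: \<rho>)
    also have "\<dots> = (exp (- 2 * \<i> * k * of_real (P x)) * exp (2 * \<i> * k * of_real (P x))) * (G x k * f x (- k) + g x (- k) * F x k)"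
      by (simp only: jb_eq[OF k, of x, symmetric] mult_ac)
    finally show ?thesis by (simp only: E mult_1)
  qed
  \<comment> \<open>For real \<open>k\<close>, conjugation acts on each of the functions as
    \<open>k \<mapsto> - k\<close>.\<close>
  have r': "cnj \<rho> * ja (- k) = G x (- k) * f x k + g x k * F x (- k)"
    using arg_cong[OF r, of cnj] k1 by (simp add: jsum_cnj F_cnj G_cnj ja_cnj ck)
  note a = nz[OF k1(1)] nz[OF k1(2)] ja_eq[OF k1(1), of x] ja_eq[OF k1(2), of x] det_one[OF k, of x]
  \<comment> \<open>Reciprocals become variables with a polynomial relation, so that the four matrix
    entries are ideal membership problems.\<close>
  define i where "i = 1 / ja (- k)"
  have i: "i * ja (- k) = 1" using a by (simp add: i_def)
  define j where "j = 1 / ja k"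
  have j: "j * ja k = 1" using a by (simp add: j_def)
  have rj: "\<rho> = (G x k * f x (- k) + g x (- k) * F x k) * j" and rj': "cnj \<rho> = (G x (- k) * f x k + g x k * F x (- k)) * i"
    using r r' a by (simp_all add: i_def j_def field_simps)
  have 1: "f x k = (F x (- k) * i) * 1 + (- g x (- k)) * cnj \<rho>" using i rj' a(3-5) by algebra
  have 2: "g x k = (- G x (- k) * i) * 1 + f x (- k) * cnj \<rho>" using i rj' a(3-5) by algebra
  \<comment> \<open>The identities for the first column, already established, absorb the products
    \<open>\<rho> * cnj \<rho>\<close> in the second.\<close>
  have 3: "G x k * j = (F x (- k) * i) * \<rho> + (- g x (- k)) * (1 + \<rho> * cnj \<rho>)"
  proof -
    have "(F x (- k) * i) * \<rho> + (- g x (- k)) * (1 + \<rho> * cnj \<rho>) = \<rho> * f x k - g x (- k)"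
      using 1 by algebra
    also have "\<dots> = G x k * j" using rj j a(3) a(5) by algebra
    finally show ?thesis by simp
  qed
  have 4: "F x k * j = (- G x (- k) * i) * \<rho> + f x (- k) * (1 + \<rho> * cnj \<rho>)"
  proof -
    have "(- G x (- k) * i) * \<rho> + f x (- k) * (1 + \<rho> * cnj \<rho>) = \<rho> * g x k + f x (- k)"
      using 2 by algebra
    also have "\<dots> = F x k * j" using rj j a(3) a(5) by algebra
    finally show ?thesis by simp
  qed
  show ?thesis
    unfolding Mp_def Mm_def mat2_mult unfolding mat2_eq_iff mat2_nth
    using 1 2 3 4 by (simp add: i_def j_def)
qed

lemma jM_tendsto: "(jM x \<longlongrightarrow> mat 1) (inf at_infinity (principal {k. Im k \<noteq> 0}))"
proof -
  have "((\<lambda>k. mat2 (f x k) (G x k / ja k) (g x k) (F x k / ja k)) \<longlongrightarrow> mat2 1 (0 / 1) 0 (1 / 1)) up_inf"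
    by (intro tendsto_mat2 tendsto_divide up_inf_tendsto) simp_all
  then have p: "(Mp x \<longlongrightarrow> mat 1) up_inf" by (simp add: Mp_def[abs_def] mat2_one)
  have m: "((\<lambda>k. mat2 (F x k / ja k) (- g x k) (- G x k / ja k) (f x k)) \<longlongrightarrow> mat2 (1 / 1) (- 0) (- 0 / 1) 1) up_inf"
    by (intro tendsto_mat2 tendsto_divide tendsto_minus up_inf_tendsto) simp_all
  have fl: "filterlim (\<lambda>k :: complex. - k) up_inf (inf at_infinity (principal {k. Im k \<le> 0}))"
  proof -
    have "filterlim (\<lambda>k :: complex. - k) at_infinity at_infinity"
      by (rule filterlim_norm_at_top_imp_at_infinity)
         (simp add: filterlim_at_infinity_imp_norm_at_top[OF filterlim_ident])
    then have "filterlim (\<lambda>k :: complex. - k) at_infinity (inf at_infinity (principal {k. Im k \<le> 0}))"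
      by (rule filterlim_mono) simp_all
    then show ?thesis
      unfolding filterlim_inf filterlim_principal by (simp add: eventually_inf_principal)
  qed
  have m': "(Mm x \<longlongrightarrow> mat 1) (inf at_infinity (principal {k. Im k \<le> 0}))"
    using filterlim_compose[OF m fl] by (simp add: Mm_def[abs_def] mat2_one)
  show ?thesis
  proof (rule topological_tendstoI)
    fix S :: "(complex^2^2) set" assume S: "open S" "mat 1 \<in> S"
    from topological_tendstoD[OF p S] topological_tendstoD[OF m' S]
    show "\<forall>\<^sub>F k in inf at_infinity (principal {k. Im k \<noteq> 0}). jM x k \<in> S"
      unfolding eventually_inf_principal by eventually_elim (auto simp: jM_def)
  qed
qed

text \<open>In the application \<open>r\<close> belongs to time 0, whereas \<open>ja\<close>,
  \<open>jb\<close> and \<open>P\<close> belong to the potential at time \<open>t\<close>; the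
  assumption says that the two phases compensate each other on the real line.\<close>

lemma rhp_solution_jM:
  assumes r: "\<And>k. r k * exp (2 * \<i> * of_real (k * y - t / (4 * k))) = jb (of_real k) / ja (of_real k) * exp (2 * \<i> * of_real k * of_real (P x))"
  shows "rhp_solution r y t (jM x)"
  unfolding rhp_solution_def
proof (intro conjI allI)
  fix i j :: 2
  have "(\<lambda>k. Mp x k $ i $ j) holomorphic_on {k. Im k > 0}"
    using exhaust_2[of i] exhaust_2[of j] nz
    by (auto simp: Mp_def intro!: holomorphic_intros jsum_hol F_hol G_hol ja_hol)
  then show "(\<lambda>k. jM x k $ i $ j) holomorphic_on {k. Im k > 0}"
    by (rule holomorphic_transform) (simp add: jM_def)
  have u: "(\<lambda>k. \<phi> (- k)) holomorphic_on {k. Im k < 0}" if "\<phi> holomorphic_on {k. Im k > 0}" for \<phi>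
    by (rule holomorphic_on_compose_gen[OF _ that, of "\<lambda>k. - k", unfolded comp_def]) (auto intro!: holomorphic_intros)
  have "(\<lambda>k. Mm x k $ i $ j) holomorphic_on {k. Im k < 0}"
    using exhaust_2[of i] exhaust_2[of j] nz
    by (auto simp: Mm_def intro!: holomorphic_intros u jsum_hol F_hol G_hol ja_hol)
  then show "(\<lambda>k. jM x k $ i $ j) holomorphic_on {k. Im k < 0}"
    by (rule holomorphic_transform) (simp add: jM_def)
next
  show "\<exists>Q. continuous_on {k. Im k \<ge> 0} Q \<and> (\<forall>k. Im k > 0 \<longrightarrow> Q k = jM x k)"
    using Mp_cont by (intro exI[of _ "Mp x"]) (simp add: jM_def)
  show "\<exists>N. continuous_on {k. Im k \<le> 0} N \<and> (\<forall>k. Im k < 0 \<longrightarrow> N k = jM x k)"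
    using Mm_cont by (intro exI[of _ "Mm x"]) (simp add: jM_def)
  show "(jM x \<longlongrightarrow> mat 1) (inf at_infinity (principal {k. Im k \<noteq> 0}))"
    by (rule jM_tendsto)
next
  fix k
  have "boundary_plus (jM x) k = Mp x (of_real k)"
    by (rule boundary_plus_eq[OF Mp_cont]) (simp add: jM_def)
  moreover have "boundary_minus (jM x) k = Mm x (of_real k)"
    by (rule boundary_minus_eq[OF Mm_cont]) (simp add: jM_def)
  ultimately show "boundary_plus (jM x) k = boundary_minus (jM x) k ** jump r y t k"
    using Mp_eq_Mm_mult[of "of_real k", OF _ r[of k]] jump_mat2[OF refl, of r y t k] by simp
qed

text \<open>The values of the Jost solutions at \<open>k = 0\<close>, a rotation by half of
  \<open>arctan w1\<close>. Its inverse carries \<open>(f, g)\<close> to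
  \<open>(n1, n2)\<close>.\<close>

definition M0 :: "real \<Rightarrow> complex^2^2" where
  "M0 x = mat2 (of_real (hc x)) (of_real (hs x)) (of_real (- hs x)) (of_real (hc x))"

lemma M0_inv: "matrix_inv (M0 x) = mat2 (of_real (hc x)) (of_real (- hs x)) (of_real (hs x)) (of_real (hc x))"
  and M0_invertible: "invertible (M0 x)"
proof -
  let ?N = "mat2 (of_real (hc x)) (of_real (- hs x)) (of_real (hs x)) (of_real (hc x))"
  have 1: "M0 x ** ?N = mat 1" "?N ** M0 x = mat 1"
    using hc_hs_complex[of x] by (simp_all add: M0_def mat2_mult mat2_one power2_eq_square mult.commute add.commute)
  then show "invertible (M0 x)" unfolding invertible_def by blast
  have "M0 x ** matrix_inv (M0 x) = mat 1 \<and> matrix_inv (M0 x) ** M0 x = mat 1"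
    unfolding matrix_inv_def by (rule someI[of _ ?N]) (rule conjI[OF 1])
  then have "matrix_inv (M0 x) ** (M0 x ** ?N) = ?N" by (simp add: matrix_mul_assoc)
  then show "matrix_inv (M0 x) = ?N" by (simp only: 1 matrix_mul_rid)
qed

lemma at_within_off_real: "at (0::complex) within {k. Im k \<noteq> 0} = sup (at 0 within {k. Im k > 0}) (at 0 within {k. Im k < 0})"
proof -
  have "{k. Im k \<noteq> 0} = {k. Im k > 0} \<union> {k. Im k < 0}" by auto
  then show ?thesis by (simp add: at_within_union)
qed

text \<open>Both half-planes are parametrised by the upper one, the lower one through
  \<open>k \<mapsto> - k\<close>, because \<open>Mm\<close> is made of data at
  \<open>- k\<close>.\<close>

lemma tendsto_off_real:
  assumes p: "(\<phi> \<longlongrightarrow> l) at0" and m: "(\<psi> \<longlongrightarrow> l) at0"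
    and eqp: "\<And>k. Im k > 0 \<Longrightarrow> \<eta> k = \<phi> k" and eqm: "\<And>k. Im k > 0 \<Longrightarrow> \<eta> (- k) = \<psi> k"
  shows "(\<eta> \<longlongrightarrow> l) (at 0 within {k. Im k \<noteq> 0})"
proof -
  have 1: "(\<eta> \<longlongrightarrow> l) (at 0 within {k. Im k > 0})"
    by (rule Lim_transform_eventually[OF tendsto_within_subset[OF p]]) (auto simp: eventually_at_filter eqp)
  have fl: "filterlim (\<lambda>k. - k) at0 (at 0 within {k. Im k < 0})"
    unfolding filterlim_at using tendsto_minus[OF tendsto_ident_at[of "0::complex" "{k. Im k < 0}"]]
    by (auto simp: eventually_at_filter)
  have 2: "(\<eta> \<longlongrightarrow> l) (at 0 within {k. Im k < 0})"
  proof (rule Lim_transform_eventually[OF filterlim_compose[OF m fl]])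
    show "\<forall>\<^sub>F k in at 0 within {k. Im k < 0}. \<psi> (- k) = \<eta> k"
      using eqm[of "- k" for k] by (auto simp: eventually_at_filter)
  qed
  show ?thesis unfolding at_within_off_real by (rule filterlim_sup[OF 1 2])
qed

lemma jM_tendsto_0: "(jM x \<longlongrightarrow> M0 x) (at 0 within {k. Im k \<noteq> 0})"
proof (rule tendsto_off_real)
  have c0: "(jsum b x \<longlongrightarrow> jsum b x 0) at0" for b
    using jsum_cont_k[of b x] by (simp add: continuous_on_def)
  have F0: "(F x \<longlongrightarrow> of_real (hc x)) at0" "(G x \<longlongrightarrow> of_real (hs x)) at0"
  proof -
    have "F x 0 = of_real (hc x)" "G x 0 = of_real (hs x)"
      by (simp_all add: F_def G_def m.jsum_at_0 m_hc m_hs)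
    then show "(F x \<longlongrightarrow> of_real (hc x)) at0" "(G x \<longlongrightarrow> of_real (hs x)) at0"
      using F_cont_k[of x, unfolded continuous_on_def, THEN bspec[where x = 0]]
        G_cont_k[of x, unfolded continuous_on_def, THEN bspec[where x = 0]] by simp_all
  qed
  have "((\<lambda>k. mat2 (f x k) (G x k / ja k) (g x k) (F x k / ja k)) \<longlongrightarrow> mat2 (f x 0) (of_real (hs x) / 1) (g x 0) (of_real (hc x) / 1)) at0"
    by (intro tendsto_mat2 tendsto_divide c0 F0 ja_tendsto_0) simp_all
  then show "(Mp x \<longlongrightarrow> M0 x) at0" by (simp add: Mp_def[abs_def] M0_def jsum_at_0)
  have "((\<lambda>k. mat2 (F x k / ja k) (- g x k) (- G x k / ja k) (f x k)) \<longlongrightarrow> mat2 (of_real (hc x) / 1) (- g x 0) (- of_real (hs x) / 1) (f x 0)) at0"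
    by (intro tendsto_mat2 tendsto_divide tendsto_minus c0 F0 ja_tendsto_0) simp_all
  then show "((\<lambda>k. Mm x (- k)) \<longlongrightarrow> M0 x) at0" by (simp add: Mm_def[abs_def] M0_def jsum_at_0)
qed (simp_all add: jM_def)

text \<open>Above the axis the entry is \<open>n1\<close>, below it is \<open>e2 / ja\<close> at
  \<open>- k\<close>. The sign that \<open>\<i> * k\<close> acquires under
  \<open>k \<mapsto> - k\<close> makes the two one-sided limits agree.\<close>

lemma jM_small_11:
  "((\<lambda>k. ((matrix_inv (M0 x) ** jM x k) $ 1 $ 1 - 1) / (\<i> * k)) \<longlongrightarrow> of_real (LINT y:{x..}|lborel. h y - 1))
     (at 0 within {k. Im k \<noteq> 0})"
proof (rule tendsto_off_real)
  show "((\<lambda>k. (n1 x k - 1) / (\<i> * k)) \<longlongrightarrow> of_real (LINT y:{x..}|lborel. h y - 1)) at0" by (rule n1_small)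
  show "((\<lambda>k. - ((e2 x k / ja k - 1) / (\<i> * k))) \<longlongrightarrow> of_real (LINT y:{x..}|lborel. h y - 1)) at0"
    using tendsto_minus[OF e2_ja_small[OF nz, of x]] by simp
qed (auto simp: M0_inv jM_def Mp_def Mm_def mat2_mult n1_def e2_def add_divide_distrib mult_ac)

lemma jM_small_21:
  "((\<lambda>k. (matrix_inv (M0 x) ** jM x k) $ 2 $ 1 / (\<i> * k)) \<longlongrightarrow> of_real (w x)) (at 0 within {k. Im k \<noteq> 0})"
proof (rule tendsto_off_real)
  show "((\<lambda>k. n2 x k / (\<i> * k)) \<longlongrightarrow> of_real (w x)) at0" by (rule n2_small)
  show "((\<lambda>k. e1 x k / ja k / (\<i> * k)) \<longlongrightarrow> of_real (w x)) at0" by (rule e1_ja_small)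
qed (auto simp: M0_inv jM_def Mp_def Mm_def mat2_mult n2_def e1_def diff_divide_distrib mult_ac)

end

end

section \<open>The spectral functions of a Schwartz potential\<close>

lemma set_integrable_minus_iff [simp]:
  fixes H :: "'a \<Rightarrow> complex"
  shows "set_integrable M A (\<lambda>y. - H y) \<longleftrightarrow> set_integrable M A H"
  by (simp add: set_integrable_def)

lemma set_integral_minus [simp]:
  fixes H :: "'a \<Rightarrow> complex"
  shows "(LINT y:A|M. - H y) = - (LINT y:A|M. H y)"
  by (simp add: set_lebesgue_integral_def)

lemma set_integrable_vec2:
  fixes H :: "real \<Rightarrow> complex^2"
  shows "set_integrable lborel A H \<longleftrightarrow> set_integrable lborel A (\<lambda>y. H y $ 1) \<and> set_integrable lborel A (\<lambda>y. H y $ 2)"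
proof
  assume H: "set_integrable lborel A H"
  have "set_integrable lborel A (\<lambda>y. H y $ i)" for i
    using integrable_bounded_linear[OF bounded_linear_vec_nth H[unfolded set_integrable_def], of i]
    by (simp add: set_integrable_def)
  then show "set_integrable lborel A (\<lambda>y. H y $ 1) \<and> set_integrable lborel A (\<lambda>y. H y $ 2)" by simp
next
  assume H: "set_integrable lborel A (\<lambda>y. H y $ 1) \<and> set_integrable lborel A (\<lambda>y. H y $ 2)"
  have bl: "bounded_linear (axis i :: complex \<Rightarrow> complex^2)" for i
    by (intro linear_conv_bounded_linear[THEN iffD1] linearI) (auto simp: axis_def vec_eq_iff)
  have "integrable lborel (\<lambda>y. axis 1 (indicator A y *\<^sub>R H y $ 1) + axis 2 (indicator A y *\<^sub>R H y $ 2) :: complex^2)"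
    using H unfolding set_integrable_def
    by (intro Bochner_Integration.integrable_add integrable_bounded_linear[OF bl]) auto
  moreover have "axis 1 (indicator A y *\<^sub>R H y $ 1) + axis 2 (indicator A y *\<^sub>R H y $ 2) = indicator A y *\<^sub>R H y" for y
    by (simp add: vec_eq_iff forall_2 axis_def)
  ultimately show "set_integrable lborel A H" by (simp add: set_integrable_def)
qed

lemma set_integral_vec_nth:
  fixes H :: "real \<Rightarrow> complex^2"
  assumes "set_integrable lborel A H"
  shows "(LINT y:A|lborel. H y) $ i = (LINT y:A|lborel. H y $ i)"
  using integral_bounded_linear[OF bounded_linear_vec_nth assms[unfolded set_integrable_def], of i]
  by (simp add: set_lebesgue_integral_def)

lemma volterra_eq_vec2:
  fixes H :: "real \<Rightarrow> complex^2"
  shows "set_integrable lborel A H \<and> v = c - (LINT y:A|lborel. H y) \<longleftrightarrow>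
      set_integrable lborel A (\<lambda>y. H y $ 1) \<and> set_integrable lborel A (\<lambda>y. H y $ 2) \<and>
      v $ 1 = c $ 1 - (LINT y:A|lborel. H y $ 1) \<and> v $ 2 = c $ 2 - (LINT y:A|lborel. H y $ 2)" (is ?minus)
    and "set_integrable lborel A H \<and> v = c + (LINT y:A|lborel. H y) \<longleftrightarrow>
      set_integrable lborel A (\<lambda>y. H y $ 1) \<and> set_integrable lborel A (\<lambda>y. H y $ 2) \<and>
      v $ 1 = c $ 1 + (LINT y:A|lborel. H y $ 1) \<and> v $ 2 = c $ 2 + (LINT y:A|lborel. H y $ 2)" (is ?plus)
proof -
  show ?minus ?plus
    using set_integral_vec_nth[of A H] set_integrable_vec2[of A H] by (auto simp: vec_eq_iff forall_2)
qed

lemma reflect_half_line: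
  fixes H :: "real \<Rightarrow> complex"
  shows "set_integrable lborel {..x} H \<longleftrightarrow> set_integrable lborel {- x..} (\<lambda>y. H (- y))"
    and "(LINT y:{..x}|lborel. H y) = (LINT y:{- x..}|lborel. H (- y))"
proof -
  have i: "indicator {..x} (- y) *\<^sub>R H (- y) = indicator {- x..} y *\<^sub>R H (- y)" for y
    by (cases "- x \<le> y") (simp_all add: indicator_def minus_le_iff)
  have "set_integrable lborel {..x} H \<longleftrightarrow> integrable lborel (\<lambda>y. indicator {..x} (0 + - 1 * y) *\<^sub>R H (0 + - 1 * y))"
    unfolding set_integrable_def
    by (rule lborel_integrable_real_affine_iff[of "- 1" "\<lambda>y. indicator {..x} y *\<^sub>R H y" 0, symmetric]) simp
  then show "set_integrable lborel {..x} H \<longleftrightarrow> set_integrable lborel {- x..} (\<lambda>y. H (- y))"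
    by (simp only: set_integrable_def i mult_minus1 add_0)
  have "(LINT y:{..x}|lborel. H y) = \<bar>- 1\<bar> *\<^sub>R (\<integral>y. indicator {..x} (0 + - 1 * y) *\<^sub>R H (0 + - 1 * y) \<partial>lborel)"
    unfolding set_lebesgue_integral_def by (rule lborel_integral_real_affine) simp
  then show "(LINT y:{..x}|lborel. H y) = (LINT y:{- x..}|lborel. H (- y))"
    by (simp only: set_lebesgue_integral_def i mult_minus1 add_0 abs_minus abs_one scaleR_one)
qed

context volterra
begin

text \<open>The hypotheses of \<open>jsum_unique\<close> for all \<open>x\<close> as one predicate,
  to which the bodies of the definite descriptions \<open>mu1_col\<close> and \<open>mu2_col\<close>
  can be rewritten.\<close>

definition vpair :: "complex \<Rightarrow> (real \<Rightarrow> complex) \<Rightarrow> (real \<Rightarrow> complex) \<Rightarrow> bool" where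
  "vpair k F G \<longleftrightarrow> (\<forall>x.
     set_integrable lborel {x..} (\<lambda>y. of_real (q y) * G y) \<and>
     set_integrable lborel {x..} (\<lambda>y. exp (2 * \<i> * k * of_real (P y - P x)) * of_real (q y) * F y) \<and>
     F x = 1 - (LINT y:{x..}|lborel. of_real (q y) * G y) \<and>
     G x = (LINT y:{x..}|lborel. exp (2 * \<i> * k * of_real (P y - P x)) * of_real (q y) * F y))"

lemma vpair_iff:
  assumes k: "Im k \<ge> 0"
  shows "vpair k F G \<longleftrightarrow> F = (\<lambda>x. jsum True x k) \<and> G = (\<lambda>x. jsum False x k)"
proof
  assume "vpair k F G"
  then have "F x = jsum True x k \<and> G x = jsum False x k" for x
    unfolding vpair_def by (intro jsum_unique[OF k]) blast+
  then show "F = (\<lambda>x. jsum True x k) \<and> G = (\<lambda>x. jsum False x k)" by auto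
next
  assume FG: "F = (\<lambda>x. jsum True x k) \<and> G = (\<lambda>x. jsum False x k)"
  have "set_integrable lborel {x..} (\<lambda>y. of_real (q y) * jsum False y k)" for x
    using integrand_integrable[of "\<lambda>_. 0", OF _ _ jsum_vclass[of False] k] by (simp add: mono_def)
  moreover have "set_integrable lborel {x..} (\<lambda>y. exp (2 * \<i> * k * of_real (P y - P x)) * of_real (q y) * jsum True y k)" for x
    by (rule integrand_integrable[OF cont_P mono_P jsum_vclass k])
  moreover have "jsum True x k = 1 - (LINT y:{x..}|lborel. of_real (q y) * jsum False y k)" for x
    using jsum_True_eq[OF k, of x] by (simp add: vop_def)
  moreover have "jsum False x k = (LINT y:{x..}|lborel. exp (2 * \<i> * k * of_real (P y - P x)) * of_real (q y) * jsum True y k)" for x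
    using jsum_False_eq[OF k, of x] by (simp only: vop_def)
  ultimately show "vpair k F G" unfolding vpair_def using FG by blast
qed

end

text \<open>The weights \<open>m = 0\<close> and \<open>m = 2\<close> of the Schwartz condition add
  up to \<open>1 + x\<^sup>2\<close>.\<close>

lemma schwartz_bound:
  assumes "schwartz w"
  obtains C where "\<And>x. \<bar>(deriv ^^ n) w x\<bar> \<le> C * kap x"
proof -
  have bd: "\<exists>B. \<forall>x. \<bar>x ^ m * (deriv ^^ n) w x\<bar> \<le> B" for m
  proof -
    have "bounded (range (\<lambda>x. x ^ m * (deriv ^^ n) w x))"
      using assms unfolding schwartz_def by blast
    then obtain B where "\<forall>v\<in>range (\<lambda>x. x ^ m * (deriv ^^ n) w x). norm v \<le> B"
      unfolding bounded_iff by blast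
    then show ?thesis by (intro exI[of _ B]) simp
  qed
  obtain B0 where B0: "\<And>x. \<bar>(deriv ^^ n) w x\<bar> \<le> B0"
    using bd[of 0] by (simp, blast)
  obtain B2 where B2: "\<And>x. \<bar>x\<^sup>2 * (deriv ^^ n) w x\<bar> \<le> B2"
    using bd[of 2] by blast
  note B = B0 B2
  have "\<bar>(deriv ^^ n) w x\<bar> \<le> (B0 + B2) * kap x" for x
  proof -
    have p: "1 + x\<^sup>2 > 0" by (simp add: add_pos_nonneg)
    have "\<bar>(deriv ^^ n) w x\<bar> * (1 + x\<^sup>2) = \<bar>(deriv ^^ n) w x\<bar> + \<bar>x\<^sup>2 * (deriv ^^ n) w x\<bar>"
      by (simp add: abs_mult algebra_simps)
    also have "\<dots> \<le> B0 + B2" using B[of x] by linarith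
    finally show ?thesis using p by (simp add: kap_def field_simps)
  qed
  then show ?thesis by (rule that)
qed

locale schwartz_potential =
  fixes w :: "real \<Rightarrow> real" and C0 :: real
  assumes jost: "jost w (deriv w) (deriv (deriv w)) (deriv (deriv (deriv w))) (p_fun w) C0"

sublocale schwartz_potential \<subseteq> scatter w "deriv w" "deriv (deriv w)" "deriv (deriv (deriv w))" "p_fun w" C0
  by (simp add: scatter_def jost)

lemma schwartz_potential_exists:
  assumes w: "schwartz w"
  shows "\<exists>C. schwartz_potential w C"
proof -
  have D: "((deriv ^^ n) w has_real_derivative (deriv ^^ Suc n) w x) (at x)" for n x
    using w by (simp add: schwartz_def DERIV_deriv_iff_real_differentiable)
  have "\<exists>C. \<forall>x. \<bar>(deriv ^^ n) w x\<bar> \<le> C * kap x" for n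
    by (rule schwartz_bound[OF w, of n]) blast
  then obtain C where C: "\<And>n x. \<bar>(deriv ^^ n) w x\<bar> \<le> C n * kap x" by metis
  define C0 where "C0 = max (max (C 0) (C 1)) (max (C 2) (C 3))"
  have C0: "\<bar>(deriv ^^ n) w x\<bar> \<le> C0 * kap x" if "n \<in> {0, 1, 2, 3}" for n x
  proof -
    have "C n \<le> C0" using that by (auto simp: C0_def)
    then have "C n * kap x \<le> C0 * kap x" using kap_pos[of x] by (simp add: mult_right_mono)
    with C[of n x] show ?thesis by linarith
  qed
  have D': "(w has_real_derivative deriv w x) (at x)" "(deriv w has_real_derivative deriv (deriv w) x) (at x)"
    "(deriv (deriv w) has_real_derivative deriv (deriv (deriv w)) x) (at x)"
    "(deriv (deriv (deriv w)) has_real_derivative deriv (deriv (deriv (deriv w))) x) (at x)" for x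
    using D[of 0 x] D[of 1 x] D[of 2 x] D[of 3 x] by (simp_all add: numeral_2_eq_2 numeral_3_eq_3)
  have cont: "continuous_on UNIV (deriv w)" "continuous_on UNIV (deriv (deriv (deriv w)))"
    using D'(2,4) by (meson DERIV_isCont continuous_at_imp_continuous_on)+
  have cm: "continuous_on UNIV (\<lambda>x. sqrt (m_fun w x) - 1)"
    unfolding m_fun_def by (intro continuous_intros cont)
  have bm: "norm (sqrt (m_fun w x) - 1) \<le> C0 * (kap x * kap_tail x ^ 0)" for x
  proof -
    have "sqrt (m_fun w x) \<le> 1 + \<bar>deriv w x\<bar>"
      unfolding m_fun_def by (rule real_le_lsqrt) (auto simp: power2_eq_square algebra_simps)
    moreover have "1 \<le> sqrt (m_fun w x)" by (simp add: m_fun_def)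
    ultimately show ?thesis using C0[of 1 x] by simp
  qed
  have "((\<lambda>x. LINT x':{x..}|lborel. (sqrt (m_fun w x') - 1)) has_vector_derivative - (sqrt (m_fun w x) - 1)) (at x)" for x
    by (rule tail_has_vector_derivative[OF cm tail_bound_integrable[OF set_borel_measurable_continuous_UNIV[OF cm] bm]])
  from has_vector_derivative_diff[OF has_vector_derivative_id this]
  have dP: "(p_fun w has_real_derivative sqrt (1 + (deriv w x)\<^sup>2)) (at x)" for x
    unfolding has_real_derivative_iff_has_vector_derivative p_fun_def[abs_def] by (simp add: m_fun_def)
  have "jost w (deriv w) (deriv (deriv w)) (deriv (deriv (deriv w))) (p_fun w) C0"
  proof (unfold_locales)
    fix x
    show "\<bar>w x\<bar> \<le> C0 * kap x" "\<bar>deriv w x\<bar> \<le> C0 * kap x" "\<bar>deriv (deriv w) x\<bar> \<le> C0 * kap x"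
      "\<bar>deriv (deriv (deriv w)) x\<bar> \<le> C0 * kap x"
      using C0[of 0 x] C0[of 1 x] C0[of 2 x] C0[of 3 x] by (simp_all add: numeral_2_eq_2 numeral_3_eq_3)
  qed (fact D' cont dP)+
  then show ?thesis unfolding schwartz_potential_def by blast
qed

section \<open>Identification of the spectral functions with \<open>ja\<close> and
  \<open>jb\<close>\<close>

context schwartz_potential
begin

abbreviation P :: "real \<Rightarrow> real" where "P \<equiv> p_fun w"

lemma V1_mat2: "V1 w y = mat2 0 (of_real (q y)) (- of_real (q y)) 0"
proof -
  have i: "\<i> * a * \<i> = - a" for a :: complex
  proof -
    have "\<i> * a * \<i> = (\<i> * \<i>) * a" by (simp only: mult_ac)
    then show ?thesis by simp
  qed
  show ?thesis
    by (simp add: mat2_eq_iff V1_def matrix_matrix_mult_def sum_2 sigma2_def mat_def q_def m_fun_def i)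
qed

text \<open>The first column sees the phase at \<open>k\<close>, the second the phase at
  \<open>- k\<close>; otherwise the columns differ by an exchange of components and signs.\<close>

lemma volterra_integrand_nth:
  "volterra_integrand w 1 k fn x y $ 1 = of_real (q y) * fn y $ 2"
  "volterra_integrand w 1 k fn x y $ 2 = - (exp (2 * \<i> * k * of_real (P y - P x)) * of_real (q y) * fn y $ 1)"
  "volterra_integrand w 2 k fn x y $ 1 = exp (2 * \<i> * (- k) * of_real (P y - P x)) * of_real (q y) * fn y $ 2"
  "volterra_integrand w 2 k fn x y $ 2 = - (of_real (q y) * fn y $ 1)"
proof -
  define \<tau> where "\<tau> = \<i> * k * of_real (P x - P y)"
  have e: "exp (- \<tau>) * exp \<tau> = 1" "exp \<tau> * exp (- \<tau>) = 1" by (simp_all add: exp_minus)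
  have t: "2 * \<i> * k * of_real (P y - P x) = - \<tau> + - \<tau>" "2 * \<i> * (- k) * of_real (P y - P x) = \<tau> + \<tau>"
    by (simp_all add: \<tau>_def algebra_simps)
  have V: "(V1 w y *v fn y) $ 1 = of_real (q y) * fn y $ 2" "(V1 w y *v fn y) $ 2 = - (of_real (q y) * fn y $ 1)"
    by (simp_all add: V1_mat2 matrix_vector_mult_def sum_2)
  have H: "hat_sigma3_col 1 \<tau> v $ 1 = (exp (- \<tau>) * exp \<tau>) * v $ 1" "hat_sigma3_col 1 \<tau> v $ 2 = (exp (- \<tau>) * exp (- \<tau>)) * v $ 2"
    "hat_sigma3_col 2 \<tau> v $ 1 = (exp \<tau> * exp \<tau>) * v $ 1" "hat_sigma3_col 2 \<tau> v $ 2 = (exp \<tau> * exp (- \<tau>)) * v $ 2" for v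
    by (simp_all add: hat_sigma3_col_def exp_sigma3_mat2 matrix_vector_mult_def sum_2 sigma3_def)
  show "volterra_integrand w 1 k fn x y $ 1 = of_real (q y) * fn y $ 2"
    "volterra_integrand w 1 k fn x y $ 2 = - (exp (2 * \<i> * k * of_real (P y - P x)) * of_real (q y) * fn y $ 1)"
    "volterra_integrand w 2 k fn x y $ 1 = exp (2 * \<i> * (- k) * of_real (P y - P x)) * of_real (q y) * fn y $ 2"
    "volterra_integrand w 2 k fn x y $ 2 = - (of_real (q y) * fn y $ 1)"
    unfolding volterra_integrand_def \<tau>_def[symmetric] H V e t exp_add by simp_all
qed

lemma column_mat_one: "column 1 (mat 1 :: complex^2^2) = vector [1, 0]" "column 2 (mat 1 :: complex^2^2) = vector [0, 1]"
  by (simp_all add: vec_eq_iff forall_2 column_def mat_def)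

lemma vec2_eq_iff: "(v :: complex^2) = vector [a, b] \<longleftrightarrow> v $ 1 = a \<and> v $ 2 = b"
  by (simp add: vec_eq_iff forall_2)

lemma mu2_col_1:
  assumes k: "Im k \<ge> 0"
  shows "mu2_col w 1 k = (\<lambda>x. vector [f x k, g x k])"
proof -
  have "(\<forall>x. set_integrable lborel {x..} (volterra_integrand w 1 k fn x) \<and>
      fn x = column 1 (mat 1) - (LINT y:{x..}|lborel. volterra_integrand w 1 k fn x y))
    \<longleftrightarrow> vpair k (\<lambda>x. fn x $ 1) (\<lambda>x. fn x $ 2)" for fn
    unfolding volterra_eq_vec2 volterra_integrand_nth vpair_def column_mat_one
    by (simp add: conj_ac cong: conj_cong)
  then have "mu2_col w 1 k = (THE fn. vpair k (\<lambda>x. fn x $ 1) (\<lambda>x. fn x $ 2))"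
    unfolding mu2_col_def by simp
  also have "\<dots> = (\<lambda>x. vector [f x k, g x k])"
    unfolding vpair_iff[OF k] by (rule the_equality) (auto simp: fun_eq_iff vec2_eq_iff)
  finally show ?thesis .
qed

text \<open>Exchanging the components and changing one sign turns the system of the second column at
  \<open>k\<close> into that of the first column at \<open>- k\<close>.\<close>

lemma mu2_col_2:
  assumes k: "Im k \<le> 0"
  shows "mu2_col w 2 k = (\<lambda>x. vector [- g x (- k), f x (- k)])"
proof -
  have k': "Im (- k) \<ge> 0" using k by simp
  have "(\<forall>x. set_integrable lborel {x..} (volterra_integrand w 2 k fn x) \<and>
      fn x = column 2 (mat 1) - (LINT y:{x..}|lborel. volterra_integrand w 2 k fn x y))
    \<longleftrightarrow> vpair (- k) (\<lambda>x. fn x $ 2) (\<lambda>x. - fn x $ 1)" for fn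
    unfolding volterra_eq_vec2 volterra_integrand_nth vpair_def column_mat_one
    by (simp add: conj_ac minus_equation_iff[of "fn _ $ 1"] eq_commute[of "fn _ $ 1"] cong: conj_cong)
  then have "mu2_col w 2 k = (THE fn. vpair (- k) (\<lambda>x. fn x $ 2) (\<lambda>x. - fn x $ 1))"
    unfolding mu2_col_def by simp
  also have "\<dots> = (\<lambda>x. vector [- g x (- k), f x (- k)])"
    unfolding vpair_iff[OF k'] by (rule the_equality) (auto simp: fun_eq_iff vec2_eq_iff, metis minus_minus)
  finally show ?thesis .
qed

lemma all_reflect: "(\<forall>x::real. Q x) \<longleftrightarrow> (\<forall>x. Q (- x))"
  by (metis minus_minus)

text \<open>Reflecting the integration variable turns the half-line ending at \<open>x\<close> into
  the one starting at \<open>- x\<close>: this is the system of the reflected potential with the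
  components exchanged.\<close>

lemma mu1_col_2:
  assumes k: "Im k \<ge> 0"
  shows "mu1_col w 2 k = (\<lambda>x. vector [G x k, F x k])"
proof -
  have ph: "exp (2 * \<i> * (- k) * of_real (P (- y) - P (- x))) = exp (2 * \<i> * k * of_real (- P (- y) - - P (- x)))" for x y
    by (simp add: algebra_simps)
  have "(\<forall>x. set_integrable lborel {..x} (volterra_integrand w 2 k fn x) \<and>
      fn x = column 2 (mat 1) + (LINT y:{..x}|lborel. volterra_integrand w 2 k fn x y))
    \<longleftrightarrow> m.vpair k (\<lambda>z. fn (- z) $ 2) (\<lambda>z. fn (- z) $ 1)" for fn
    unfolding volterra_eq_vec2 volterra_integrand_nth m.vpair_def column_mat_one reflect_half_line
    by (subst all_reflect) (simp only: minus_minus m_q ph vector_2 set_integrable_minus_iff set_integral_minus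
        add_0_left add_uminus_conv_diff, blast)
  then have "mu1_col w 2 k = (THE fn. m.vpair k (\<lambda>z. fn (- z) $ 2) (\<lambda>z. fn (- z) $ 1))"
    unfolding mu1_col_def by simp
  also have "\<dots> = (\<lambda>x. vector [G x k, F x k])"
    unfolding m.vpair_iff[OF k]
    by (rule the_equality) (auto simp: fun_eq_iff vec2_eq_iff G_def F_def, (metis minus_minus)+)
  finally show ?thesis .
qed

lemma mu1_col_1:
  assumes k: "Im k \<le> 0"
  shows "mu1_col w 1 k = (\<lambda>x. vector [F x (- k), - G x (- k)])"
proof -
  have k': "Im (- k) \<ge> 0" using k by simp
  have neg: "complex_of_real a * - b = - (complex_of_real a * b)" for a b by simp
  have flip: "v = 0 + - L \<longleftrightarrow> - v = L" for v L :: complex by auto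
  have ph: "exp (2 * \<i> * k * of_real (P (- y) - P (- x))) = exp (2 * \<i> * (- k) * of_real (- P (- y) - - P (- x)))" for x y
    by (simp add: algebra_simps)
  have "(\<forall>x. set_integrable lborel {..x} (volterra_integrand w 1 k fn x) \<and>
      fn x = column 1 (mat 1) + (LINT y:{..x}|lborel. volterra_integrand w 1 k fn x y))
    \<longleftrightarrow> m.vpair (- k) (\<lambda>z. fn (- z) $ 1) (\<lambda>z. - fn (- z) $ 2)" for fn
    unfolding volterra_eq_vec2 volterra_integrand_nth m.vpair_def column_mat_one reflect_half_line
    by (subst all_reflect) (simp only: minus_minus m_q ph vector_2 set_integrable_minus_iff set_integral_minus
        neg flip diff_minus_eq_add)
  then have "mu1_col w 1 k = (THE fn. m.vpair (- k) (\<lambda>z. fn (- z) $ 1) (\<lambda>z. - fn (- z) $ 2))"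
    unfolding mu1_col_def by simp
  also have "\<dots> = (\<lambda>x. vector [F x (- k), - G x (- k)])"
    unfolding m.vpair_iff[OF k']
    by (rule the_equality) (auto simp: fun_eq_iff vec2_eq_iff G_def F_def, (metis minus_minus)+)
  finally show ?thesis .
qed

lemma of_columns_mat2: "of_columns (vector [a, c]) (vector [b, d]) = mat2 a b c d"
  by (simp add: mat2_eq_iff of_columns_def transpose_def)

lemma spectral_a_eq:
  assumes k: "Im k \<ge> 0"
  shows "spectral_a w k = ja k"
  unfolding spectral_a_def mu2_col_1[OF k] mu1_col_2[OF k] of_columns_mat2
  using ja_eq[OF k] by (auto simp: det_2 mult_ac)

text \<open>Existence is Cramer's rule with \<open>det_one\<close>. For uniqueness it is enough to
  look at \<open>x = 0\<close>, where \<open>mu2\<close> is invertible and conjugation with the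
  phase is injective.\<close>

lemma scattering_matrix_eq:
  "scattering_matrix w \<kappa> = mat2 (ja (- of_real \<kappa>)) (jb (of_real \<kappa>)) (- jb (- of_real \<kappa>)) (ja (of_real \<kappa>))"
proof -
  define k where "k = complex_of_real \<kappa>"
  have k: "Im k \<ge> 0" "Im k \<le> 0" "Im k = 0" "Im (- k) = 0" "Im (- k) \<ge> 0" by (simp_all add: k_def)
  have mu: "mu1 w k x = mat2 (F x (- k)) (G x k) (- G x (- k)) (F x k)"
    "mu2 w k x = mat2 (f x k) (- g x (- k)) (g x k) (f x (- k))" for x
    by (simp_all add: mu1_def mu2_def mu1_col_1[OF k(2)] mu1_col_2[OF k(1)] mu2_col_1[OF k(1)] mu2_col_2[OF k(2)] of_columns_mat2)
  define E where "E x = exp (2 * \<i> * k * of_real (P x))" for x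
  define E' where "E' x = exp (- 2 * \<i> * k * of_real (P x))" for x
  have EE: "E x * E' x = 1" for x by (simp add: E_def E'_def exp_minus)
  have hat: "hat_sigma3 (\<i> * k * of_real (P x)) (mat2 a b c d) = mat2 a (E x * b) (E' x * c) d" for x a b c d
  proof -
    define \<tau> where "\<tau> = \<i> * k * of_real (P x)"
    have "2 * \<i> * k * of_real (P x) = \<tau> + \<tau>" "- 2 * \<i> * k * of_real (P x) = - \<tau> + - \<tau>" by (simp_all add: \<tau>_def)
    then have e: "E x = exp \<tau> * exp \<tau>" "E' x = exp (- \<tau>) * exp (- \<tau>)" by (simp_all only: E_def E'_def exp_add)
    have i: "exp \<tau> * exp (- \<tau>) = 1" by (simp add: exp_minus)
    have r: "exp \<tau> * z * exp (- \<tau>) = z" "exp (- \<tau>) * z * exp \<tau> = z" for z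
    proof -
      have "exp \<tau> * z * exp (- \<tau>) = (exp \<tau> * exp (- \<tau>)) * z" "exp (- \<tau>) * z * exp \<tau> = (exp \<tau> * exp (- \<tau>)) * z"
        by (simp_all only: mult_ac)
      then show "exp \<tau> * z * exp (- \<tau>) = z" "exp (- \<tau>) * z * exp \<tau> = z" by (simp_all only: i mult_1_left)
    qed
    show ?thesis
      unfolding hat_sigma3_def \<tau>_def[symmetric] exp_sigma3_mat2 mat2_mult minus_minus mat2_eq_iff mat2_nth e
      by (intro conjI) (simp_all only: mult_zero_left mult_zero_right add_0_left add_0_right r, simp_all only: mult_ac)
  qed
  have b: "E' x * (G x k * f x (- k) + g x (- k) * F x k) = jb k"
    "E x * (G x (- k) * f x k + g x k * F x (- k)) = jb (- k)" for x
    using jb_eq[OF k(3), of x] jb_eq[OF k(4), of x] by (simp_all add: E_def E'_def)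
  note a = ja_eq[OF k(1)] ja_eq[OF k(5)] det_one[OF k(3)]
  have sol: "mu1 w k x = mu2 w k x ** hat_sigma3 (\<i> * k * of_real (P x)) (mat2 (ja (- k)) (jb k) (- jb (- k)) (ja k))" for x
  proof -
    have c1: "E x * jb k = G x k * f x (- k) + g x (- k) * F x k"
      using EE[of x] by (simp only: b(1)[of x, symmetric] mult.assoc[symmetric] mult_1_left)
    have "E' x * jb (- k) = (E x * E' x) * (G x (- k) * f x k + g x k * F x (- k))"
      by (simp only: b(2)[of x, symmetric] mult_ac)
    then have c2: "E' x * jb (- k) = G x (- k) * f x k + g x k * F x (- k)"
      by (simp only: EE mult_1_left)
    have "F x (- k) = f x k * ja (- k) + g x (- k) * (E' x * jb (- k))"
      unfolding c2 a(2)[of x, symmetric] using a(3)[of x] by algebra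
    moreover have "G x k = f x k * (E x * jb k) - g x (- k) * ja k"
      unfolding c1 a(1)[of x, symmetric] using a(3)[of x] by algebra
    moreover have "- G x (- k) = g x k * ja (- k) - f x (- k) * (E' x * jb (- k))"
      unfolding c2 a(2)[of x, symmetric] using a(3)[of x] by algebra
    moreover have "F x k = g x k * (E x * jb k) + f x (- k) * ja k"
      unfolding c1 a(1)[of x, symmetric] using a(3)[of x] by algebra
    ultimately show ?thesis
      unfolding mu hat mat2_mult unfolding mat2_eq_iff mat2_nth by simp
  qed
  have uniq: "S = mat2 (ja (- k)) (jb k) (- jb (- k)) (ja k)"
    if S: "\<forall>x. mu1 w k x = mu2 w k x ** hat_sigma3 (\<i> * k * of_real (P x)) S" for S
  proof -
    let ?S = "mat2 (ja (- k)) (jb k) (- jb (- k)) (ja k)"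
    \<comment> \<open>The adjugate of \<open>mu2\<close> at \<open>x = 0\<close>, an inverse by
      \<open>det_one\<close>.\<close>
    let ?N = "mat2 (f 0 (- k)) (g 0 (- k)) (- g 0 k) (f 0 k)"
    have N: "?N ** mu2 w k 0 = mat 1"
      unfolding mu mat2_mult mat2_one unfolding mat2_eq_iff mat2_nth using a(3)[of 0] by (simp add: mult.commute add.commute)
    have "mu2 w k 0 ** hat_sigma3 (\<i> * k * of_real (P 0)) S = mu2 w k 0 ** hat_sigma3 (\<i> * k * of_real (P 0)) ?S"
      using S sol[of 0] by simp
    then have "(?N ** mu2 w k 0) ** hat_sigma3 (\<i> * k * of_real (P 0)) S = (?N ** mu2 w k 0) ** hat_sigma3 (\<i> * k * of_real (P 0)) ?S"
      by (simp only: matrix_mul_assoc[symmetric])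
    then have eq: "hat_sigma3 (\<i> * k * of_real (P 0)) (mat2 (S $ 1 $ 1) (S $ 1 $ 2) (S $ 2 $ 1) (S $ 2 $ 2)) = hat_sigma3 (\<i> * k * of_real (P 0)) ?S"
      by (simp only: N matrix_mul_lid mat2_eta[of S, symmetric])
    have "E 0 \<noteq> 0" "E' 0 \<noteq> 0" by (simp_all add: E_def E'_def)
    with eq show ?thesis
      unfolding hat mat2_eq_iff mat2_nth by (metis mult_left_cancel)
  qed
  have "scattering_matrix w \<kappa> = mat2 (ja (- k)) (jb k) (- jb (- k)) (ja k)"
    unfolding scattering_matrix_def k_def[symmetric] by (rule the_equality) (use sol uniq in auto)
  then show ?thesis by (simp add: k_def)
qed

lemma reflection_eq: "reflection w \<kappa> = jb (of_real \<kappa>) / ja (of_real \<kappa>)"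
  by (simp add: reflection_def spectral_b_def scattering_matrix_eq spectral_a_eq)

end

section \<open>Conservation laws\<close>

lemma integral_kap_le:
  assumes "0 \<le> C" "a \<le> b"
  shows "integral {a..b} (\<lambda>x. C * kap x) \<le> C * kap_tail a"
    and "(\<lambda>x. C * kap x) integrable_on {a..b}"
proof -
  have "((\<lambda>x. C * kap x) has_integral (- (C * kap_tail b) - - (C * kap_tail a))) {a..b}"
  proof (rule fundamental_theorem_of_calculus[OF assms(2)])
    fix x
    have "((\<lambda>x. - kap_tail x) has_real_derivative kap x) (at x within {a..b})"
      using DERIV_kap_tail_power[of 0 x] by (auto intro: has_field_derivative_at_within)
    from DERIV_cmult[OF this, of C]
    show "((\<lambda>x. - (C * kap_tail x)) has_vector_derivative C * kap x) (at x within {a..b})"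
      by (simp add: has_real_derivative_iff_has_vector_derivative)
  qed
  moreover have "0 \<le> C * kap_tail b" using assms(1) kap_tail_pos[of b] by simp
  ultimately show "integral {a..b} (\<lambda>x. C * kap x) \<le> C * kap_tail a" "(\<lambda>x. C * kap x) integrable_on {a..b}"
    by (auto simp: has_integral_iff)
qed

text \<open>\<open>D\<close> is both the time derivative of the density and the space derivative of
  the flux; its joint continuity permits differentiation under the time integral.\<close>

definition conservation_law ::
    "(real \<Rightarrow> real \<Rightarrow> real) \<Rightarrow> (real \<Rightarrow> real \<Rightarrow> real) \<Rightarrow> (real \<Rightarrow> real \<Rightarrow> real) \<Rightarrow> bool" where
  "conservation_law \<phi> \<psi> D \<longleftrightarrow>
     continuous_on (UNIV \<times> {0..}) (\<lambda>(x, t). \<phi> x t) \<and>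
     continuous_on (UNIV \<times> {0..}) (\<lambda>(x, t). \<psi> x t) \<and> continuous_on (UNIV \<times> {0..}) (\<lambda>(x, t). D x t) \<and>
     (\<forall>x. \<forall>t\<ge>0. ((\<lambda>z. \<psi> z t) has_real_derivative D x t) (at x) \<and>
        (\<phi> x has_vector_derivative D x t) (at t within {0..}))"

lemma continuous_on_halfplane_compose:
  fixes \<phi> :: "real \<Rightarrow> real \<Rightarrow> 'c :: topological_space" and a b :: "'b :: topological_space \<Rightarrow> real"
  assumes "continuous_on (UNIV \<times> {0..}) (\<lambda>(x, t). \<phi> x t)" "continuous_on S a" "continuous_on S b" "\<And>s. s \<in> S \<Longrightarrow> 0 \<le> b s"
  shows "continuous_on S (\<lambda>s. \<phi> (a s) (b s))"
  using continuous_on_compose2[OF assms(1) continuous_on_Pair[OF assms(2,3)]] assms(4) by auto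

text \<open>Integrating in time first involves only a compact time interval, hence no decay in
  \<open>x\<close>.\<close>

lemma flux_deriv:
  assumes cl: "conservation_law \<phi> \<psi> D" and t: "0 \<le> t"
  shows "((\<lambda>x. integral {0..t} (\<psi> x)) has_real_derivative \<phi> x t - \<phi> x 0) (at x)"
proof -
  have c\<psi>: "continuous_on (UNIV \<times> {0..}) (\<lambda>(x, t). \<psi> x t)" and cD: "continuous_on (UNIV \<times> {0..}) (\<lambda>(x, t). D x t)"
    and d: "\<And>x t. t \<ge> 0 \<Longrightarrow> ((\<lambda>z. \<psi> z t) has_real_derivative D x t) (at x)"
      "\<And>x t. t \<ge> 0 \<Longrightarrow> (\<phi> x has_vector_derivative D x t) (at t within {0..})"
    using cl by (simp_all add: conservation_law_def)
  have "((\<lambda>x. integral (cbox 0 t) (\<psi> x)) has_vector_derivative integral (cbox 0 t) (D x)) (at x within UNIV)"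
  proof (rule leibniz_rule_vector_derivative)
    show "((\<lambda>x. \<psi> x s) has_vector_derivative D x s) (at x within UNIV)" if "s \<in> cbox 0 t" for x s
      using d(1)[of s x] that by (simp add: has_real_derivative_iff_has_vector_derivative)
    show "\<psi> x integrable_on cbox 0 t" for x
      unfolding cbox_interval
      by (intro integrable_continuous_real continuous_on_halfplane_compose[OF c\<psi>] continuous_intros) simp
    show "continuous_on (UNIV \<times> cbox 0 t) (\<lambda>(x, t). D x t)"
      by (rule continuous_on_subset[OF cD]) auto
  qed auto
  moreover have "(D x has_integral \<phi> x t - \<phi> x 0) {0..t}"
  proof (rule fundamental_theorem_of_calculus[OF t])
    show "(\<phi> x has_vector_derivative D x s) (at s within {0..t})" if "s \<in> {0..t}" for s
      by (rule has_vector_derivative_within_subset[OF d(2)]) (use that in auto)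
  qed
  ultimately show ?thesis
    by (simp add: has_real_derivative_iff_has_vector_derivative integral_unique)
qed

text \<open>The time-integrated flux \<open>J s\<close> is nonnegative and increasing in
  \<open>s\<close>, and the mass in \<open>{a..b}\<close> changes by \<open>J s b - J s a\<close>.
  At times 0 and \<open>t\<close> the mass is at most \<open>C * pi\<close>, so \<open>J t\<close>
  exceeds its value at 0 by at most \<open>C * pi\<close>. This bounds \<open>J s b\<close> and with
  it the mass at intermediate times, where no uniform decay is available.\<close>

lemma conservation_law_bound:
  assumes cl: "conservation_law \<phi> \<psi> D" and t: "0 \<le> t"
    and pos: "\<And>x s. 0 \<le> s \<Longrightarrow> 0 \<le> \<phi> x s" "\<And>x s. 0 \<le> s \<Longrightarrow> 0 \<le> \<psi> x s"
    and b: "\<And>x. \<phi> x 0 \<le> C * kap x" "\<And>x. \<phi> x t \<le> C * kap x"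
  obtains K where "\<And>s a b. s \<in> {0..t} \<Longrightarrow> a \<le> b \<Longrightarrow> integral {a..b} (\<lambda>x. \<phi> x s) \<le> K"
proof -
  define J where "J s x = integral {0..s} (\<psi> x)" for s x
  have C: "0 \<le> C"
    using b(1)[of 0] pos(1)[of 0 0] kap_pos[of 0] by (smt (verit) mult_neg_pos)
  have i\<phi>: "(\<lambda>x. \<phi> x s) integrable_on {a..b}" if "0 \<le> s" for s a b
    using cl that unfolding conservation_law_def
    by (intro integrable_continuous_real continuous_on_halfplane_compose[of \<phi>] continuous_intros) auto
  have i\<psi>: "\<psi> x integrable_on {0..s}" for x s
    using cl unfolding conservation_law_def
    by (intro integrable_continuous_real continuous_on_halfplane_compose[of \<psi>] continuous_intros) auto
  have J: "integral {a..b} (\<lambda>x. \<phi> x s) - integral {a..b} (\<lambda>x. \<phi> x 0) = J s b - J s a" if "0 \<le> s" "a \<le> b" for s a b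
  proof -
    have "((\<lambda>x. \<phi> x s - \<phi> x 0) has_integral J s b - J s a) {a..b}"
      unfolding J_def using flux_deriv[OF cl that(1)]
      by (intro fundamental_theorem_of_calculus[OF that(2)])
         (auto simp: has_real_derivative_iff_has_vector_derivative intro: has_vector_derivative_at_within)
    from integral_unique[OF this] show ?thesis
      using integral_diff[OF i\<phi>[OF that(1), of a b] i\<phi>[of 0 a b]] by simp
  qed
  have Jpos: "0 \<le> J s x" if "0 \<le> s" for s x
    unfolding J_def using pos(2) by (intro integral_nonneg i\<psi>) auto
  have Jmono: "J s x \<le> J t x" if "s \<in> {0..t}" for s x
    unfolding J_def using that pos(2) by (intro integral_subset_le i\<psi>) auto
  have ib: "integral {a..b} (\<lambda>x. \<phi> x s) \<le> C * pi" "0 \<le> integral {a..b} (\<lambda>x. \<phi> x s)"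
    if "s = 0 \<or> s = t" "a \<le> b" for s a b
  proof -
    have "integral {a..b} (\<lambda>x. \<phi> x s) \<le> integral {a..b} (\<lambda>x. C * kap x)"
      using that b t by (intro integral_le i\<phi> integral_kap_le(2) C) auto
    also have "\<dots> \<le> C * kap_tail a" by (rule integral_kap_le[OF C that(2)])
    also have "\<dots> \<le> C * pi" using C kap_tail_le_pi[of a] by (simp add: mult_left_mono)
    finally show "integral {a..b} (\<lambda>x. \<phi> x s) \<le> C * pi" .
    show "0 \<le> integral {a..b} (\<lambda>x. \<phi> x s)" using that t pos(1) by (intro integral_nonneg i\<phi>) auto
  qed
  have Jb: "J t x \<le> J t 0 + C * pi" for x
  proof (cases "0 \<le> x")
    case True
    then show ?thesis using J[OF t True] ib(1)[of t 0 x] ib(2)[of 0 0 x] by simp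
  next
    case False
    then show ?thesis using J[OF t, of x 0] ib(1)[of 0 x 0] ib(2)[of t x 0] by simp
  qed
  show ?thesis
  proof (rule that[of "C * pi + (J t 0 + C * pi)"])
    fix s a b assume s: "s \<in> {0..t}" and ab: "a \<le> (b::real)"
    then show "integral {a..b} (\<lambda>x. \<phi> x s) \<le> C * pi + (J t 0 + C * pi)"
      using J[of s a b] Jpos[of s a] Jmono[OF s, of b] Jb[of b] ib(1)[of 0 a b] by simp
  qed
qed

text \<open>Average \<open>J x \<le> J y + C * kap_tail x\<close> over \<open>y \<in> {x..x + n}\<close>.\<close>

lemma decay_of_integrable:
  fixes J J' :: "real \<Rightarrow> real"
  assumes d: "\<And>x. (J has_real_derivative J' x) (at x)" and b: "\<And>x. \<bar>J' x\<bar> \<le> C * kap x"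
    and int: "\<And>a b. a \<le> b \<Longrightarrow> integral {a..b} J \<le> K"
  shows "J x \<le> C * kap_tail x"
proof -
  have C: "0 \<le> C"
    using b[of 0] kap_pos[of 0] by (smt (verit) mult_neg_pos)
  have le: "J x \<le> J y + C * kap_tail x" if "x \<le> y" for y
  proof -
    have "J x + (- (C * kap_tail x)) \<le> J y + (- (C * kap_tail y))"
    proof (rule DERIV_nonneg_imp_nondecreasing[OF that])
      fix z
      have "((\<lambda>x. - kap_tail x) has_real_derivative kap z) (at z)"
        using DERIV_kap_tail_power[of 0 z] by simp
      from DERIV_add[OF d DERIV_cmult[OF this, of C]] b[of z]
      show "\<exists>y. ((\<lambda>x. J x + - (C * kap_tail x)) has_real_derivative y) (at z) \<and> 0 \<le> y"
        by (intro exI[of _ "J' z + C * kap z"]) auto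
    qed
    moreover have "0 \<le> C * kap_tail y" using C kap_tail_pos[of y] by simp
    ultimately show ?thesis by simp
  qed
  have "J x - C * kap_tail x \<le> K / real (Suc n)" for n
  proof -
    have cJ: "continuous_on A J" for A
      using d by (meson DERIV_isCont continuous_at_imp_continuous_on)
    have "integral {x..x + real (Suc n)} (\<lambda>y. J x - C * kap_tail x) \<le> integral {x..x + real (Suc n)} J"
      using le by (intro integral_le integrable_continuous_real cJ continuous_intros) (auto simp: algebra_simps)
    also have "\<dots> \<le> K" by (rule int) simp
    finally show ?thesis by (simp add: field_simps)
  qed
  moreover have "(\<lambda>n. K / real (Suc n)) \<longlonglongrightarrow> 0"
    using LIMSEQ_Suc[OF tendsto_mult_left[OF lim_1_over_n, of K]] by simp
  ultimately have "J x - C * kap_tail x \<le> 0"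
    by (intro LIMSEQ_le_const[of "\<lambda>n. K / real (Suc n)"]) auto
  then show ?thesis by simp
qed

section \<open>The short pulse equation\<close>

locale short_pulse =
  fixes u0 :: "real \<Rightarrow> real" and u :: "real \<Rightarrow> real \<Rightarrow> real"
  assumes sol: "short_pulse_solution u0 u"
begin

abbreviation "ux \<equiv> pdx u"
abbreviation "uxx \<equiv> pdx (pdx u)"
abbreviation "ut \<equiv> pdt u"
abbreviation "uxt \<equiv> pdt (pdx u)"
abbreviation "utx \<equiv> pdx (pdt u)"

lemma partials [simp]:
  "u \<in> partials u" "ux \<in> partials u" "uxx \<in> partials u" "ut \<in> partials u" "uxt \<in> partials u" "utx \<in> partials u"
  by (auto intro: partials.intros)

lemma partial_cont: "p \<in> partials u \<Longrightarrow> continuous_on (UNIV \<times> {0..}) (\<lambda>(x, t). p x t)"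
  using sol by (simp add: short_pulse_solution_def smooth_halfplane_def)

lemma cont:
  assumes "p \<in> partials u" "continuous_on S a" "continuous_on S b" "\<And>s. s \<in> S \<Longrightarrow> 0 \<le> b s"
  shows "continuous_on S (\<lambda>s. p (a s) (b s))"
  by (rule continuous_on_halfplane_compose[OF partial_cont]) (use assms in auto)

lemmas cont_partials [continuous_intros] =
  cont[OF partials(1)] cont[OF partials(2)] cont[OF partials(3)] cont[OF partials(4)] cont[OF partials(5)] cont[OF partials(6)]

lemma partial_dx:
  assumes "p \<in> partials u" "t \<ge> 0"
  shows "((\<lambda>z. p z t) has_real_derivative pdx p x t) (at x)"
  using sol assms unfolding short_pulse_solution_def smooth_halfplane_def pdx_def
  by (simp add: DERIV_deriv_iff_real_differentiable)

lemma partial_dt: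
  assumes "p \<in> partials u" "t \<ge> 0"
  shows "(p x has_vector_derivative pdt p x t) (at t within {0..})"
  using sol assms unfolding short_pulse_solution_def smooth_halfplane_def pdt_def
  by (simp add: vector_derivative_works)

lemma partial_schwartz: "p \<in> partials u \<Longrightarrow> t \<ge> 0 \<Longrightarrow> schwartz (\<lambda>x. p x t)"
  using sol by (simp add: short_pulse_solution_def)

lemma initial: "u x 0 = u0 x"
  using sol by (simp add: short_pulse_solution_def)

lemma equation:
  assumes t: "t \<ge> 0"
  shows "uxt x t = u x t + u x t * (ux x t)\<^sup>2 + (u x t)\<^sup>2 * uxx x t / 2"
proof -
  have 1: "pdx (\<lambda>z s. u z s ^ 3) x t = 3 * (u x t)\<^sup>2 * ux x t" for x
    unfolding pdx_def[of "\<lambda>z s. u z s ^ 3"]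
    by (rule DERIV_imp_deriv) (use partial_dx[of u t x] t in \<open>auto intro!: derivative_eq_intros\<close>)
  have 2: "pdx (pdx (\<lambda>z s. u z s ^ 3)) x t = 6 * u x t * (ux x t)\<^sup>2 + 3 * (u x t)\<^sup>2 * uxx x t"
    unfolding pdx_def[of "pdx (\<lambda>z s. u z s ^ 3)"] 1
    by (rule DERIV_imp_deriv)
       (use partial_dx[of u t x] partial_dx[of ux t x] t in \<open>auto intro!: derivative_eq_intros simp: power2_eq_square\<close>)
  have "uxt x t = u x t + 1 / 6 * pdx (pdx (\<lambda>z s. u z s ^ 3)) x t"
    using sol t by (simp add: short_pulse_solution_def)
  then show ?thesis unfolding 2 by (simp add: field_simps)
qed

text \<open>Writing \<open>u x s - u x 0\<close> as a time integral of \<open>ut\<close> and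
  differentiating under the integral expresses \<open>ux\<close> as an integral of
  \<open>utx\<close>. By continuity its time derivative is \<open>utx\<close>, also one-sidedly at
  0.\<close>

lemma mixed_partials:
  assumes t: "t \<ge> 0"
  shows "utx x t = uxt x t"
proof -
  have FTC: "(ut x has_integral u x s - u x 0) {0..s}" if "0 \<le> s" for x s
  proof (rule fundamental_theorem_of_calculus[OF that])
    show "(u x has_vector_derivative ut x r) (at r within {0..s})" if "r \<in> {0..s}" for r
      by (rule has_vector_derivative_within_subset[OF partial_dt]) (use that in auto)
  qed
  have L: "ux x s = ux x 0 + integral {0..s} (utx x)" if s: "0 \<le> s" for s
  proof -
    have "((\<lambda>x. integral (cbox 0 s) (ut x)) has_vector_derivative integral (cbox 0 s) (utx x)) (at x within UNIV)"
    proof (rule leibniz_rule_vector_derivative)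
      show "((\<lambda>x. ut x r) has_vector_derivative utx x r) (at x within UNIV)" if "r \<in> cbox 0 s" for x r
        using partial_dx[of ut r x] that by (simp add: has_real_derivative_iff_has_vector_derivative)
      show "ut x integrable_on cbox 0 s" for x
        by (auto intro!: integrable_continuous_real continuous_intros)
      show "continuous_on (UNIV \<times> cbox 0 s) (\<lambda>(x, t). utx x t)"
        by (rule continuous_on_subset[OF partial_cont]) auto
    qed auto
    then have "((\<lambda>x. u x s - u x 0) has_real_derivative integral {0..s} (utx x)) (at x)"
      using integral_unique[OF FTC[OF s]] by (simp add: has_real_derivative_iff_has_vector_derivative)
    moreover have "((\<lambda>x. u x s - u x 0) has_real_derivative ux x s - ux x 0) (at x)"
      using s by (intro derivative_intros partial_dx) auto
    ultimately have "ux x s - ux x 0 = integral {0..s} (utx x)"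
      using DERIV_unique by blast
    then show ?thesis by simp
  qed
  \<comment> \<open>The interval reaches beyond \<open>t\<close>, so that it does not degenerate for
    \<open>t = 0\<close>.\<close>
  have "((\<lambda>s. integral {0..s} (utx x)) has_vector_derivative utx x t) (at t within {0..t+1})"
    using t by (intro integral_has_vector_derivative continuous_intros) auto
  then have "((\<lambda>s. ux x 0 + integral {0..s} (utx x)) has_vector_derivative utx x t) (at t within {0..t+1})"
    using has_vector_derivative_add[OF has_vector_derivative_const] by fastforce
  then have "(ux x has_vector_derivative utx x t) (at t within {0..t+1})"
  proof (rule has_vector_derivative_transform[rotated 2])
    show "ux x s = ux x 0 + integral {0..s} (utx x)" if "s \<in> {0..t+1}" for s
      by (rule L) (use that in simp)
  qed (use t in simp)
  moreover have "(ux x has_vector_derivative uxt x t) (at t within {0..t+1})"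
    by (rule has_vector_derivative_within_subset[OF partial_dt]) (use t in auto)
  moreover have "at t within {0..t+1} \<noteq> bot"
    using t by (simp add: trivial_limit_within islimpt_Icc)
  ultimately show ?thesis by (rule vector_derivative_unique_within[rotated])
qed

definition m :: "real \<Rightarrow> real \<Rightarrow> real" where "m x t = sqrt (1 + (ux x t)\<^sup>2)"

lemma m_ge_1: "1 \<le> m x t" by (simp add: m_def)

lemma m_sq: "m x t * m x t = 1 + (ux x t)\<^sup>2"
  unfolding m_def by (rule real_sqrt_mult_self[THEN trans]) (simp add: add_nonneg_nonneg)

lemma cont_m: "continuous_on (UNIV \<times> {0..}) (\<lambda>(x, t). m x t)"
  unfolding m_def case_prod_unfold by (intro continuous_intros) auto

lemma DERIV_sqrt_one_plus_square:
  assumes p: "0 < 1 + (v::real)\<^sup>2"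
  shows "((\<lambda>v. sqrt (1 + v\<^sup>2)) has_real_derivative v / sqrt (1 + v\<^sup>2)) (at v)"
proof -
  have "((\<lambda>v. 1 + v\<^sup>2) has_real_derivative 2 * v) (at v)"
    by (auto intro!: derivative_eq_intros)
  from DERIV_chain2[OF DERIV_real_sqrt[OF p] this] show ?thesis
    by (simp add: field_simps)
qed

lemma m_dx: "t \<ge> 0 \<Longrightarrow> ((\<lambda>z. m z t) has_real_derivative ux x t / m x t * uxx x t) (at x)"
  unfolding m_def by (rule DERIV_chain2[OF DERIV_sqrt_one_plus_square]) (auto intro: partial_dx simp: add_pos_nonneg)

lemma m_dt: "t \<ge> 0 \<Longrightarrow> (m x has_vector_derivative ux x t / m x t * uxt x t) (at t within {0..})"
proof -
  assume t: "t \<ge> 0"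
  have "(ux x has_real_derivative uxt x t) (at t within {0..})"
    using partial_dt[of ux t x] t by (simp add: has_real_derivative_iff_has_vector_derivative)
  from DERIV_chain2[OF DERIV_sqrt_one_plus_square this]
  have "(m x has_real_derivative ux x t / m x t * uxt x t) (at t within {0..})"
    by (simp add: m_def[abs_def] add_pos_nonneg)
  then show "(m x has_vector_derivative ux x t / m x t * uxt x t) (at t within {0..})"
    by (simp add: has_real_derivative_iff_has_vector_derivative)
qed

text \<open>An \<open>x\<close>-antiderivative of \<open>u\<close>: the equation says that
  \<open>u_t - (u^3)_x / 6\<close> has \<open>x\<close>-derivative \<open>u\<close>.\<close>

definition v :: "real \<Rightarrow> real \<Rightarrow> real" where "v x t = ut x t - (u x t)\<^sup>2 * ux x t / 2"

lemma v_dx: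
  assumes t: "t \<ge> 0"
  shows "((\<lambda>z. v z t) has_real_derivative u x t) (at x)"
proof -
  have "((\<lambda>z. v z t) has_real_derivative utx x t - (2 * u x t * ux x t * ux x t + (u x t)\<^sup>2 * uxx x t) / 2) (at x)"
    unfolding v_def
    by (auto intro!: derivative_eq_intros partial_dx[OF _ t] simp: power2_eq_square algebra_simps)
  moreover have "utx x t - (2 * u x t * ux x t * ux x t + (u x t)\<^sup>2 * uxx x t) / 2 = u x t"
    unfolding mixed_partials[OF t] equation[OF t] by (simp add: field_simps power2_eq_square)
  ultimately show ?thesis by simp
qed

text \<open>By definition of \<open>v\<close>, \<open>2 * u * ut = 2 * u * v + u ^ 3 * ux\<close>,
  and \<open>u\<close> is the \<open>x\<close>-derivative of \<open>v\<close>. The flux is a sum of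
  even powers, hence nonnegative.\<close>

lemma energy_law: "conservation_law (\<lambda>x t. (u x t)\<^sup>2) (\<lambda>x t. (v x t)\<^sup>2 + (u x t) ^ 4 / 4) (\<lambda>x t. 2 * u x t * ut x t)"
  unfolding conservation_law_def
proof (intro conjI allI impI)
  show "continuous_on (UNIV \<times> {0..}) (\<lambda>(x, t). (u x t)\<^sup>2)"
    "continuous_on (UNIV \<times> {0..}) (\<lambda>(x, t). (v x t)\<^sup>2 + (u x t) ^ 4 / 4)"
    "continuous_on (UNIV \<times> {0..}) (\<lambda>(x, t). 2 * u x t * ut x t)"
    unfolding v_def case_prod_unfold by (intro continuous_intros; auto)+
  fix x t :: real assume t: "0 \<le> t"
  have "((\<lambda>z. (v z t)\<^sup>2 + (u z t) ^ 4 / 4) has_real_derivative 2 * v x t * u x t + u x t ^ 3 * ux x t) (at x)"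
    by (auto intro!: derivative_eq_intros v_dx partial_dx t simp: power2_eq_square)
  also have "2 * v x t * u x t + u x t ^ 3 * ux x t = 2 * u x t * ut x t"
    by (simp add: v_def algebra_simps power2_eq_square power3_eq_cube)
  finally show "((\<lambda>z. (v z t)\<^sup>2 + (u z t) ^ 4 / 4) has_real_derivative 2 * u x t * ut x t) (at x)" .
  have "((\<lambda>t. (u x t)\<^sup>2) has_real_derivative 2 * u x t * ut x t) (at t within {0..})"
    using partial_dt[of u t x] t
    by (auto intro!: derivative_eq_intros simp: has_real_derivative_iff_has_vector_derivative[symmetric])
  then show "((\<lambda>t. (u x t)\<^sup>2) has_vector_derivative 2 * u x t * ut x t) (at t within {0..})"
    by (simp add: has_real_derivative_iff_has_vector_derivative)
qed

text \<open>The equation reads \<open>uxt = u * m\<^sup>2 + u\<^sup>2 * uxx / 2\<close>; multiplied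
  by \<open>ux / m\<close>, its right-hand side becomes the \<open>x\<close>-derivative of
  \<open>u\<^sup>2 * m / 2\<close>.\<close>

lemma length_law:
  "conservation_law (\<lambda>x t. m x t - 1) (\<lambda>x t. (u x t)\<^sup>2 * m x t / 2) (\<lambda>x t. ux x t / m x t * uxt x t)"
  unfolding conservation_law_def
proof (intro conjI allI impI)
  have m0: "m x t \<noteq> 0" for x t using m_ge_1[of x t] by simp
  note cm = continuous_on_halfplane_compose[OF cont_m]
  show "continuous_on (UNIV \<times> {0..}) (\<lambda>(x, t). m x t - 1)"
    "continuous_on (UNIV \<times> {0..}) (\<lambda>(x, t). (u x t)\<^sup>2 * m x t / 2)"
    "continuous_on (UNIV \<times> {0..}) (\<lambda>(x, t). ux x t / m x t * uxt x t)"
    unfolding case_prod_unfold by (intro continuous_intros cm; auto simp: m0)+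
  fix x t :: real assume t: "0 \<le> t"
  have "((\<lambda>z. (u z t)\<^sup>2 * m z t / 2) has_real_derivative
      (2 * u x t * ux x t * m x t + (u x t)\<^sup>2 * (ux x t / m x t * uxx x t)) / 2) (at x)"
    by (auto intro!: derivative_eq_intros m_dx partial_dx t simp: power2_eq_square)
  also have "(2 * u x t * ux x t * m x t + (u x t)\<^sup>2 * (ux x t / m x t * uxx x t)) / 2 = ux x t / m x t * uxt x t"
  proof -
    have "u x t * ux x t * m x t = ux x t / m x t * (u x t * (m x t * m x t))" using m0 by simp
    then show ?thesis
      unfolding m_sq equation[OF t] by (simp add: algebra_simps)
  qed
  finally show "((\<lambda>z. (u z t)\<^sup>2 * m z t / 2) has_real_derivative ux x t / m x t * uxt x t) (at x)" .
  show "((\<lambda>t. m x t - 1) has_vector_derivative ux x t / m x t * uxt x t) (at t within {0..})"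
    using has_vector_derivative_diff[OF m_dt[OF t, of x] has_vector_derivative_const[of 1]] by simp
qed

lemma partial_bound:
  assumes "p \<in> partials u" "t \<ge> 0"
  obtains C where "\<And>x. \<bar>p x t\<bar> \<le> C * kap x"
  using schwartz_bound[OF partial_schwartz[OF assms], of 0] by auto

lemma m_minus_1_le: "m x t - 1 \<le> \<bar>ux x t\<bar>"
proof -
  have "m x t \<le> 1 + \<bar>ux x t\<bar>"
    unfolding m_def by (rule real_le_lsqrt) (auto simp: power2_eq_square algebra_simps)
  then show ?thesis by simp
qed

lemma square_kap_bound:
  assumes "\<bar>a\<bar> \<le> C * kap x"
  shows "a\<^sup>2 \<le> C\<^sup>2 * kap x"
proof -
  have "a\<^sup>2 \<le> (C * kap x)\<^sup>2" using assms by (metis abs_ge_zero power2_abs power_mono)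
  also have "\<dots> \<le> C\<^sup>2 * kap x"
  proof -
    have "(kap x)\<^sup>2 \<le> kap x"
      using kap_le_1[of x] kap_pos[of x] by (simp add: power2_eq_square mult_left_le)
    then show ?thesis unfolding power_mult_distrib by (intro mult_left_mono) auto
  qed
  finally show ?thesis .
qed

lemma energy_bound:
  assumes t: "t \<ge> 0"
  obtains K where "\<And>s a b. s \<in> {0..t} \<Longrightarrow> a \<le> b \<Longrightarrow> integral {a..b} (\<lambda>x. (u x s)\<^sup>2) \<le> K"
proof -
  obtain C1 where C1: "\<And>x. \<bar>u x 0\<bar> \<le> C1 * kap x" using partial_bound[of u 0] by auto
  obtain C2 where C2: "\<And>x. \<bar>u x t\<bar> \<le> C2 * kap x" using partial_bound[of u t] t by auto
  show ?thesis
  proof (rule conservation_law_bound[OF energy_law t, of "max (C1\<^sup>2) (C2\<^sup>2)"])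
    fix x
    have "C1\<^sup>2 * kap x \<le> max (C1\<^sup>2) (C2\<^sup>2) * kap x" "C2\<^sup>2 * kap x \<le> max (C1\<^sup>2) (C2\<^sup>2) * kap x"
      using kap_pos[of x] by (auto intro!: mult_right_mono)
    then show "(u x 0)\<^sup>2 \<le> max (C1\<^sup>2) (C2\<^sup>2) * kap x" "(u x t)\<^sup>2 \<le> max (C1\<^sup>2) (C2\<^sup>2) * kap x"
      using square_kap_bound[OF C1[of x]] square_kap_bound[OF C2[of x]] by linarith+
  next
    fix K assume "\<And>s a b. s \<in> {0..t} \<Longrightarrow> a \<le> b \<Longrightarrow> integral {a..b} (\<lambda>x. (u x s)\<^sup>2) \<le> K"
    then show thesis by (rule that)
  qed auto
qed

lemma length_bound:
  assumes t: "t \<ge> 0"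
  obtains K where "\<And>s a b. s \<in> {0..t} \<Longrightarrow> a \<le> b \<Longrightarrow> integral {a..b} (\<lambda>x. m x s - 1) \<le> K"
proof -
  obtain C1 where C1: "\<And>x. \<bar>ux x 0\<bar> \<le> C1 * kap x" using partial_bound[of ux 0] by auto
  obtain C2 where C2: "\<And>x. \<bar>ux x t\<bar> \<le> C2 * kap x" using partial_bound[of ux t] t by auto
  show ?thesis
  proof (rule conservation_law_bound[OF length_law t, of "max C1 C2"])
    fix x
    have "C1 * kap x \<le> max C1 C2 * kap x" "C2 * kap x \<le> max C1 C2 * kap x"
      using kap_pos[of x] by (auto intro!: mult_right_mono)
    then show "m x 0 - 1 \<le> max C1 C2 * kap x" "m x t - 1 \<le> max C1 C2 * kap x"
      using C1[of x] C2[of x] m_minus_1_le[of x 0] m_minus_1_le[of x t] by linarith+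
  next
    fix x s show "0 \<le> m x s - 1" using m_ge_1[of x s] by simp
    show "0 \<le> (u x s)\<^sup>2 * m x s / 2" using m_ge_1[of x s] by simp
  next
    fix K assume "\<And>s a b. s \<in> {0..t} \<Longrightarrow> a \<le> b \<Longrightarrow> integral {a..b} (\<lambda>x. m x s - 1) \<le> K"
    then show thesis by (rule that)
  qed
qed

text \<open>The bound on \<open>|2 u u\<^sub>x / (1 + u\<^sup>2)|\<close> holds since \<open>|u\<^sub>x| \<le> q + sqrt (2 q)\<close> for \<open>q = m - 1\<close>.\<close>

lemma log_deriv_bound:
  "\<bar>2 * u x s * ux x s / (1 + (u x s)\<^sup>2)\<bar> \<le> 3 * (m x s - 1) + (u x s)\<^sup>2"
proof -
  define q where "q = m x s - 1"
  define r where "r = sqrt (2 * q)"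
  define a where "a = \<bar>u x s\<bar>"
  define p where "p = \<bar>ux x s\<bar>"
  have q: "0 \<le> q" using m_ge_1[of x s] by (simp add: q_def)
  have r: "0 \<le> r" "r\<^sup>2 = 2 * q" using q by (simp_all add: r_def)
  have "p\<^sup>2 = q\<^sup>2 + 2 * q" using m_sq[of x s] by (simp add: p_def q_def power2_eq_square algebra_simps)
  also have "\<dots> \<le> (q + r)\<^sup>2" using q r by (simp add: power2_sum)
  finally have p: "p \<le> q + r" by (rule power2_le_imp_le) (use q r in simp)
  have a: "0 \<le> a" "a\<^sup>2 = (u x s)\<^sup>2" by (simp_all add: a_def)
  have a1: "2 * a \<le> 1 + a\<^sup>2" using zero_le_power2[of "a - 1"] by (simp add: power2_diff)
  have ar: "2 * a * r \<le> a\<^sup>2 + r\<^sup>2" using zero_le_power2[of "a - r"] by (simp add: power2_diff)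
  have pos: "0 < 1 + a\<^sup>2" by (simp add: add_pos_nonneg)
  have "2 * a * p \<le> 2 * a * (q + r)" using p a by (simp add: mult_left_mono)
  also have "\<dots> \<le> (1 + a\<^sup>2) * q + (a\<^sup>2 + 2 * q)"
    using mult_right_mono[OF a1 q] ar r by (simp add: algebra_simps)
  also have "\<dots> \<le> (3 * q + a\<^sup>2) * (1 + a\<^sup>2)"
    using q a by (simp add: algebra_simps)
  finally have "2 * a * p / (1 + a\<^sup>2) \<le> 3 * q + a\<^sup>2" using pos by (simp add: divide_le_eq)
  moreover have "\<bar>2 * u x s * ux x s / (1 + (u x s)\<^sup>2)\<bar> = 2 * a * p / (1 + a\<^sup>2)"
    using pos by (simp add: a_def p_def abs_mult)
  ultimately show ?thesis unfolding q_def[symmetric] a(2)[symmetric] by linarith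
qed

lemma integrable_u2: "s \<ge> 0 \<Longrightarrow> (\<lambda>x. (u x s)\<^sup>2) integrable_on {a..b}"
  and integrable_m: "s \<ge> 0 \<Longrightarrow> (\<lambda>x. m x s - 1) integrable_on {a..b}"
  by (intro integrable_continuous_real continuous_intros continuous_on_halfplane_compose[OF cont_m]; auto)+

text \<open>Near \<open>ux = 0\<close> the density \<open>m - 1\<close> is quadratic and does not
  control \<open>|ux|\<close>. The derivative of \<open>ln (1 + u\<^sup>2)\<close>, however, is
  controlled by the two conserved densities together, and integrating it from \<open>x\<close> to
  plus infinity bounds \<open>u\<close> uniformly in time.\<close>

lemma sup_bound:
  assumes t: "t \<ge> 0"
  obtains A where "\<And>x s. s \<in> {0..t} \<Longrightarrow> (u x s)\<^sup>2 \<le> A"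
proof -
  obtain K1 where K1: "\<And>s a b. s \<in> {0..t} \<Longrightarrow> a \<le> b \<Longrightarrow> integral {a..b} (\<lambda>x. (u x s)\<^sup>2) \<le> K1"
    using energy_bound[OF t] by blast
  obtain K2 where K2: "\<And>s a b. s \<in> {0..t} \<Longrightarrow> a \<le> b \<Longrightarrow> integral {a..b} (\<lambda>x. m x s - 1) \<le> K2"
    using length_bound[OF t] by blast
  have main: "ln (1 + (u x s)\<^sup>2) \<le> 3 * K2 + K1" if s: "s \<in> {0..t}" for x s
  proof -
    define l where "l z = ln (1 + (u z s)\<^sup>2)" for z
    have s0: "s \<ge> 0" using s by simp
    have pos: "0 < 1 + (u z s)\<^sup>2" for z by (simp add: add_pos_nonneg)
    have dl: "(l has_real_derivative 2 * u z s * ux z s / (1 + (u z s)\<^sup>2)) (at z)" for z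
      unfolding l_def using partial_dx[of u s z] s0 pos[of z]
      by (auto intro!: derivative_eq_intros simp: field_simps)
    have le: "l x \<le> l y + (3 * K2 + K1)" if xy: "x \<le> y" for y
    proof -
      have I: "((\<lambda>z. 2 * u z s * ux z s / (1 + (u z s)\<^sup>2)) has_integral l y - l x) {x..y}"
        using dl by (intro fundamental_theorem_of_calculus[OF xy])
          (auto simp: has_real_derivative_iff_has_vector_derivative intro: has_vector_derivative_at_within)
      have i3: "(\<lambda>z. 3 * (m z s - 1)) integrable_on {x..y}"
        using integrable_m[OF s0, of x y] by (rule integrable_on_mult_right)
      have ib: "(\<lambda>z. 3 * (m z s - 1) + (u z s)\<^sup>2) integrable_on {x..y}"
        by (intro integrable_add i3 integrable_u2 s0)
      have "norm (integral {x..y} (\<lambda>z. 2 * u z s * ux z s / (1 + (u z s)\<^sup>2))) \<le> integral {x..y} (\<lambda>z. 3 * (m z s - 1) + (u z s)\<^sup>2)"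
        using I log_deriv_bound ib
        by (intro Henstock_Kurzweil_Integration.integral_norm_bound_integral) (auto simp: has_integral_iff)
      also have "\<dots> = 3 * integral {x..y} (\<lambda>z. m z s - 1) + integral {x..y} (\<lambda>z. (u z s)\<^sup>2)"
        by (simp only: integral_add[OF i3 integrable_u2[OF s0, of x y]] Henstock_Kurzweil_Integration.integral_mult_right)
      also have "\<dots> \<le> 3 * K2 + K1" using K1[OF s xy] K2[OF s xy] by simp
      finally show ?thesis using integral_unique[OF I] by simp
    qed
    obtain C where C: "\<And>x. \<bar>u x s\<bar> \<le> C * kap x" using partial_bound[of u s] s0 by auto
    have "((\<lambda>y. C * kap y) \<longlongrightarrow> 0) at_top" using tendsto_mult_left[OF tendsto_kap, of C] by simp
    then have "((\<lambda>y. u y s) \<longlongrightarrow> 0) at_top"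
      by (rule Lim_null_comparison[rotated]) (simp add: C)
    then have "((\<lambda>y. l y + (3 * K2 + K1)) \<longlongrightarrow> ln (1 + 0\<^sup>2) + (3 * K2 + K1)) at_top"
      unfolding l_def by (intro tendsto_intros) auto
    then have "l x \<le> ln (1 + 0\<^sup>2) + (3 * K2 + K1)"
      by (rule tendsto_lowerbound[OF _ eventually_mono[OF eventually_ge_at_top[of x] le]]) auto
    then show ?thesis by (simp add: l_def)
  qed
  show ?thesis
  proof (rule that[of "exp (3 * K2 + K1)"])
    fix x s assume "s \<in> {0..t}"
    have "0 < 1 + (u x s)\<^sup>2" by (simp add: add_pos_nonneg)
    then have "1 + (u x s)\<^sup>2 = exp (ln (1 + (u x s)\<^sup>2))" by simp
    also have "\<dots> \<le> exp (3 * K2 + K1)" using main[OF \<open>s \<in> {0..t}\<close>, of x] by simp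
    finally show "(u x s)\<^sup>2 \<le> exp (3 * K2 + K1)" by simp
  qed
qed

text \<open>The time-integrated flux of the length law. By \<open>p_fun_evolution\<close> it is also
  the displacement of \<open>p_fun\<close> between times 0 and \<open>t\<close>.\<close>

definition J :: "real \<Rightarrow> real \<Rightarrow> real" where "J t x = integral {0..t} (\<lambda>s. (u x s)\<^sup>2 * m x s / 2)"

lemma J_deriv: "t \<ge> 0 \<Longrightarrow> (J t has_real_derivative m x t - m x 0) (at x)"
  using flux_deriv[OF length_law, of t x] by (simp add: J_def[abs_def])

text \<open>With \<open>A\<close> bounding \<open>u\<^sup>2\<close>, the flux is at most
  \<open>u\<^sup>2 + A * (m - 1)\<close>; exchanging the integrals bounds the integral of
  \<open>J t\<close> over every interval. Its derivative \<open>m x t - m x 0\<close> involves the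
  two end times only and is dominated by \<open>kap\<close>.\<close>

lemma J_decay:
  assumes t: "t \<ge> 0"
  obtains C where "0 < C" "\<And>x. J t x \<le> C * kap_tail x" "\<And>x. J t x \<le> C * kap_tail (- x)"
proof -
  obtain A where A: "\<And>x s. s \<in> {0..t} \<Longrightarrow> (u x s)\<^sup>2 \<le> A" using sup_bound[OF t] by blast
  obtain K1 where K1: "\<And>s a b. s \<in> {0..t} \<Longrightarrow> a \<le> b \<Longrightarrow> integral {a..b} (\<lambda>x. (u x s)\<^sup>2) \<le> K1"
    using energy_bound[OF t] by blast
  obtain K2 where K2: "\<And>s a b. s \<in> {0..t} \<Longrightarrow> a \<le> b \<Longrightarrow> integral {a..b} (\<lambda>x. m x s - 1) \<le> K2"
    using length_bound[OF t] by blast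
  obtain C1 where C1: "\<And>x. \<bar>ux x 0\<bar> \<le> C1 * kap x" using partial_bound[of ux 0] by auto
  obtain C2 where C2: "\<And>x. \<bar>ux x t\<bar> \<le> C2 * kap x" using partial_bound[of ux t] t by auto
  \<comment> \<open>The summand 1 makes \<open>C\<close> positive, as the estimate with
    \<open>sqrt B\<close> in \<open>err_integral\<close> will require.\<close>
  define C where "C = \<bar>C1\<bar> + \<bar>C2\<bar> + 1"
  have A0: "0 \<le> A" using A[of 0 0] t by (smt (verit) atLeastAtMost_iff zero_le_power2)
  have Jb: "\<bar>m x t - m x 0\<bar> \<le> C * kap x" for x
  proof -
    have "\<bar>m x t - m x 0\<bar> \<le> (C1 + C2) * kap x"
      using C1[of x] C2[of x] m_minus_1_le[of x 0] m_minus_1_le[of x t] m_ge_1[of x 0] m_ge_1[of x t]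
      by (auto simp: distrib_right abs_le_iff)
    also have "\<dots> \<le> C * kap x" using kap_pos[of x] by (intro mult_right_mono) (auto simp: C_def)
    finally show ?thesis .
  qed
  define K where "K = t * (K1 + A * K2)"
  have int: "integral {a..b} (J t) \<le> K" if ab: "a \<le> b" for a b
  proof -
    have c: "continuous_on (cbox (a, 0) (b, t)) (\<lambda>(x, s). (u x s)\<^sup>2 * m x s / 2)"
      unfolding case_prod_unfold
      by (intro continuous_intros continuous_on_halfplane_compose[OF cont_m]) (auto simp: cbox_Pair_eq)
    have "integral {a..b} (J t) = integral {0..t} (\<lambda>s. integral {a..b} (\<lambda>x. (u x s)\<^sup>2 * m x s / 2))"
      unfolding J_def[abs_def] using integral_swap_continuous[OF c] by simp
    also have "\<dots> \<le> integral {0..t} (\<lambda>s. K1 + A * K2)"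
    proof (rule integral_le)
      have "continuous_on ({0..t} \<times> cbox a b) (\<lambda>(s, x). (u x s)\<^sup>2 * m x s / 2)"
        unfolding case_prod_unfold
        by (intro continuous_intros continuous_on_halfplane_compose[OF cont_m]) auto
      from integral_continuous_on_param[OF this]
      show "(\<lambda>s. integral {a..b} (\<lambda>x. (u x s)\<^sup>2 * m x s / 2)) integrable_on {0..t}"
        by (intro integrable_continuous_real) simp
      fix s assume s: "s \<in> {0..t}"
      have s0: "s \<ge> 0" using s by simp
      have i: "(\<lambda>x. (u x s)\<^sup>2 + A * (m x s - 1)) integrable_on {a..b}"
        by (intro integrable_add integrable_u2 integrable_on_mult_right integrable_m s0)
      have "integral {a..b} (\<lambda>x. (u x s)\<^sup>2 * m x s / 2) \<le> integral {a..b} (\<lambda>x. (u x s)\<^sup>2 + A * (m x s - 1))"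
      proof (rule integral_le[OF _ i])
        show "(\<lambda>x. (u x s)\<^sup>2 * m x s / 2) integrable_on {a..b}"
          using s0 by (intro integrable_continuous_real continuous_intros continuous_on_halfplane_compose[OF cont_m]) auto
        fix x
        have "(u x s)\<^sup>2 * (m x s - 1) \<le> A * (m x s - 1)"
          using A[OF s, of x] m_ge_1[of x s] by (intro mult_right_mono) auto
        moreover have "0 \<le> (u x s)\<^sup>2 * m x s" using m_ge_1[of x s] by simp
        ultimately show "(u x s)\<^sup>2 * m x s / 2 \<le> (u x s)\<^sup>2 + A * (m x s - 1)" by (simp add: algebra_simps)
      qed
      also have "\<dots> = integral {a..b} (\<lambda>x. (u x s)\<^sup>2) + A * integral {a..b} (\<lambda>x. m x s - 1)"
        by (simp only: integral_add[OF integrable_u2[OF s0, of a b] integrable_on_mult_right[OF integrable_m[OF s0, of a b], of A]]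
            Henstock_Kurzweil_Integration.integral_mult_right)
      also have "\<dots> \<le> K1 + A * K2"
        using K1[OF s ab] K2[OF s ab] A0 by (intro add_mono mult_left_mono) auto
      finally show "integral {a..b} (\<lambda>x. (u x s)\<^sup>2 * m x s / 2) \<le> K1 + A * K2" .
    qed auto
    also have "\<dots> = K" using t by (simp add: K_def)
    finally show ?thesis .
  qed
  show ?thesis
  proof (rule that[of C])
    show "0 < C" by (simp add: C_def)
    show "J t x \<le> C * kap_tail x" for x
      by (rule decay_of_integrable[OF J_deriv[OF t] Jb int])
    \<comment> \<open>The left tail is the right tail of the reflected function.\<close>
    have "J t (- x) \<le> C * kap_tail x" for x
    proof (rule decay_of_integrable[of "\<lambda>x. J t (- x)"])
      show "((\<lambda>x. J t (- x)) has_real_derivative - (m (- x) t - m (- x) 0)) (at x)" for x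
        using J_deriv[OF t, of "- x"] unfolding DERIV_mirror .
      show "\<bar>- (m (- x) t - m (- x) 0)\<bar> \<le> C * kap x" for x using Jb[of "- x"] by simp
      show "integral {a..b} (\<lambda>x. J t (- x)) \<le> K" if "a \<le> b" for a b
        using int[of "- b" "- a"] that Henstock_Kurzweil_Integration.integral_reflect_real[of "- a" "- b" "J t"] by simp
    qed
    from this[of "- x" for x] show "J t x \<le> C * kap_tail (- x)" for x by simp
  qed
qed

end

section \<open>Evolution of the scattering data\<close>

text \<open>The spatial Lax equation in the original gauge, with the skew-Hermitian, trace-free
  matrix \<open>\<i> * \<kappa>\<close> times \<open>(1, g; g, - 1)\<close>.\<close>

definition lax_solution ::
    "real \<Rightarrow> (real \<Rightarrow> real) \<Rightarrow> (real \<Rightarrow> complex) \<Rightarrow> (real \<Rightarrow> complex) \<Rightarrow> bool" where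
  "lax_solution \<kappa> g \<phi>1 \<phi>2 \<longleftrightarrow> (\<forall>x.
     (\<phi>1 has_vector_derivative \<i> * of_real \<kappa> * (\<phi>1 x + of_real (g x) * \<phi>2 x)) (at x) \<and>
     (\<phi>2 has_vector_derivative \<i> * of_real \<kappa> * (of_real (g x) * \<phi>1 x - \<phi>2 x)) (at x))"

lemma lax_cnj:
  assumes "lax_solution \<kappa> g \<phi>1 \<phi>2"
  shows "lax_solution \<kappa> g (\<lambda>x. cnj (\<phi>2 x)) (\<lambda>x. - cnj (\<phi>1 x))"
  unfolding lax_solution_def
proof (intro allI conjI)
  fix x
  have d: "((\<lambda>x. cnj (\<phi>2 x)) has_vector_derivative cnj (\<i> * of_real \<kappa> * (of_real (g x) * \<phi>1 x - \<phi>2 x))) (at x)"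
    "((\<lambda>x. cnj (\<phi>1 x)) has_vector_derivative cnj (\<i> * of_real \<kappa> * (\<phi>1 x + of_real (g x) * \<phi>2 x))) (at x)"
    using assms unfolding lax_solution_def
    by (blast intro: bounded_linear.has_vector_derivative[OF bounded_linear_cnj])+
  show "((\<lambda>x. cnj (\<phi>2 x)) has_vector_derivative \<i> * of_real \<kappa> * (cnj (\<phi>2 x) + of_real (g x) * - cnj (\<phi>1 x))) (at x)"
    using d(1) by (rule has_vector_derivative_eq_rhs) (simp add: algebra_simps)
  show "((\<lambda>x. - cnj (\<phi>1 x)) has_vector_derivative \<i> * of_real \<kappa> * (of_real (g x) * cnj (\<phi>2 x) - - cnj (\<phi>1 x))) (at x)"
    using has_vector_derivative_minus[OF d(2)] by (rule has_vector_derivative_eq_rhs) (simp add: algebra_simps)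
qed

lemma lax_linear:
  assumes "lax_solution \<kappa> g \<phi>1 \<phi>2" "lax_solution \<kappa> g \<chi>1 \<chi>2"
  shows "lax_solution \<kappa> g (\<lambda>x. A * \<phi>1 x + B * \<chi>1 x) (\<lambda>x. A * \<phi>2 x + B * \<chi>2 x)"
  unfolding lax_solution_def
proof (intro allI conjI)
  fix x
  have d: "((\<lambda>x. A * \<phi>1 x + B * \<chi>1 x) has_vector_derivative
      A * (\<i> * of_real \<kappa> * (\<phi>1 x + of_real (g x) * \<phi>2 x)) + B * (\<i> * of_real \<kappa> * (\<chi>1 x + of_real (g x) * \<chi>2 x))) (at x)"
    "((\<lambda>x. A * \<phi>2 x + B * \<chi>2 x) has_vector_derivative
      A * (\<i> * of_real \<kappa> * (of_real (g x) * \<phi>1 x - \<phi>2 x)) + B * (\<i> * of_real \<kappa> * (of_real (g x) * \<chi>1 x - \<chi>2 x))) (at x)"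
    using assms unfolding lax_solution_def
    by (auto intro!: has_vector_derivative_add has_vector_derivative_mult_right)
  show "((\<lambda>x. A * \<phi>1 x + B * \<chi>1 x) has_vector_derivative
      \<i> * of_real \<kappa> * (A * \<phi>1 x + B * \<chi>1 x + of_real (g x) * (A * \<phi>2 x + B * \<chi>2 x))) (at x)"
    using d(1) by (rule has_vector_derivative_eq_rhs) (simp add: algebra_simps)
  show "((\<lambda>x. A * \<phi>2 x + B * \<chi>2 x) has_vector_derivative
      \<i> * of_real \<kappa> * (of_real (g x) * (A * \<phi>1 x + B * \<chi>1 x) - (A * \<phi>2 x + B * \<chi>2 x))) (at x)"
    using d(2) by (rule has_vector_derivative_eq_rhs) (simp add: algebra_simps)
qed

text \<open>The coefficient matrices are trace free, so a determinant of two solutions changes only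
  through the difference of the potentials. For \<open>g = g'\<close> it is constant; for potentials
  at different times this is the differential form of Duhamel's formula.\<close>

lemma lax_wedge_deriv:
  assumes "lax_solution \<kappa> g \<phi>1 \<phi>2" "lax_solution \<kappa> g' \<chi>1 \<chi>2"
  shows "((\<lambda>x. \<phi>1 x * \<chi>2 x - \<phi>2 x * \<chi>1 x) has_vector_derivative
     \<i> * of_real \<kappa> * of_real (g x - g' x) * (\<phi>2 x * \<chi>2 x - \<phi>1 x * \<chi>1 x)) (at x)"
proof -
  have "((\<lambda>x. \<phi>1 x * \<chi>2 x - \<phi>2 x * \<chi>1 x) has_vector_derivative
     (\<phi>1 x * (\<i> * of_real \<kappa> * (of_real (g' x) * \<chi>1 x - \<chi>2 x)) + \<i> * of_real \<kappa> * (\<phi>1 x + of_real (g x) * \<phi>2 x) * \<chi>2 x)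
     - (\<phi>2 x * (\<i> * of_real \<kappa> * (\<chi>1 x + of_real (g' x) * \<chi>2 x)) + \<i> * of_real \<kappa> * (of_real (g x) * \<phi>1 x - \<phi>2 x) * \<chi>1 x)) (at x)"
    using assms unfolding lax_solution_def
    by (intro has_vector_derivative_diff has_vector_derivative_mult) auto
  then show ?thesis
    by (rule has_vector_derivative_eq_rhs) (simp add: algebra_simps)
qed

text \<open>The determinant of a solution with its partner from \<open>lax_cnj\<close> is minus the
  squared norm, hence constant: propagation in \<open>x\<close> is unitary.\<close>

lemma lax_norm:
  assumes "lax_solution \<kappa> g \<phi>1 \<phi>2"
  shows "(cmod (\<phi>1 x))\<^sup>2 + (cmod (\<phi>2 x))\<^sup>2 = (cmod (\<phi>1 y))\<^sup>2 + (cmod (\<phi>2 y))\<^sup>2"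
proof -
  have "((\<lambda>x. \<phi>1 x * - cnj (\<phi>1 x) - \<phi>2 x * cnj (\<phi>2 x)) has_vector_derivative 0) (at x)" for x
    using lax_wedge_deriv[OF assms lax_cnj[OF assms], of x] by simp
  then have "\<phi>1 x * - cnj (\<phi>1 x) - \<phi>2 x * cnj (\<phi>2 x) = \<phi>1 y * - cnj (\<phi>1 y) - \<phi>2 y * cnj (\<phi>2 y)"
    by (rule has_vector_derivative_zero_UNIV)
  then have "\<phi>1 x * cnj (\<phi>1 x) + \<phi>2 x * cnj (\<phi>2 x) = \<phi>1 y * cnj (\<phi>1 y) + \<phi>2 y * cnj (\<phi>2 y)"
    by (simp add: algebra_simps)
  then have "complex_of_real ((cmod (\<phi>1 x))\<^sup>2 + (cmod (\<phi>2 x))\<^sup>2) = of_real ((cmod (\<phi>1 y))\<^sup>2 + (cmod (\<phi>2 y))\<^sup>2)"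
    by (simp only: of_real_add complex_norm_square)
  then show ?thesis by (simp only: of_real_eq_iff)
qed

lemma lax_le_1:
  assumes "lax_solution \<kappa> g \<phi>1 \<phi>2" "(cmod (\<phi>1 y))\<^sup>2 + (cmod (\<phi>2 y))\<^sup>2 = 1"
  shows "cmod (\<phi>1 x) \<le> 1" "cmod (\<phi>2 x) \<le> 1"
proof -
  have "(cmod (\<phi>1 x))\<^sup>2 + (cmod (\<phi>2 x))\<^sup>2 = 1" using lax_norm[OF assms(1), of x y] assms(2) by simp
  then have "(cmod (\<phi>1 x))\<^sup>2 \<le> 1" "(cmod (\<phi>2 x))\<^sup>2 \<le> 1"
    using zero_le_power2[of "cmod (\<phi>1 x)"] zero_le_power2[of "cmod (\<phi>2 x)"] by linarith+
  then show "cmod (\<phi>1 x) \<le> 1" "cmod (\<phi>2 x) \<le> 1"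
    by (simp_all add: power_le_one_iff)
qed

lemma norm_wedge_le_2:
  assumes "cmod a \<le> 1" "cmod b \<le> 1" "cmod c \<le> 1" "cmod d \<le> 1"
  shows "cmod (a * b - c * d) \<le> 2" "cmod (a * b + c * d) \<le> 2"
proof -
  have "cmod (a * b) \<le> 1" "cmod (c * d) \<le> 1"
    using assms by (simp_all add: norm_mult mult_le_one)
  then show "cmod (a * b - c * d) \<le> 2" "cmod (a * b + c * d) \<le> 2"
    using norm_triangle_ineq4[of "a * b" "c * d"] norm_triangle_ineq[of "a * b" "c * d"] by linarith+
qed

lemma lax_wedge_integral:
  assumes "lax_solution \<kappa> g \<phi>1 \<phi>2" "lax_solution \<kappa> g' \<chi>1 \<chi>2" "a \<le> b"
  shows "((\<lambda>x. \<i> * of_real \<kappa> * of_real (g x - g' x) * (\<phi>2 x * \<chi>2 x - \<phi>1 x * \<chi>1 x)) has_integral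
     (\<phi>1 b * \<chi>2 b - \<phi>2 b * \<chi>1 b) - (\<phi>1 a * \<chi>2 a - \<phi>2 a * \<chi>1 a)) {a..b}"
  using lax_wedge_deriv[OF assms(1,2)]
  by (intro fundamental_theorem_of_calculus[OF assms(3)]) (blast intro: has_vector_derivative_at_within)

lemma has_vector_derivative_quotient:
  fixes c :: "real \<Rightarrow> 'a :: real_normed_vector"
  assumes "((\<lambda>y. (c y - c x) /\<^sub>R (y - x)) \<longlongrightarrow> d) (at x within S)"
  shows "(c has_vector_derivative d) (at x within S)"
  unfolding has_vector_derivative_def has_derivative_within
proof
  show "bounded_linear (\<lambda>h. h *\<^sub>R d)" by (rule bounded_linear_scaleR_left)
  have "((\<lambda>y. norm ((c y - c x) /\<^sub>R (y - x) - d)) \<longlongrightarrow> 0) (at x within S)"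
    using assms by (intro tendsto_norm_zero) (simp add: LIM_zero)
  then show "((\<lambda>y. (1 / norm (y - x)) *\<^sub>R (c y - (c x + (y - x) *\<^sub>R d))) \<longlongrightarrow> 0) (at x within S)"
  proof (rule Lim_null_comparison[rotated])
    have "norm ((1 / norm (y - x)) *\<^sub>R (c y - (c x + (y - x) *\<^sub>R d))) \<le> norm ((c y - c x) /\<^sub>R (y - x) - d)" if "y \<noteq> x" for y
    proof -
      have "(c y - c x) /\<^sub>R (y - x) - d = (1 / (y - x)) *\<^sub>R (c y - (c x + (y - x) *\<^sub>R d))"
        using that by (simp add: scaleR_diff_right scaleR_add_right divide_inverse)
      then show ?thesis using that by simp
    qed
    then show "\<forall>\<^sub>F y in at x within S. norm ((1 / norm (y - x)) *\<^sub>R (c y - (c x + (y - x) *\<^sub>R d))) \<le> norm ((c y - c x) /\<^sub>R (y - x) - d)"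
      by (auto simp: eventually_at_filter)
  qed
qed

section \<open>Lax solutions on long intervals and their asymptotics\<close>

context schwartz_potential
begin

text \<open>The Jost solution times the phase \<open>E\<close> and its partner from
  \<open>lax_cnj\<close> are orthonormal at every point, so arbitrary data at \<open>x0\<close> are
  met by projecting onto them.\<close>

lemma lax_solution_exists:
  "\<exists>\<phi>1 \<phi>2. lax_solution \<kappa> (deriv w) \<phi>1 \<phi>2 \<and> \<phi>1 x0 = \<alpha> \<and> \<phi>2 x0 = \<beta>"
proof -
  define k where "k = complex_of_real \<kappa>"
  have k: "Im k \<ge> 0" "Im k = 0" "- cnj k = - k" by (simp_all add: k_def)
  define E where "E x = exp (\<i> * k * of_real (P x))" for x
  have dE: "(E has_vector_derivative \<i> * k * of_real (h x) * E x) (at x)" for x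
    using has_vector_derivative_exp[OF dP, of "\<i> * k" 0 x] by (simp add: E_def[abs_def] h_def)
  have cE: "E x * cnj (E x) = 1" for x
    by (simp add: E_def k_def exp_cnj exp_minus)
  define y1 where "y1 x = E x * n1 x k" for x
  define y2 where "y2 x = E x * n2 x k" for x
  have lax: "lax_solution \<kappa> (deriv w) y1 y2"
    unfolding lax_solution_def
  proof (intro allI conjI)
    fix x
    have "(y1 has_vector_derivative E x * (\<i> * k * (of_real (1 - h x) * n1 x k + of_real (deriv w x) * n2 x k))
        + \<i> * k * of_real (h x) * E x * n1 x k) (at x)"
      unfolding y1_def by (intro has_vector_derivative_mult dE deriv_n k)
    then show "(y1 has_vector_derivative \<i> * of_real \<kappa> * (y1 x + of_real (deriv w x) * y2 x)) (at x)"
      by (rule has_vector_derivative_eq_rhs) (simp add: y1_def y2_def k_def algebra_simps)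
    have "(y2 has_vector_derivative E x * (\<i> * k * (of_real (deriv w x) * n1 x k - of_real (1 + h x) * n2 x k))
        + \<i> * k * of_real (h x) * E x * n2 x k) (at x)"
      unfolding y2_def by (intro has_vector_derivative_mult dE deriv_n k)
    then show "(y2 has_vector_derivative \<i> * of_real \<kappa> * (of_real (deriv w x) * y1 x - y2 x)) (at x)"
      by (rule has_vector_derivative_eq_rhs) (simp add: y1_def y2_def k_def algebra_simps)
  qed
  have unit: "y1 x * cnj (y1 x) + y2 x * cnj (y2 x) = 1" for x
  proof -
    have d: "f x k * cnj (f x k) + g x k * cnj (g x k) = 1"
      using det_one[OF k(2), of x] by (simp add: jsum_cnj[OF k(1)] k)
    have "y1 x * cnj (y1 x) + y2 x * cnj (y2 x) = (E x * cnj (E x)) * (n1 x k * cnj (n1 x k) + n2 x k * cnj (n2 x k))"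
      by (simp add: y1_def y2_def algebra_simps)
    also have "n1 x k * cnj (n1 x k) + n2 x k * cnj (n2 x k) =
        ((of_real (hc x))\<^sup>2 + (of_real (hs x))\<^sup>2) * (f x k * cnj (f x k) + g x k * cnj (g x k))"
      by (simp add: n1_def n2_def algebra_simps power2_eq_square)
    finally show ?thesis by (simp only: cE d hc_hs_complex mult_1_left)
  qed
  define A where "A = \<alpha> * cnj (y1 x0) + \<beta> * cnj (y2 x0)"
  define B where "B = \<alpha> * y2 x0 - \<beta> * y1 x0"
  have "A * y1 x0 + B * cnj (y2 x0) = \<alpha>" "A * y2 x0 + B * - cnj (y1 x0) = \<beta>"
    unfolding A_def B_def using unit[of x0] by algebra+
  then show ?thesis
    using lax_linear[OF lax lax_cnj[OF lax], of A B] by (intro exI conjI)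
qed

lemma e_tendsto_bot:
  assumes k: "Im k \<ge> 0"
  shows "((\<lambda>L. e1 (- L) k) \<longlongrightarrow> 0) at_top" "((\<lambda>L. e2 (- L) k) \<longlongrightarrow> 1) at_top"
  unfolding e_eq_m using m.n_tendsto[OF k] by simp_all

text \<open>By \<open>jb_eq\<close> and \<open>ja_eq\<close> the differences are combinations of the
  bounded functions \<open>F\<close> and \<open>G\<close> with coefficients \<open>hc - f\<close>
  and \<open>hs + g\<close>, up to sign and taken at \<open>k\<close> or \<open>- k\<close>; these
  vanish at plus infinity.\<close>

lemma e_tendsto_top:
  fixes \<kappa> :: real
  defines "k \<equiv> complex_of_real \<kappa>"
  shows "((\<lambda>L. e1 L k - exp (2 * \<i> * k * of_real (P L)) * jb k) \<longlongrightarrow> 0) at_top"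
    and "((\<lambda>L. e2 L k - ja k) \<longlongrightarrow> 0) at_top"
proof -
  have k: "Im k \<ge> 0" "Im (- k) \<ge> 0" "Im k = 0" by (simp_all add: k_def)
  have bF: "norm (F x k) \<le> m.B" "norm (G x k) \<le> m.B" for x
    using m.jsum_le_B[OF k(1)] by (simp_all add: F_def G_def)
  have "((\<lambda>x. m.B * (norm (of_real (hc x) - f x k) + norm (of_real (hs x) + g x k))) \<longlongrightarrow>
      m.B * (norm (of_real 1 - 1 :: complex) + norm (of_real 0 + 0 :: complex))) at_top" if "Im k \<ge> 0" for k
    by (intro tendsto_intros hc_tendsto hs_tendsto jsum_tendsto that)
  then have t: "((\<lambda>x. m.B * (norm (of_real (hc x) - f x k) + norm (of_real (hs x) + g x k))) \<longlongrightarrow> 0) at_top" if "Im k \<ge> 0" for k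
    using that by simp
  have b: "norm (a * u + c * v) \<le> m.B * (norm u + norm v)" if "norm a \<le> m.B" "norm c \<le> m.B" for a c u v :: complex
    using mult_right_mono[OF that(1), of "norm u"] mult_right_mono[OF that(2), of "norm v"] norm_triangle_ineq[of "a * u" "c * v"]
    by (simp add: norm_mult distrib_left)
  show "((\<lambda>L. e1 L k - exp (2 * \<i> * k * of_real (P L)) * jb k) \<longlongrightarrow> 0) at_top"
  proof (rule Lim_null_comparison[OF always_eventually t[OF k(2)]], rule allI)
    fix x
    have "exp (2 * \<i> * k * of_real (P x)) * jb k = (exp (2 * \<i> * k * of_real (P x)) * exp (- 2 * \<i> * k * of_real (P x))) * (G x k * f x (- k) + g x (- k) * F x k)"
      by (simp only: jb_eq[OF k(3), of x, symmetric] mult.assoc)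
    then have "e1 x k - exp (2 * \<i> * k * of_real (P x)) * jb k = G x k * (of_real (hc x) - f x (- k)) + (- F x k) * (of_real (hs x) + g x (- k))"
      by (simp add: exp_minus e1_def algebra_simps)
    then show "norm (e1 x k - exp (2 * \<i> * k * of_real (P x)) * jb k) \<le> m.B * (norm (of_real (hc x) - f x (- k)) + norm (of_real (hs x) + g x (- k)))"
      using b[of "G x k" "- F x k"] bF[of x] by simp
  qed
  show "((\<lambda>L. e2 L k - ja k) \<longlongrightarrow> 0) at_top"
  proof (rule Lim_null_comparison[OF always_eventually t[OF k(1)]], rule allI)
    fix x
    have "e2 x k - ja k = F x k * (of_real (hc x) - f x k) + G x k * (of_real (hs x) + g x k)"
      by (simp add: e2_def ja_eq[OF k(1), of x, symmetric] algebra_simps)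
    then show "norm (e2 x k - ja k) \<le> m.B * (norm (of_real (hc x) - f x k) + norm (of_real (hs x) + g x k))"
      using b[of "F x k" "G x k"] bF[of x] by simp
  qed
qed

lemma spectral_b_eq: "spectral_b w \<kappa> = jb (of_real \<kappa>)"
  by (simp add: spectral_b_def scattering_matrix_eq)

text \<open>The data \<open>(0, 1)\<close> at \<open>- L\<close> nearly match the solution
  \<open>z\<close> coming from minus infinity. The mismatch propagates unitarily to
  \<open>L\<close>, where \<open>z\<close> is given by \<open>a\<close> and \<open>b\<close> up to
  the phases collected in \<open>D\<close> and \<open>E\<close>.\<close>

lemma lax_asymptotics:
  assumes lax: "\<And>L. lax_solution \<kappa> (deriv w) (y1 L) (y2 L)" and init: "\<And>L. y1 L (- L) = 0" "\<And>L. y2 L (- L) = 1"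
  shows "((\<lambda>L. y1 L L - spectral_b w \<kappa> * exp (\<i> * of_real (\<kappa> * (P L + P (- L))))) \<longlongrightarrow> 0) at_top"
    and "((\<lambda>L. y2 L L - spectral_a w (of_real \<kappa>) * exp (\<i> * of_real (\<kappa> * (P (- L) - P L)))) \<longlongrightarrow> 0) at_top"
proof -
  define k where "k = complex_of_real \<kappa>"
  have k: "Im k \<ge> 0" by (simp add: k_def)
  define E where "E x = exp (- (\<i> * k) * of_real (P x))" for x
  have dE: "(E has_vector_derivative - (\<i> * k) * of_real (h x) * E x) (at x)" for x
    using has_vector_derivative_exp[OF dP, of "- (\<i> * k)" 0 x] by (simp add: E_def[abs_def] h_def)
  define z1 where "z1 x = E x * e1 x k" for x
  define z2 where "z2 x = E x * e2 x k" for x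
  have de: "((\<lambda>x. e1 x k) has_vector_derivative \<i> * k * (of_real (deriv w x) * e2 x k + of_real (1 + h x) * e1 x k)) (at x)"
    "((\<lambda>x. e2 x k) has_vector_derivative \<i> * k * (of_real (h x - 1) * e2 x k + of_real (deriv w x) * e1 x k)) (at x)" for x
    using has_vector_derivative_mirror[OF m.deriv_n(2)[OF k, of "- x"]] has_vector_derivative_mirror[OF m.deriv_n(1)[OF k, of "- x"]]
    by (auto simp: e_eq_m m_h algebra_simps elim!: has_vector_derivative_eq_rhs)
  have laxz: "lax_solution \<kappa> (deriv w) z1 z2"
    unfolding lax_solution_def
  proof (intro allI conjI)
    fix x
    have "(z1 has_vector_derivative E x * (\<i> * k * (of_real (deriv w x) * e2 x k + of_real (1 + h x) * e1 x k))
        + - (\<i> * k) * of_real (h x) * E x * e1 x k) (at x)"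
      unfolding z1_def by (intro has_vector_derivative_mult dE de)
    then show "(z1 has_vector_derivative \<i> * of_real \<kappa> * (z1 x + of_real (deriv w x) * z2 x)) (at x)"
      by (rule has_vector_derivative_eq_rhs) (simp add: z1_def z2_def k_def algebra_simps)
    have "(z2 has_vector_derivative E x * (\<i> * k * (of_real (h x - 1) * e2 x k + of_real (deriv w x) * e1 x k))
        + - (\<i> * k) * of_real (h x) * E x * e2 x k) (at x)"
      unfolding z2_def by (intro has_vector_derivative_mult dE de)
    then show "(z2 has_vector_derivative \<i> * of_real \<kappa> * (of_real (deriv w x) * z1 x - z2 x)) (at x)"
      by (rule has_vector_derivative_eq_rhs) (simp add: z1_def z2_def k_def algebra_simps)
  qed
  \<comment> \<open>Cancels the phase of \<open>z\<close> at \<open>- L\<close>, so that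
    \<open>D L * z\<close> starts at \<open>(e1, e2)\<close>, which is close to
    \<open>(0, 1)\<close>.\<close>
  define D where "D L = exp (\<i> * k * of_real (P (- L)))" for L
  have DE: "D L * E (- L) = 1" for L by (simp add: D_def E_def exp_minus)
  define N where "N L = norm (e1 (- L) k) + norm (1 - e2 (- L) k)" for L
  have "((\<lambda>L. norm (e1 (- L) k) + norm (1 - e2 (- L) k)) \<longlongrightarrow> norm (0::complex) + norm (1 - 1 :: complex)) at_top"
    by (intro tendsto_intros e_tendsto_bot k)
  then have N: "(N \<longlongrightarrow> 0) at_top" by (simp add: N_def[abs_def])
  have close: "norm (y1 L L - D L * z1 L) \<le> N L" "norm (y2 L L - D L * z2 L) \<le> N L" for L
  proof -
    let ?d1 = "\<lambda>x. 1 * y1 L x + (- D L) * z1 x" and ?d2 = "\<lambda>x. 1 * y2 L x + (- D L) * z2 x"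
    have i: "?d1 (- L) = - e1 (- L) k" "?d2 (- L) = 1 - e2 (- L) k"
      using DE[of L] by (simp_all add: z1_def z2_def init mult.assoc[symmetric])
    have "(cmod (?d1 L))\<^sup>2 + (cmod (?d2 L))\<^sup>2 = (cmod (?d1 (- L)))\<^sup>2 + (cmod (?d2 (- L)))\<^sup>2"
      by (rule lax_norm[OF lax_linear[OF lax laxz]])
    also have "\<dots> = (norm (e1 (- L) k))\<^sup>2 + (norm (1 - e2 (- L) k))\<^sup>2"
      unfolding i by simp
    also have "\<dots> \<le> (N L)\<^sup>2"
      by (simp add: N_def power2_sum)
    finally have *: "(cmod (?d1 L))\<^sup>2 + (cmod (?d2 L))\<^sup>2 \<le> (N L)\<^sup>2" .
    have N0: "0 \<le> N L" by (simp add: N_def)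
    have "(cmod (?d1 L))\<^sup>2 \<le> (N L)\<^sup>2" "(cmod (?d2 L))\<^sup>2 \<le> (N L)\<^sup>2"
      using * zero_le_power2[of "cmod (?d1 L)"] zero_le_power2[of "cmod (?d2 L)"] by linarith+
    then have "cmod (?d1 L) \<le> N L" "cmod (?d2 L) \<le> N L"
      using N0 by (auto intro: power2_le_imp_le)
    then show "norm (y1 L L - D L * z1 L) \<le> N L" "norm (y2 L L - D L * z2 L) \<le> N L" by simp_all
  qed
  have nD: "norm (D L) = 1" "norm (E L) = 1" for L
    by (simp_all add: D_def E_def k_def norm_exp_eq_Re)
  have ex: "D L * E L * exp (2 * \<i> * k * of_real (P L)) = exp (\<i> * of_real (\<kappa> * (P L + P (- L))))"
    "D L * E L = exp (\<i> * of_real (\<kappa> * (P (- L) - P L)))" for L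
    unfolding D_def E_def exp_add[symmetric] by (simp_all add: k_def algebra_simps)
  have lim: "((\<lambda>L. N L + norm (\<delta> L)) \<longlongrightarrow> 0) at_top" if "(\<delta> \<longlongrightarrow> 0) at_top" for \<delta> :: "real \<Rightarrow> complex"
    using tendsto_add[OF N tendsto_norm_zero[OF that]] by simp
  show "((\<lambda>L. y1 L L - spectral_b w \<kappa> * exp (\<i> * of_real (\<kappa> * (P L + P (- L))))) \<longlongrightarrow> 0) at_top"
  proof (rule Lim_null_comparison[OF always_eventually lim[OF e_tendsto_top(1)[of \<kappa>]]], rule allI)
    fix L
    have "spectral_b w \<kappa> * exp (\<i> * of_real (\<kappa> * (P L + P (- L)))) = D L * E L * (exp (2 * \<i> * k * of_real (P L)) * jb k)"
      by (simp only: spectral_b_eq k_def[symmetric] ex(1)[symmetric] mult_ac)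
    then have eq: "y1 L L - spectral_b w \<kappa> * exp (\<i> * of_real (\<kappa> * (P L + P (- L)))) =
        (y1 L L - D L * z1 L) + D L * E L * (e1 L k - exp (2 * \<i> * k * of_real (P L)) * jb k)"
      by (simp add: z1_def right_diff_distrib mult.assoc)
    show "norm (y1 L L - spectral_b w \<kappa> * exp (\<i> * of_real (\<kappa> * (P L + P (- L)))))
        \<le> N L + norm (e1 L (of_real \<kappa>) - exp (2 * \<i> * of_real \<kappa> * of_real (P L)) * jb (of_real \<kappa>))"
      unfolding eq unfolding k_def[symmetric] using close(1)[of L] by (intro norm_triangle_le) (simp add: norm_mult nD)
  qed
  show "((\<lambda>L. y2 L L - spectral_a w (of_real \<kappa>) * exp (\<i> * of_real (\<kappa> * (P (- L) - P L)))) \<longlongrightarrow> 0) at_top"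
  proof (rule Lim_null_comparison[OF always_eventually lim[OF e_tendsto_top(2)[of \<kappa>]]], rule allI)
    fix L
    have "spectral_a w (of_real \<kappa>) * exp (\<i> * of_real (\<kappa> * (P (- L) - P L))) = D L * E L * ja k"
      by (simp only: spectral_a_eq[OF k] k_def[symmetric] ex(2)[symmetric] mult_ac)
    then have eq: "y2 L L - spectral_a w (of_real \<kappa>) * exp (\<i> * of_real (\<kappa> * (P (- L) - P L))) =
        (y2 L L - D L * z2 L) + D L * E L * (e2 L k - ja k)"
      by (simp add: z2_def right_diff_distrib mult.assoc)
    show "norm (y2 L L - spectral_a w (of_real \<kappa>) * exp (\<i> * of_real (\<kappa> * (P (- L) - P L))))
        \<le> N L + norm (e2 L (of_real \<kappa>) - ja (of_real \<kappa>))"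
      unfolding eq unfolding k_def[symmetric] using close(2)[of L] by (intro norm_triangle_le) (simp add: norm_mult nD)
  qed
qed

lemma P_minus_id_le: "\<bar>P x - x\<bar> \<le> C0 * kap_tail x"
proof -
  have "norm (LINT y:{x..}|lborel. sqrt (m_fun w y) - 1) \<le> C0 * kap_tail x ^ Suc 0 / Suc 0"
  proof (rule tail_bound_norm)
    show "set_borel_measurable lborel {x..} (\<lambda>y. sqrt (m_fun w y) - 1)"
      unfolding m_fun_def by (intro set_borel_measurable_continuous_UNIV continuous_intros cont_w1)
    show "norm (sqrt (m_fun w y) - 1) \<le> C0 * (kap y * kap_tail y ^ 0)" for y
      using h_minus_1[of y] by (simp add: h_def m_fun_def)
  qed
  then show ?thesis by (simp add: p_fun_def)
qed

lemma P_growth: "x \<le> y \<Longrightarrow> P x + (y - x) \<le> P y"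
proof -
  assume "x \<le> y"
  then have "P x - x \<le> P y - y"
    by (rule DERIV_nonneg_imp_nondecreasing)
       (use DERIV_diff[OF dP DERIV_ident] h_ge_1 in \<open>fastforce simp: h_def\<close>)
  then show ?thesis by simp
qed

text \<open>\<open>P\<close> has slope at least 1, so it attains the level \<open>y\<close> within
  distance \<open>|y - P 0|\<close> of 0, and only once.\<close>

lemma P_bij: "\<exists>!x. P x = y"
proof -
  define b where "b = \<bar>y - P 0\<bar>"
  have "P (- b) \<le> y" "y \<le> P b"
    using P_growth[of 0 b] P_growth[of "- b" 0] by (auto simp: b_def)
  then have "\<exists>x\<ge>- b. x \<le> b \<and> P x = y"
    by (intro IVT') (auto simp: b_def intro: continuous_on_subset[OF cont_P])
  moreover have "x = x'" if "P x = P x'" for x x'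
    using P_growth[of x x'] P_growth[of x' x] that by linarith
  ultimately show ?thesis by metis
qed

end

section \<open>Time derivative of the transfer matrix of a finite interval\<close>

context short_pulse
begin

text \<open>This is \<open>det (W p, c)\<close> for the time part \<open>W = u\<^sup>2/2 i\<kappa> (\<sigma>\<^sub>3 + u\<^sub>x \<sigma>\<^sub>1) + \<sigma>\<^sub>3 / (4 i\<kappa>) - (u/2) i\<sigma>\<^sub>2\<close> of the Lax pair;
  at infinity only the middle term survives.\<close>

definition lax_flux :: "real \<Rightarrow> real \<Rightarrow> real \<Rightarrow> complex \<Rightarrow> complex \<Rightarrow> complex \<Rightarrow> complex \<Rightarrow> complex" where
  "lax_flux \<kappa> x s p1 p2 c1 c2 =
     \<i> * of_real \<kappa> / 2 * (of_real (u x s) * of_real (u x s)) *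
        ((p1 + of_real (ux x s) * p2) * c2 - (of_real (ux x s) * p1 - p2) * c1)
     + (p1 * c2 + p2 * c1) / (4 * \<i> * of_real \<kappa>) - of_real (u x s) / 2 * (p2 * c2 + p1 * c1)"

text \<open>The zero curvature equation in scalar form: the right-hand side is the determinant of
  \<open>c\<close> with the time derivative of the spatial Lax matrix applied to \<open>p\<close>.
  The short pulse equation enters through \<open>T\<close>.\<close>

lemma lax_flux_deriv:
  assumes \<kappa>: "\<kappa> \<noteq> 0" and s: "0 \<le> s"
    and lax: "lax_solution \<kappa> (\<lambda>x. ux x s) p1 p2" "lax_solution \<kappa> (\<lambda>x. ux x s) c1 c2"
  shows "((\<lambda>x. lax_flux \<kappa> x s (p1 x) (p2 x) (c1 x) (c2 x)) has_vector_derivative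
     \<i> * of_real \<kappa> * of_real (uxt x s) * (p2 x * c2 x - p1 x * c1 x)) (at x)"
proof -
  define K where "K = \<i> * complex_of_real \<kappa>"
  \<comment> \<open>A variable for \<open>1 / (4 * \<i> * \<kappa>)\<close>; with the relation
    \<open>Kl\<close> the final identity is free of division by \<open>\<kappa>\<close>.\<close>
  define l where "l = 1 / (4 * K)"
  have Kl: "4 * K * l = 1" using \<kappa> by (simp add: K_def l_def)
  define U where "U x = complex_of_real (u x s)" for x
  define V where "V x = complex_of_real (ux x s)" for x
  have dU: "(U has_vector_derivative V x) (at x)" for x
    unfolding U_def V_def by (rule has_vector_derivative_complex_of_real[OF partial_dx]) (use s in auto)
  have dV: "(V has_vector_derivative of_real (uxx x s)) (at x)" for x
    unfolding V_def by (rule has_vector_derivative_complex_of_real[OF partial_dx]) (use s in auto)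
  have d: "(p1 has_vector_derivative K * (p1 x + V x * p2 x)) (at x)" "(p2 has_vector_derivative K * (V x * p1 x - p2 x)) (at x)"
    "(c1 has_vector_derivative K * (c1 x + V x * c2 x)) (at x)" "(c2 has_vector_derivative K * (V x * c1 x - c2 x)) (at x)" for x
    using lax by (simp_all add: lax_solution_def K_def V_def)
  have eq: "lax_flux \<kappa> x s (p1 x) (p2 x) (c1 x) (c2 x) =
      (K / 2 * (U x * U x)) * ((p1 x + V x * p2 x) * c2 x - (V x * p1 x - p2 x) * c1 x)
      + l * (p1 x * c2 x + p2 x * c1 x) - (1 / 2 * U x) * (p2 x * c2 x + p1 x * c1 x)" for x
    by (simp add: lax_flux_def K_def U_def V_def l_def mult.assoc)
  have T: "complex_of_real (uxt x s) = U x + U x * V x * V x + U x * U x * of_real (uxx x s) / 2"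
    unfolding equation[OF s] by (simp add: U_def V_def power2_eq_square mult.assoc)
  show ?thesis
    unfolding eq K_def[symmetric] T
    by (rule has_vector_derivative_eq_rhs,
        (rule has_vector_derivative_add has_vector_derivative_diff has_vector_derivative_mult
          has_vector_derivative_const dU dV d)+)
       (use Kl in algebra)
qed

lemma lax_flux_bound:
  assumes "cmod p1 \<le> 1" "cmod p2 \<le> 1" "cmod c1 \<le> 1" "cmod c2 \<le> 1"
  shows "cmod (lax_flux \<kappa> x s p1 p2 c1 c2 - (p1 * c2 + p2 * c1) / (4 * \<i> * of_real \<kappa>))
     \<le> 2 * \<bar>\<kappa>\<bar> * ((u x s)\<^sup>2 * m x s) + \<bar>u x s\<bar>"
proof -
  define V where "V = complex_of_real (ux x s)"
  have V: "cmod V \<le> m x s"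
    unfolding V_def m_def norm_of_real by (rule real_le_rsqrt) simp
  have "cmod (p1 * c2 + p2 * c1) \<le> 2" by (rule norm_wedge_le_2) (use assms in auto)
  moreover have "cmod (V * (p2 * c2 - p1 * c1)) \<le> m x s * 2"
    unfolding norm_mult using V m_ge_1[of x s] by (intro mult_mono norm_wedge_le_2 assms) auto
  ultimately have "cmod ((p1 * c2 + p2 * c1) + V * (p2 * c2 - p1 * c1)) \<le> 2 * m x s + m x s * 2"
    using m_ge_1[of x s] by (intro norm_triangle_le) simp
  moreover have "(p1 + V * p2) * c2 - (V * p1 - p2) * c1 = (p1 * c2 + p2 * c1) + V * (p2 * c2 - p1 * c1)"
    by (simp add: algebra_simps)
  ultimately have b: "cmod ((p1 + V * p2) * c2 - (V * p1 - p2) * c1) \<le> 4 * m x s" by simp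
  have 1: "cmod (\<i> * of_real \<kappa> / 2 * (of_real (u x s) * of_real (u x s)) * ((p1 + V * p2) * c2 - (V * p1 - p2) * c1))
      \<le> \<bar>\<kappa>\<bar> / 2 * (u x s)\<^sup>2 * (4 * m x s)"
    unfolding norm_mult using b by (intro mult_mono) (auto simp: norm_mult power2_eq_square abs_mult[symmetric])
  have "cmod (p2 * c2 + p1 * c1) \<le> 2" by (rule norm_wedge_le_2) (use assms in auto)
  then have 2: "cmod (of_real (u x s) / 2 * (p2 * c2 + p1 * c1)) \<le> \<bar>u x s\<bar> / 2 * 2"
    unfolding norm_mult by (intro mult_mono) auto
  have eq: "lax_flux \<kappa> x s p1 p2 c1 c2 - (p1 * c2 + p2 * c1) / (4 * \<i> * of_real \<kappa>) =
      \<i> * of_real \<kappa> / 2 * (of_real (u x s) * of_real (u x s)) * ((p1 + V * p2) * c2 - (V * p1 - p2) * c1)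
      - of_real (u x s) / 2 * (p2 * c2 + p1 * c1)"
    by (simp add: lax_flux_def V_def)
  show ?thesis
    unfolding eq by (rule order_trans[OF norm_triangle_ineq4], rule order_trans[OF add_mono[OF 1 2]]) simp
qed

lemma ux_lipschitz:
  obtains K where "0 \<le> K"
    "\<And>x s s'. x \<in> {- L..L} \<Longrightarrow> s \<in> {0..t} \<Longrightarrow> s' \<in> {0..t} \<Longrightarrow> \<bar>ux x s' - ux x s\<bar> \<le> K * \<bar>s' - s\<bar>"
proof -
  have "compact ((\<lambda>z. uxt (fst z) (snd z)) ` ({- L..L} \<times> {0..t}))"
    by (intro compact_continuous_image compact_Times compact_Icc continuous_intros) auto
  then have "bounded ((\<lambda>z. uxt (fst z) (snd z)) ` ({- L..L} \<times> {0..t}))"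
    by (rule compact_imp_bounded)
  then obtain K where K: "0 < K" "\<forall>y\<in>(\<lambda>z. uxt (fst z) (snd z)) ` ({- L..L} \<times> {0..t}). norm y \<le> K"
    unfolding bounded_pos by blast
  show ?thesis
  proof (rule that[of K])
    fix x s s' assume x: "x \<in> {- L..L}" and s: "s \<in> {0..t}" "s' \<in> {0..t}"
    have "norm (ux x s' - ux x s) \<le> K * norm (s' - s)"
    proof (rule field_differentiable_bound[of "{0..t}"])
      fix r assume r: "r \<in> {0..t}"
      have "(ux x has_vector_derivative uxt x r) (at r within {0..t})"
        by (rule has_vector_derivative_within_subset[OF partial_dt]) (use r in auto)
      then show "(ux x has_field_derivative uxt x r) (at r within {0..t})"
        by (simp add: has_real_derivative_iff_has_vector_derivative)
      show "norm (uxt x r) \<le> K" using K(2) x r by force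
    qed (use s in auto)
    then show "\<bar>ux x s' - ux x s\<bar> \<le> K * \<bar>s' - s\<bar>" by simp
  qed (use K in simp)
qed

text \<open>The determinant at \<open>L\<close> of the solution \<open>p\<close>, started at
  \<open>- L\<close>, with the vector \<open>(\<gamma>, \<delta>)\<close>. For coordinate vectors as
  data it is, up to sign, an entry of the transfer matrix of \<open>{- L..L}\<close>.\<close>

definition connection ::
    "real \<Rightarrow> (real \<Rightarrow> real \<Rightarrow> complex) \<Rightarrow> (real \<Rightarrow> real \<Rightarrow> complex) \<Rightarrow> complex \<Rightarrow> complex \<Rightarrow> real \<Rightarrow> complex" where
  "connection L p1 p2 \<gamma> \<delta> s = p1 s L * \<delta> - p2 s L * \<gamma>"

context
  fixes \<kappa> t L :: real and p1 p2 c1 c2 :: "real \<Rightarrow> real \<Rightarrow> complex" and \<alpha> \<beta> \<gamma> \<delta> :: complex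
  assumes \<kappa>: "\<kappa> \<noteq> 0" and t: "0 \<le> t" and L: "0 < L"
    and laxp: "\<And>s. s \<in> {0..t} \<Longrightarrow> lax_solution \<kappa> (\<lambda>x. ux x s) (p1 s) (p2 s)"
    and laxc: "\<And>s. s \<in> {0..t} \<Longrightarrow> lax_solution \<kappa> (\<lambda>x. ux x s) (c1 s) (c2 s)"
    and ip: "\<And>s. s \<in> {0..t} \<Longrightarrow> p1 s (- L) = \<alpha> \<and> p2 s (- L) = \<beta>" "(cmod \<alpha>)\<^sup>2 + (cmod \<beta>)\<^sup>2 = 1"
    and ic: "\<And>s. s \<in> {0..t} \<Longrightarrow> c1 s L = \<gamma> \<and> c2 s L = \<delta>" "(cmod \<gamma>)\<^sup>2 + (cmod \<delta>)\<^sup>2 = 1"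
    and ex: "\<And>s x0 a b. s \<in> {0..t} \<Longrightarrow>
      \<exists>y1 y2. lax_solution \<kappa> (\<lambda>x. ux x s) y1 y2 \<and> y1 x0 = a \<and> y2 x0 = b"
begin

lemma p_le_1: "s \<in> {0..t} \<Longrightarrow> cmod (p1 s x) \<le> 1" "s \<in> {0..t} \<Longrightarrow> cmod (p2 s x) \<le> 1"
  and c_le_1: "s \<in> {0..t} \<Longrightarrow> cmod (c1 s x) \<le> 1" "s \<in> {0..t} \<Longrightarrow> cmod (c2 s x) \<le> 1"
  using lax_le_1[OF laxp, of s "- L" x] lax_le_1[OF laxc, of s L x] ip ic by auto

text \<open>Duhamel's formula in time: the determinant of \<open>p s\<close> with a solution at time
  \<open>s\<close> is constant in \<open>x\<close> and fixed by the common data at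
  \<open>- L\<close>, so only the determinant with \<open>p s'\<close> varies along the
  interval.\<close>

lemma wedge_difference:
  assumes s: "s \<in> {0..t}" "s' \<in> {0..t}" and lax: "lax_solution \<kappa> (\<lambda>x. ux x s) y1 y2" and x: "- L \<le> x"
  shows "((\<lambda>z. \<i> * of_real \<kappa> * of_real (ux z s' - ux z s) * (p2 s' z * y2 z - p1 s' z * y1 z)) has_integral
     (p1 s' x * y2 x - p2 s' x * y1 x) - (p1 s x * y2 x - p2 s x * y1 x)) {- L..x}"
proof -
  have "((\<lambda>z. p1 s z * y2 z - p2 s z * y1 z) has_vector_derivative 0) (at z)" for z
    using lax_wedge_deriv[OF laxp[OF s(1)] lax, of z] by simp
  from has_vector_derivative_zero_UNIV[of "\<lambda>z. p1 s z * y2 z - p2 s z * y1 z", OF this, of x "- L"]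
  have "p1 s x * y2 x - p2 s x * y1 x = p1 s' (- L) * y2 (- L) - p2 s' (- L) * y1 (- L)"
    using ip(1)[OF s(1)] ip(1)[OF s(2)] by simp
  then show ?thesis
    using lax_wedge_integral[OF laxp[OF s(2)] lax x] by simp
qed

text \<open>Testing against solutions with data \<open>(0, 1)\<close> and \<open>(1, 0)\<close> at
  the point \<open>x\<close> extracts the two components of \<open>p s' - p s\<close>.\<close>

lemma p_lipschitz:
  obtains K where "\<And>x s s'. x \<in> {- L..L} \<Longrightarrow> s \<in> {0..t} \<Longrightarrow> s' \<in> {0..t} \<Longrightarrow>
    cmod (p1 s' x - p1 s x) \<le> K * \<bar>s' - s\<bar> \<and> cmod (p2 s' x - p2 s x) \<le> K * \<bar>s' - s\<bar>"
proof -
  obtain K where K: "0 \<le> K" "\<And>x s s'. x \<in> {- L..L} \<Longrightarrow> s \<in> {0..t} \<Longrightarrow> s' \<in> {0..t} \<Longrightarrow> \<bar>ux x s' - ux x s\<bar> \<le> K * \<bar>s' - s\<bar>"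
    using ux_lipschitz by blast
  \<comment> \<open>The integrand bound in \<open>wedge_difference\<close>, with 2 for the products
    of entries of modulus at most 1, times the length \<open>2 * L\<close> of the interval.\<close>
  define K' where "K' = \<bar>\<kappa>\<bar> * K * 2 * (2 * L)"
  have est: "cmod ((p1 s' x * b - p2 s' x * a) - (p1 s x * b - p2 s x * a)) \<le> K' * \<bar>s' - s\<bar>"
    if x: "x \<in> {- L..L}" and s: "s \<in> {0..t}" "s' \<in> {0..t}" and ab: "(cmod a)\<^sup>2 + (cmod b)\<^sup>2 = 1" for x s s' a b
  proof -
    obtain y1 y2 where y: "lax_solution \<kappa> (\<lambda>x. ux x s) y1 y2" "y1 x = a" "y2 x = b"
      using ex[OF s(1)] by blast
    have y1: "cmod (y1 z) \<le> 1" "cmod (y2 z) \<le> 1" for z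
      using lax_le_1[OF y(1), of x z] y(2,3) ab by auto
    have "norm ((p1 s' x * y2 x - p2 s' x * y1 x) - (p1 s x * y2 x - p2 s x * y1 x)) \<le> (\<bar>\<kappa>\<bar> * (K * \<bar>s' - s\<bar>) * 2) * measure lborel {- L..x}"
    proof (rule has_integral_bound_real[OF _ finite.emptyI wedge_difference[OF s y(1)]])
      show "0 \<le> \<bar>\<kappa>\<bar> * (K * \<bar>s' - s\<bar>) * 2" using K(1) by simp
      show "- L \<le> x" using x by simp
      fix z assume "z \<in> {- L..x} - {}"
      then have "z \<in> {- L..L}" using x by simp
      then show "norm (\<i> * of_real \<kappa> * of_real (ux z s' - ux z s) * (p2 s' z * y2 z - p1 s' z * y1 z)) \<le> \<bar>\<kappa>\<bar> * (K * \<bar>s' - s\<bar>) * 2"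
        unfolding norm_mult norm_of_real using K(1) K(2)[of z s s'] s y1 p_le_1
        by (intro mult_mono norm_wedge_le_2) auto
    qed
    also have "\<dots> \<le> (\<bar>\<kappa>\<bar> * (K * \<bar>s' - s\<bar>) * 2) * (2 * L)"
      using x K(1) by (intro mult_left_mono) auto
    finally show ?thesis using y by (simp add: K'_def mult_ac)
  qed
  show ?thesis
  proof (rule that[of K'])
    fix x s s' assume "x \<in> {- L..L}" "s \<in> {0..t}" "s' \<in> {0..t}"
    from est[OF this, of 0 1] est[OF this, of 1 0]
    show "cmod (p1 s' x - p1 s x) \<le> K' * \<bar>s' - s\<bar> \<and> cmod (p2 s' x - p2 s x) \<le> K' * \<bar>s' - s\<bar>"
      by (simp add: norm_minus_commute)
  qed
qed

abbreviation conn :: "real \<Rightarrow> complex" where "conn \<equiv> connection L p1 p2 \<gamma> \<delta>"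

text \<open>Solutions at the same time have constant determinant, so \<open>conn\<close> can be read
  off at either end. This expresses \<open>c\<close> at \<open>- L\<close> through \<open>p\<close>
  at \<open>L\<close>.\<close>

lemma conn_at_minus: "s \<in> {0..t} \<Longrightarrow> conn s = \<alpha> * c2 s (- L) - \<beta> * c1 s (- L)"
proof -
  assume s: "s \<in> {0..t}"
  have "((\<lambda>z. p1 s z * c2 s z - p2 s z * c1 s z) has_vector_derivative 0) (at z)" for z
    using lax_wedge_deriv[OF laxp[OF s] laxc[OF s], of z] by simp
  from has_vector_derivative_zero_UNIV[of "\<lambda>z. p1 s z * c2 s z - p2 s z * c1 s z", OF this, of L "- L"]
  show ?thesis using ip(1)[OF s] ic(1)[OF s] by (simp add: connection_def)
qed

text \<open>While \<open>p\<close> varies in time, \<open>c\<close> stays at time \<open>s\<close>;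
  the difference quotient is then an exact integral over \<open>{- L..L}\<close>, and the Lipschitz
  bounds allow dominated convergence. By \<open>lax_flux_deriv\<close> the limit integrates to the
  fluxes at the two ends.\<close>

lemma conn_deriv:
  assumes s: "s \<in> {0..t}"
  shows "(conn has_vector_derivative
     lax_flux \<kappa> L s (p1 s L) (p2 s L) \<gamma> \<delta> - lax_flux \<kappa> (- L) s \<alpha> \<beta> (c1 s (- L)) (c2 s (- L))) (at s within {0..t})"
proof (rule has_vector_derivative_quotient)
  obtain K where K: "0 \<le> K" "\<And>x s s'. x \<in> {- L..L} \<Longrightarrow> s \<in> {0..t} \<Longrightarrow> s' \<in> {0..t} \<Longrightarrow> \<bar>ux x s' - ux x s\<bar> \<le> K * \<bar>s' - s\<bar>"
    using ux_lipschitz by blast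
  obtain K' where K': "\<And>x s s'. x \<in> {- L..L} \<Longrightarrow> s \<in> {0..t} \<Longrightarrow> s' \<in> {0..t} \<Longrightarrow>
    cmod (p1 s' x - p1 s x) \<le> K' * \<bar>s' - s\<bar> \<and> cmod (p2 s' x - p2 s x) \<le> K' * \<bar>s' - s\<bar>"
    using p_lipschitz by blast
  let ?d = "lax_flux \<kappa> L s (p1 s L) (p2 s L) \<gamma> \<delta> - lax_flux \<kappa> (- L) s \<alpha> \<beta> (c1 s (- L)) (c2 s (- L))"
  let ?g = "\<lambda>x. \<i> * of_real \<kappa> * of_real (uxt x s) * (p2 s x * c2 s x - p1 s x * c1 s x)"
  have "(?g has_integral lax_flux \<kappa> L s (p1 s L) (p2 s L) (c1 s L) (c2 s L)
      - lax_flux \<kappa> (- L) s (p1 s (- L)) (p2 s (- L)) (c1 s (- L)) (c2 s (- L))) {- L..L}"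
    using lax_flux_deriv[OF \<kappa> _ laxp[OF s] laxc[OF s]] s L
    by (intro fundamental_theorem_of_calculus) (auto intro: has_vector_derivative_at_within)
  then have g: "(?g has_integral ?d) {- L..L}" using ip(1)[OF s] ic(1)[OF s] by simp
  show "((\<lambda>s'. (conn s' - conn s) /\<^sub>R (s' - s)) \<longlongrightarrow> ?d) (at s within {0..t})"
    unfolding tendsto_at_iff_sequentially comp_def
  proof (intro allI impI)
    fix X assume X: "\<forall>i. X i \<in> {0..t} - {s}" "X \<longlonglongrightarrow> s"
    define q where "q n x = (ux x (X n) - ux x s) / (X n - s)" for n x
    define F where "F n x = \<i> * of_real \<kappa> * of_real (q n x) * (p2 (X n) x * c2 s x - p1 (X n) x * c1 s x)" for n x
    have Xn: "X n \<in> {0..t}" "X n \<noteq> s" for n using X(1) by auto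
    have F: "(F n has_integral (conn (X n) - conn s) /\<^sub>R (X n - s)) {- L..L}" for n
    proof -
      have "((\<lambda>z. \<i> * of_real \<kappa> * of_real (ux z (X n) - ux z s) * (p2 (X n) z * c2 s z - p1 (X n) z * c1 s z)) has_integral
          conn (X n) - conn s) {- L..L}"
        using wedge_difference[OF s Xn(1) laxc[OF s], of L n] L ic(1)[OF s] by (simp add: connection_def)
      from has_integral_cmul[OF this, of "inverse (X n - s)"]
      show ?thesis
        by (rule has_integral_eq[rotated]) (simp add: F_def q_def scaleR_conv_of_real divide_inverse mult_ac)
    qed
    have "(\<lambda>n. integral {- L..L} (F n)) \<longlonglongrightarrow> integral {- L..L} ?g"
    proof (rule dominated_convergence(2)[where h = "\<lambda>_. \<bar>\<kappa>\<bar> * K * 2"])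
      show "F n integrable_on {- L..L}" for n using F by blast
      show "(\<lambda>_. \<bar>\<kappa>\<bar> * K * 2) integrable_on {- L..L}" by (rule integrable_const_ivl)
      fix n x assume x: "x \<in> {- L..L}"
      have "\<bar>q n x\<bar> \<le> K"
        using K(2)[OF x s Xn(1), of n] Xn(2)[of n] by (simp add: q_def divide_le_eq)
      then show "norm (F n x) \<le> \<bar>\<kappa>\<bar> * K * 2"
        unfolding F_def norm_mult using K(1) s Xn(1) p_le_1 c_le_1
        by (intro mult_mono norm_wedge_le_2) auto
    next
      fix x assume x: "x \<in> {- L..L}"
      have "(ux x has_vector_derivative uxt x s) (at s within {0..t})"
        by (rule has_vector_derivative_within_subset[OF partial_dt]) (use s in auto)
      then have "((\<lambda>y. (ux x y - ux x s) / (y - s)) \<longlongrightarrow> uxt x s) (at s within {0..t})"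
        by (simp add: has_real_derivative_iff_has_vector_derivative[symmetric] has_field_derivative_iff)
      then have q: "(\<lambda>n. q n x) \<longlonglongrightarrow> uxt x s"
        using X unfolding tendsto_at_iff_sequentially comp_def q_def by blast
      have "(\<lambda>n. K' * \<bar>X n - s\<bar>) \<longlonglongrightarrow> K' * \<bar>s - s\<bar>" by (intro tendsto_intros X)
      then have z: "(\<lambda>n. K' * \<bar>X n - s\<bar>) \<longlonglongrightarrow> 0" by simp
      have p: "(\<lambda>n. p1 (X n) x) \<longlonglongrightarrow> p1 s x" "(\<lambda>n. p2 (X n) x) \<longlonglongrightarrow> p2 s x"
        using K'[OF x s Xn(1)] by (auto intro!: LIM_zero_cancel[OF Lim_null_comparison[OF always_eventually z]])
      show "(\<lambda>n. F n x) \<longlonglongrightarrow> ?g x"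
        unfolding F_def by (intro tendsto_intros q p)
    qed
    then show "(\<lambda>n. (conn (X n) - conn s) /\<^sub>R (X n - s)) \<longlonglongrightarrow> ?d"
      by (simp only: integral_unique[OF F] integral_unique[OF g])
  qed
qed

definition err :: "real \<Rightarrow> real \<Rightarrow> real" where
  "err x s = 2 * \<bar>\<kappa>\<bar> * ((u x s)\<^sup>2 * m x s) + \<bar>u x s\<bar>"

text \<open>The assumption says that the flux terms surviving at infinity act on \<open>conn\<close>
  as multiplication by \<open>\<i> * l\<close>. An integrating factor of modulus 1 removes them,
  leaving \<open>err\<close> at both ends.\<close>

lemma conn_estimate:
  assumes \<lambda>: "\<And>s. s \<in> {0..t} \<Longrightarrow> (p1 s L * \<delta> + p2 s L * \<gamma>) / (4 * \<i> * of_real \<kappa>)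
      - (\<alpha> * c2 s (- L) + \<beta> * c1 s (- L)) / (4 * \<i> * of_real \<kappa>) = \<i> * of_real l * conn s"
  shows "cmod (exp (- (\<i> * of_real (l * t))) * conn t - conn 0) \<le> integral {0..t} (\<lambda>s. err L s + err (- L) s)"
proof -
  define E where "E s = exp (- (\<i> * of_real l) * of_real (s - 0))" for s :: real
  have dE: "(E has_vector_derivative - (\<i> * of_real l) * of_real 1 * E s) (at s within {0..t})" for s
    unfolding E_def by (rule has_vector_derivative_at_within[OF has_vector_derivative_exp[OF DERIV_ident]])
  have nE: "cmod (E s) = 1" for s by (simp add: E_def norm_exp_eq_Re)
  define d where "d s = lax_flux \<kappa> L s (p1 s L) (p2 s L) \<gamma> \<delta> - lax_flux \<kappa> (- L) s \<alpha> \<beta> (c1 s (- L)) (c2 s (- L))" for s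
  have I: "((\<lambda>s. E s * d s + - (\<i> * of_real l) * of_real 1 * E s * conn s) has_integral E t * conn t - E 0 * conn 0) {0..t}"
    by (rule fundamental_theorem_of_calculus[OF t]) (unfold d_def, intro has_vector_derivative_mult dE conn_deriv)
  have b: "norm (E s * d s + - (\<i> * of_real l) * of_real 1 * E s * conn s) \<le> err L s + err (- L) s" if s: "s \<in> {0..t}" for s
  proof -
    have \<gamma>: "cmod \<gamma> \<le> 1" "cmod \<delta> \<le> 1" "cmod \<alpha> \<le> 1" "cmod \<beta> \<le> 1"
      using p_le_1[OF s, of "- L"] c_le_1[OF s, of L] ip(1)[OF s] ic(1)[OF s] by auto
    have "E s * d s + - (\<i> * of_real l) * of_real 1 * E s * conn s = E s * (d s - \<i> * of_real l * conn s)"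
      by (simp add: algebra_simps)
    also have "\<dots> = E s * ((lax_flux \<kappa> L s (p1 s L) (p2 s L) \<gamma> \<delta> - (p1 s L * \<delta> + p2 s L * \<gamma>) / (4 * \<i> * of_real \<kappa>))
        - (lax_flux \<kappa> (- L) s \<alpha> \<beta> (c1 s (- L)) (c2 s (- L)) - (\<alpha> * c2 s (- L) + \<beta> * c1 s (- L)) / (4 * \<i> * of_real \<kappa>)))"
      unfolding \<lambda>[OF s, symmetric] d_def by (simp add: algebra_simps)
    also have "norm \<dots> \<le> err L s + err (- L) s"
      unfolding norm_mult nE mult_1_left err_def
      by (intro order_trans[OF norm_triangle_ineq4] add_mono lax_flux_bound \<gamma> p_le_1 c_le_1 s)
    finally show ?thesis .
  qed
  have "norm (integral {0..t} (\<lambda>s. E s * d s + - (\<i> * of_real l) * of_real 1 * E s * conn s)) \<le> integral {0..t} (\<lambda>s. err L s + err (- L) s)"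
  proof (rule Henstock_Kurzweil_Integration.integral_norm_bound_integral[OF _ _ b])
    show "(\<lambda>s. err L s + err (- L) s) integrable_on {0..t}"
      unfolding err_def
      by (intro integrable_continuous_real continuous_intros continuous_on_halfplane_compose[OF cont_m]) auto
  qed (use I in blast)
  then show ?thesis
    unfolding integral_unique[OF I] by (simp add: E_def mult.assoc)
qed

text \<open>The linear term is reduced to the flux by
  \<open>|u| \<le> e + u\<^sup>2 * m / e\<close>. The choice \<open>e = sqrt B\<close> balances the
  two parts, which contribute \<open>sqrt B * t\<close> and \<open>2 * sqrt B\<close>.\<close>

lemma err_integral:
  assumes B: "J t x \<le> B" "0 < B"
  shows "integral {0..t} (err x) \<le> 4 * \<bar>\<kappa>\<bar> * B + sqrt B * (t + 2)"
proof -
  define e where "e = sqrt B"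
  have e: "e > 0" "e * e = B" using B by (simp_all add: e_def)
  have iJ: "(\<lambda>s. (u x s)\<^sup>2 * m x s / 2) integrable_on {0..t}"
    by (intro integrable_continuous_real continuous_intros continuous_on_halfplane_compose[OF cont_m]) auto
  have le: "err x s \<le> (4 * \<bar>\<kappa>\<bar> + 2 / e) * ((u x s)\<^sup>2 * m x s / 2) + e" for s
  proof -
    have "\<bar>u x s\<bar> \<le> e + (u x s)\<^sup>2 / e"
    proof (cases "\<bar>u x s\<bar> \<le> e")
      case True
      then show ?thesis using e(1) by (intro order_trans[OF True]) auto
    next
      case False
      then have "e * \<bar>u x s\<bar> \<le> \<bar>u x s\<bar> * \<bar>u x s\<bar>" by (intro mult_right_mono) auto
      then show ?thesis using e(1) by (simp add: field_simps power2_eq_square) (smt (verit) mult_pos_pos)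
    qed
    also have "(u x s)\<^sup>2 / e \<le> (u x s)\<^sup>2 * m x s / e"
      using e(1) m_ge_1[of x s] by (intro divide_right_mono mult_le_cancel_left1[THEN iffD2]) auto
    finally have "err x s \<le> 2 * \<bar>\<kappa>\<bar> * ((u x s)\<^sup>2 * m x s) + (e + (u x s)\<^sup>2 * m x s / e)"
      by (simp add: err_def)
    also have "\<dots> = (4 * \<bar>\<kappa>\<bar> + 2 / e) * ((u x s)\<^sup>2 * m x s / 2) + e"
      using e(1) by (simp add: field_simps)
    finally show ?thesis .
  qed
  have "integral {0..t} (err x) \<le> integral {0..t} (\<lambda>s. (4 * \<bar>\<kappa>\<bar> + 2 / e) * ((u x s)\<^sup>2 * m x s / 2) + e)"
  proof (rule integral_le)
    show "err x integrable_on {0..t}"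
      unfolding err_def[abs_def]
      by (intro integrable_continuous_real continuous_intros continuous_on_halfplane_compose[OF cont_m]) auto
    show "(\<lambda>s. (4 * \<bar>\<kappa>\<bar> + 2 / e) * ((u x s)\<^sup>2 * m x s / 2) + e) integrable_on {0..t}"
      by (intro integrable_add integrable_on_mult_right iJ integrable_const_ivl)
  qed (use le in auto)
  also have "\<dots> = (4 * \<bar>\<kappa>\<bar> + 2 / e) * J t x + integral {0..t} (\<lambda>_. e)"
    unfolding J_def
    by (simp only: integral_add[OF integrable_on_mult_right[OF iJ] integrable_const_ivl] Henstock_Kurzweil_Integration.integral_mult_right)
  also have "\<dots> \<le> (4 * \<bar>\<kappa>\<bar> + 2 / e) * (e * e) + e * t"
    using B e t by (intro add_mono mult_left_mono) auto
  also have "\<dots> = 4 * \<bar>\<kappa>\<bar> * B + sqrt B * (t + 2)"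
    using e(1) by (simp add: e(2)[symmetric] distrib_right, simp add: e_def algebra_simps)
  finally show ?thesis .
qed

lemma connection_estimate:
  assumes \<lambda>: "\<And>s. s \<in> {0..t} \<Longrightarrow> (p1 s L * \<delta> + p2 s L * \<gamma>) / (4 * \<i> * of_real \<kappa>)
      - (\<alpha> * c2 s (- L) + \<beta> * c1 s (- L)) / (4 * \<i> * of_real \<kappa>) = \<i> * of_real l * conn s"
    and B: "J t L \<le> B" "J t (- L) \<le> B" "0 < B"
  shows "cmod (exp (- (\<i> * of_real (l * t))) * conn t - conn 0) \<le> 2 * (4 * \<bar>\<kappa>\<bar> * B + sqrt B * (t + 2))"
proof -
  have i: "err x integrable_on {0..t}" for x
    unfolding err_def[abs_def]
    by (intro integrable_continuous_real continuous_intros continuous_on_halfplane_compose[OF cont_m]) auto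
  have "cmod (exp (- (\<i> * of_real (l * t))) * conn t - conn 0) \<le> integral {0..t} (\<lambda>s. err L s + err (- L) s)"
    by (rule conn_estimate[OF \<lambda>])
  also have "\<dots> = integral {0..t} (err L) + integral {0..t} (err (- L))"
    by (rule integral_add[OF i i])
  also have "\<dots> \<le> (4 * \<bar>\<kappa>\<bar> * B + sqrt B * (t + 2)) + (4 * \<bar>\<kappa>\<bar> * B + sqrt B * (t + 2))"
    by (rule add_mono[OF err_integral[OF B(1,3)] err_integral[OF B(2,3)]])
  finally show ?thesis by (simp only: mult_2)
qed

end

end

text \<open>For data \<open>(0, 1)\<close> at both ends, \<open>c1\<close> at \<open>- L\<close> is
  minus \<open>p1\<close> at \<open>L\<close>, and the two surviving flux terms add up. This is the
  origin of the phase \<open>t / (2 * \<kappa>)\<close> of \<open>b\<close>.\<close>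

lemma connection_coefficient:
  fixes k v v' d :: complex
  assumes "k \<noteq> 0"
  shows "(v * 1 + v' * 0) / (4 * \<i> * k) - (0 * d + 1 * (- v)) / (4 * \<i> * k) = \<i> * (- 1 / (2 * k)) * v"
  using assms by (simp add: field_simps)

text \<open>Combined, the three limits say that \<open>e0 * (E * b * d - b0)\<close> tends to 0; the
  factor \<open>e0\<close> may oscillate but has modulus 1.\<close>

lemma phase_limit:
  fixes A A0 e e0 d :: "real \<Rightarrow> complex"
  assumes 1: "((\<lambda>L. E * A L - A0 L) \<longlongrightarrow> 0) at_top" and 2: "((\<lambda>L. A L - b * e L) \<longlongrightarrow> 0) at_top"
    and 3: "((\<lambda>L. A0 L - b0 * e0 L) \<longlongrightarrow> 0) at_top"
    and e: "\<And>L. e L = e0 L * d L" "\<And>L. cmod (e0 L) = 1" and d: "(d \<longlongrightarrow> 1) at_top"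
  shows "E * b = b0"
proof -
  have "((\<lambda>L. (E * A L - A0 L) - E * (A L - b * e L) + (A0 L - b0 * e0 L)) \<longlongrightarrow> 0 - E * 0 + 0) at_top"
    by (intro tendsto_intros 1 2 3)
  moreover have "(E * A L - A0 L) - E * (A L - b * e L) + (A0 L - b0 * e0 L) = e0 L * (E * b * d L - b0)" for L
    by (simp add: e(1) algebra_simps)
  ultimately have "((\<lambda>L. e0 L * (E * b * d L - b0)) \<longlongrightarrow> 0) at_top" by simp
  then have "((\<lambda>L. norm (e0 L * (E * b * d L - b0))) \<longlongrightarrow> 0) at_top"
    by (rule tendsto_norm_zero)
  then have "((\<lambda>L. E * b * d L - b0) \<longlongrightarrow> 0) at_top"
    by (simp add: norm_mult e(2) tendsto_norm_zero_iff)
  moreover have "((\<lambda>L. E * b * d L - b0) \<longlongrightarrow> E * b * 1 - b0) at_top"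
    by (intro tendsto_intros d)
  ultimately have "E * b * 1 - b0 = 0"
    using tendsto_unique[OF trivial_limit_at_top_linorder] by blast
  then show ?thesis by simp
qed

section \<open>Evolution of the spectral functions and assembly of the result\<close>

context schwartz_potential
begin

text \<open>The rotation in \<open>jsum_at_0\<close> gives these values directly, for every
  potential. They cover the point excluded from \<open>spectral_evolution\<close>.\<close>

lemma ja_0: "ja 0 = 1" and jb_0: "jb 0 = 0"
proof -
  have v: "F 0 0 = of_real (hc 0)" "G 0 0 = of_real (hs 0)"
    using m.jsum_at_0[of 0] by (simp_all add: F_def G_def m_hc[of 0, simplified] m_hs[of 0, simplified])
  show "ja 0 = 1"
    using hc_hs_complex[of 0] by (simp add: ja_def v jsum_at_0 power2_eq_square)
  show "jb 0 = 0" by (simp add: jb_def v jsum_at_0)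
qed

lemma rhp_summary:
  assumes nz: "\<And>k. Im k \<ge> 0 \<Longrightarrow> spectral_a w k \<noteq> 0"
    and r: "\<And>\<kappa>. r \<kappa> * exp (2 * \<i> * of_real (\<kappa> * y - t / (4 * \<kappa>))) = reflection w \<kappa> * exp (2 * \<i> * of_real \<kappa> * of_real (P x))"
  shows "rhp_unique_solution r y t (jM x)"
    and "(jM x \<longlongrightarrow> M0 x) (at 0 within {k. Im k \<noteq> 0})"
    and "invertible (M0 x)"
    and "((\<lambda>k. ((matrix_inv (M0 x) ** jM x k) $ 1 $ 1 - 1) / (\<i> * k)) \<longlongrightarrow> of_real (x - P x)) (at 0 within {k. Im k \<noteq> 0})"
    and "((\<lambda>k. (matrix_inv (M0 x) ** jM x k) $ 2 $ 1 / (\<i> * k)) \<longlongrightarrow> of_real (w x)) (at 0 within {k. Im k \<noteq> 0})"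
proof -
  have nz': "\<And>k. Im k \<ge> 0 \<Longrightarrow> ja k \<noteq> 0" using nz by (simp add: spectral_a_eq)
  have "rhp_solution r y t (jM x)"
  proof (rule rhp_solution_jM)
    show "ja k \<noteq> 0" if "Im k \<ge> 0" for k by (rule nz'[OF that])
  qed (use r in \<open>simp add: reflection_eq\<close>)
  moreover have "det (jM x k) = 1" for k by (rule det_jM) (rule nz')
  ultimately show "rhp_unique_solution r y t (jM x)"
    unfolding rhp_unique_solution_def using rhp_unique by blast
  show "(jM x \<longlongrightarrow> M0 x) (at 0 within {k. Im k \<noteq> 0})" by (rule jM_tendsto_0) (rule nz')
  show "invertible (M0 x)" by (rule M0_invertible) (rule nz')
  have "(LINT y:{x..}|lborel. h y - 1) = x - P x"
    by (simp add: p_fun_def h_def m_fun_def)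
  moreover have "((\<lambda>k. ((matrix_inv (M0 x) ** jM x k) $ 1 $ 1 - 1) / (\<i> * k)) \<longlongrightarrow> of_real (LINT y:{x..}|lborel. h y - 1)) (at 0 within {k. Im k \<noteq> 0})"
    by (rule jM_small_11) (rule nz')
  ultimately show "((\<lambda>k. ((matrix_inv (M0 x) ** jM x k) $ 1 $ 1 - 1) / (\<i> * k)) \<longlongrightarrow> of_real (x - P x)) (at 0 within {k. Im k \<noteq> 0})"
    by simp
  show "((\<lambda>k. (matrix_inv (M0 x) ** jM x k) $ 2 $ 1 / (\<i> * k)) \<longlongrightarrow> of_real (w x)) (at 0 within {k. Im k \<noteq> 0})"
    by (rule jM_small_21) (rule nz')
qed

end

context short_pulse
begin

abbreviation U :: "real \<Rightarrow> real \<Rightarrow> real" where "U s \<equiv> (\<lambda>x. u x s)"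

lemma deriv_U: "deriv (U s) = (\<lambda>x. ux x s)"
  by (simp add: pdx_def fun_eq_iff)

lemma potential:
  assumes "s \<ge> 0" obtains C where "schwartz_potential (U s) C"
  using schwartz_potential_exists[OF partial_schwartz[OF partials(1) assms]] by blast

lemma lax_exists:
  assumes "s \<ge> 0"
  shows "\<exists>y1 y2. lax_solution \<kappa> (\<lambda>x. ux x s) y1 y2 \<and> y1 x0 = a \<and> y2 x0 = b"
proof -
  obtain C where "schwartz_potential (U s) C" using potential[OF assms] .
  from schwartz_potential.lax_solution_exists[OF this, of \<kappa> x0 a b]
  show ?thesis by (simp only: deriv_U)
qed

lemma J_nonneg: "t \<ge> 0 \<Longrightarrow> 0 \<le> J t x"
  unfolding J_def
proof (rule integral_nonneg)
  show "(\<lambda>s. (u x s)\<^sup>2 * m x s / 2) integrable_on {0..t}"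
    by (intro integrable_continuous_real continuous_intros continuous_on_halfplane_compose[OF cont_m]) auto
  show "0 \<le> (u x s)\<^sup>2 * m x s / 2" for s using m_ge_1[of x s] by simp
qed

text \<open>The two sides have the same \<open>x\<close>-derivative by the length law, and both are
  asymptotic to \<open>x\<close> at plus infinity.\<close>

lemma p_fun_evolution:
  assumes t: "t \<ge> 0"
  shows "p_fun (U t) x = p_fun (U 0) x + J t x"
proof -
  obtain C where "schwartz_potential (U t) C" using potential[OF t] .
  then interpret A: schwartz_potential "U t" C .
  obtain C' where "schwartz_potential (U 0) C'" using potential[of 0] by auto
  then interpret B: schwartz_potential "U 0" C' .
  obtain K where K: "0 < K" "\<And>x. J t x \<le> K * kap_tail x" "\<And>x. J t x \<le> K * kap_tail (- x)"
    by (rule J_decay[OF t]) (rule that)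
  note Jpos = J_nonneg[OF t]
  let ?D = "\<lambda>x. p_fun (U t) x - p_fun (U 0) x - J t x"
  have "(?D has_real_derivative sqrt (1 + (deriv (U t) z)\<^sup>2) - sqrt (1 + (deriv (U 0) z)\<^sup>2) - (m z t - m z 0)) (at z)" for z
    by (intro derivative_intros A.dP B.dP J_deriv t)
  then have "(?D has_vector_derivative 0) (at z)" for z
    by (simp add: deriv_U m_def has_real_derivative_iff_has_vector_derivative)
  from has_vector_derivative_zero_UNIV[of ?D, OF this] have const: "?D x = ?D y" for y .
  have tl: "((\<lambda>y. (C + C' + K) * kap_tail y) \<longlongrightarrow> 0) at_top"
    using tendsto_mult_left[OF kap_tail_tendsto, of "C + C' + K"] by simp
  have "(?D \<longlongrightarrow> 0) at_top"
  proof (rule Lim_null_comparison[OF always_eventually tl], rule allI)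
    fix y
    have "\<bar>?D y\<bar> \<le> C * kap_tail y + C' * kap_tail y + K * kap_tail y"
      using A.P_minus_id_le[of y] B.P_minus_id_le[of y] K(2)[of y] Jpos[of y] by linarith
    then show "norm (?D y) \<le> (C + C' + K) * kap_tail y" by (simp add: distrib_right)
  qed
  moreover have "(?D \<longlongrightarrow> ?D x) at_top"
    by (rule Lim_transform_eventually[OF tendsto_const always_eventually]) (rule allI, rule const)
  ultimately have "?D x = 0" by (rule tendsto_unique[OF trivial_limit_at_top_linorder, symmetric])
  then show ?thesis by simp
qed

lemma spectral_evolution:
  assumes t: "t \<ge> 0" and \<kappa>: "\<kappa> \<noteq> 0"
  shows spectral_b_evolution: "exp (\<i> * of_real (t / (2 * \<kappa>))) * spectral_b (U t) \<kappa> = spectral_b (U 0) \<kappa>"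
    and spectral_a_evolution: "spectral_a (U t) (of_real \<kappa>) = spectral_a (U 0) (of_real \<kappa>)"
proof -
  \<comment> \<open>Solutions are chosen for all \<open>L\<close> and \<open>s\<close> at once;
    \<open>\<sigma> = - 1\<close> or \<open>\<sigma> = 1\<close> selects the end of the interval
    that carries the data.\<close>
  have ch: "\<exists>y1 y2. \<forall>L s. 0 \<le> s \<longrightarrow> lax_solution \<kappa> (\<lambda>x. ux x s) (y1 L s) (y2 L s) \<and> y1 L s (\<sigma> * L) = a \<and> y2 L s (\<sigma> * L) = b"
    for \<sigma> a b
  proof -
    have "\<forall>L s. \<exists>y. 0 \<le> s \<longrightarrow> lax_solution \<kappa> (\<lambda>x. ux x s) (fst y) (snd y) \<and> fst y (\<sigma> * L) = a \<and> snd y (\<sigma> * L) = b"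
      using lax_exists by (metis fst_conv snd_conv)
    then obtain y where "\<forall>L s. 0 \<le> s \<longrightarrow> lax_solution \<kappa> (\<lambda>x. ux x s) (fst (y L s)) (snd (y L s)) \<and> fst (y L s) (\<sigma> * L) = a \<and> snd (y L s) (\<sigma> * L) = b"
      by metis
    then show ?thesis by (intro exI[of _ "\<lambda>L s. fst (y L s)"] exI[of _ "\<lambda>L s. snd (y L s)"])
  qed
  obtain y1 y2 where y: "\<And>L s. 0 \<le> s \<Longrightarrow> lax_solution \<kappa> (\<lambda>x. ux x s) (y1 L s) (y2 L s)"
      "\<And>L s. 0 \<le> s \<Longrightarrow> y1 L s (- L) = 0" "\<And>L s. 0 \<le> s \<Longrightarrow> y2 L s (- L) = 1"
    using ch[of "- 1" 0 1] by auto
  obtain c1 c2 where c: "\<And>L s. 0 \<le> s \<Longrightarrow> lax_solution \<kappa> (\<lambda>x. ux x s) (c1 L s) (c2 L s)"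
      "\<And>L s. 0 \<le> s \<Longrightarrow> c1 L s L = 0" "\<And>L s. 0 \<le> s \<Longrightarrow> c2 L s L = 1"
    using ch[of 1 0 1] by auto
  \<comment> \<open>With data \<open>(- 1, 0)\<close> at \<open>L\<close> the connection is
    \<open>y2\<close> at \<open>L\<close>, the entry carrying \<open>a\<close>; with the data
    \<open>(0, 1)\<close> of \<open>c\<close> it is \<open>y1\<close>, the entry carrying
    \<open>b\<close>.\<close>
  obtain z1 z2 where z: "\<And>L s. 0 \<le> s \<Longrightarrow> lax_solution \<kappa> (\<lambda>x. ux x s) (z1 L s) (z2 L s)"
      "\<And>L s. 0 \<le> s \<Longrightarrow> z1 L s L = - 1" "\<And>L s. 0 \<le> s \<Longrightarrow> z2 L s L = 0"
    using ch[of 1 "- 1" 0] by auto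
  obtain K where K: "0 < K" "\<And>x. J t x \<le> K * kap_tail x" "\<And>x. J t x \<le> K * kap_tail (- x)"
    by (rule J_decay[OF t]) (rule that)
  define R where "R L = 2 * (4 * \<bar>\<kappa>\<bar> * (K * kap_tail L) + sqrt (K * kap_tail L) * (t + 2))" for L
  have Bpos: "0 < K * kap_tail L" for L using K(1) kap_tail_pos[of L] by simp
  have JL: "J t L \<le> K * kap_tail L" "J t (- L) \<le> K * kap_tail L" for L
    using K(2)[of L] K(3)[of "- L"] by simp_all
  have "((\<lambda>L. 2 * (4 * \<bar>\<kappa>\<bar> * (K * kap_tail L) + sqrt (K * kap_tail L) * (t + 2))) \<longlongrightarrow> 2 * (4 * \<bar>\<kappa>\<bar> * (K * 0) + sqrt (K * 0) * (t + 2))) at_top"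
    by (intro tendsto_intros kap_tail_tendsto)
  then have R: "(R \<longlongrightarrow> 0) at_top" by (simp add: R_def[abs_def])
  have est1: "cmod (exp (\<i> * of_real (t / (2 * \<kappa>))) * y1 L t L - y1 L 0 L) \<le> R L" if L: "L > 0" for L
  proof -
    have ip: "y1 L s (- L) = 0 \<and> y2 L s (- L) = 1" "c1 L s L = 0 \<and> c2 L s L = 1" if "s \<in> {0..t}" for s
      using y(2,3)[of s L] c(2,3)[of s L] that by auto
    have "cmod (exp (- (\<i> * of_real ((- 1 / (2 * \<kappa>)) * t))) * connection L (y1 L) (y2 L) 0 1 t - connection L (y1 L) (y2 L) 0 1 0)
        \<le> 2 * (4 * \<bar>\<kappa>\<bar> * (K * kap_tail L) + sqrt (K * kap_tail L) * (t + 2))"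
    proof (rule connection_estimate[where ?c1.0 = "c1 L" and ?c2.0 = "c2 L" and \<alpha> = 0 and \<beta> = 1])
      fix s assume s: "s \<in> {0..t}"
      have "connection L (y1 L) (y2 L) 0 1 s = 0 * c2 L s (- L) - 1 * c1 L s (- L)"
        by (rule conn_at_minus) (use s y c ip lax_exists \<kappa> t L in auto)
      then have c1: "c1 L s (- L) = - y1 L s L" by (simp add: connection_def)
      have co: "connection L (y1 L) (y2 L) 0 1 s = y1 L s L" by (simp add: connection_def)
      show "(y1 L s L * 1 + y2 L s L * 0) / (4 * \<i> * of_real \<kappa>) - (0 * c2 L s (- L) + 1 * c1 L s (- L)) / (4 * \<i> * of_real \<kappa>) =
          \<i> * of_real (- 1 / (2 * \<kappa>)) * connection L (y1 L) (y2 L) 0 1 s"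
        unfolding c1 co using connection_coefficient[of "of_real \<kappa>" "y1 L s L" "y2 L s L" "c2 L s (- L)"] \<kappa> by simp
    qed (use y c ip lax_exists \<kappa> t L JL Bpos in auto)
    then show ?thesis by (simp add: connection_def R_def)
  qed
  \<comment> \<open>Here the two surviving flux terms cancel instead of adding up, so the rate is
    0.\<close>
  have est2: "cmod (1 * y2 L t L - y2 L 0 L) \<le> R L" if L: "L > 0" for L
  proof -
    have ip: "y1 L s (- L) = 0 \<and> y2 L s (- L) = 1" "z1 L s L = - 1 \<and> z2 L s L = 0" if "s \<in> {0..t}" for s
      using y(2,3)[of s L] z(2,3)[of s L] that by auto
    have "cmod (exp (- (\<i> * of_real (0 * t))) * connection L (y1 L) (y2 L) (- 1) 0 t - connection L (y1 L) (y2 L) (- 1) 0 0)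
        \<le> 2 * (4 * \<bar>\<kappa>\<bar> * (K * kap_tail L) + sqrt (K * kap_tail L) * (t + 2))"
    proof (rule connection_estimate[where ?c1.0 = "z1 L" and ?c2.0 = "z2 L" and \<alpha> = 0 and \<beta> = 1])
      fix s assume s: "s \<in> {0..t}"
      have "connection L (y1 L) (y2 L) (- 1) 0 s = 0 * z2 L s (- L) - 1 * z1 L s (- L)"
        by (rule conn_at_minus) (use s y z ip lax_exists \<kappa> t L in auto)
      then have z1: "z1 L s (- L) = - y2 L s L" by (simp add: connection_def)
      show "(y1 L s L * 0 + y2 L s L * - 1) / (4 * \<i> * of_real \<kappa>) - (0 * z2 L s (- L) + 1 * z1 L s (- L)) / (4 * \<i> * of_real \<kappa>) =
          \<i> * of_real 0 * connection L (y1 L) (y2 L) (- 1) 0 s"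
        unfolding z1 by simp
    qed (use y z ip lax_exists \<kappa> t L JL Bpos in auto)
    then show ?thesis by (simp add: connection_def R_def)
  qed
  have lim: "(\<phi> \<longlongrightarrow> 0) at_top" if "\<And>L. L > 0 \<Longrightarrow> cmod (\<phi> L) \<le> R L" for \<phi> :: "real \<Rightarrow> complex"
    by (rule Lim_null_comparison[OF eventually_mono[OF eventually_gt_at_top[of 0] that] R])
  obtain C where "schwartz_potential (U t) C" using potential[OF t] .
  then interpret A: schwartz_potential "U t" C .
  obtain C' where "schwartz_potential (U 0) C'" using potential[of 0] by auto
  then interpret B: schwartz_potential "U 0" C' .
  note as = A.lax_asymptotics[unfolded deriv_U, OF y(1)[OF t] y(2,3)[OF t]]
    B.lax_asymptotics[unfolded deriv_U, OF y(1)[OF order_refl] y(2,3)[OF order_refl]]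
  note pe = p_fun_evolution[OF t]
  have Jt: "((\<lambda>L. J t L) \<longlongrightarrow> 0) at_top" "((\<lambda>L. J t (- L)) \<longlongrightarrow> 0) at_top"
  proof -
    have tl: "((\<lambda>L. K * kap_tail L) \<longlongrightarrow> 0) at_top"
      using tendsto_mult_left[OF kap_tail_tendsto, of K] by simp
    note Jpos = J_nonneg[OF t]
    show "((\<lambda>L. J t L) \<longlongrightarrow> 0) at_top" "((\<lambda>L. J t (- L)) \<longlongrightarrow> 0) at_top"
      using JL Jpos by (auto intro!: Lim_null_comparison[OF always_eventually tl])
  qed
  \<comment> \<open>The phases in \<open>lax_asymptotics\<close> at times \<open>t\<close> and 0
    differ only by the values of \<open>J t\<close> at the two ends.\<close>
  have d: "((\<lambda>L. exp (\<i> * of_real (\<kappa> * (J t L + J t (- L))))) \<longlongrightarrow> 1) at_top"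
    "((\<lambda>L. exp (\<i> * of_real (\<kappa> * (J t (- L) - J t L)))) \<longlongrightarrow> 1) at_top"
  proof -
    have "((\<lambda>L. exp (\<i> * of_real (\<kappa> * (J t L + J t (- L))))) \<longlongrightarrow> exp (\<i> * of_real (\<kappa> * (0 + 0)))) at_top"
      "((\<lambda>L. exp (\<i> * of_real (\<kappa> * (J t (- L) - J t L)))) \<longlongrightarrow> exp (\<i> * of_real (\<kappa> * (0 - 0)))) at_top"
      by (intro tendsto_intros Jt)+
    then show "((\<lambda>L. exp (\<i> * of_real (\<kappa> * (J t L + J t (- L))))) \<longlongrightarrow> 1) at_top"
      "((\<lambda>L. exp (\<i> * of_real (\<kappa> * (J t (- L) - J t L)))) \<longlongrightarrow> 1) at_top" by simp_all
  qed
  show "exp (\<i> * of_real (t / (2 * \<kappa>))) * spectral_b (U t) \<kappa> = spectral_b (U 0) \<kappa>"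
  proof (rule phase_limit[OF lim[OF est1] as(1) as(3) _ _ d(1)])
    show "exp (\<i> * of_real (\<kappa> * (p_fun (U t) L + p_fun (U t) (- L)))) =
        exp (\<i> * of_real (\<kappa> * (p_fun (U 0) L + p_fun (U 0) (- L)))) * exp (\<i> * of_real (\<kappa> * (J t L + J t (- L))))" for L
      unfolding pe exp_add[symmetric] by (simp add: algebra_simps)
  qed (assumption, rule norm_exp_i_times)
  have "1 * spectral_a (U t) (of_real \<kappa>) = spectral_a (U 0) (of_real \<kappa>)"
  proof (rule phase_limit[OF lim[OF est2] as(2) as(4) _ _ d(2)])
    show "exp (\<i> * of_real (\<kappa> * (p_fun (U t) (- L) - p_fun (U t) L))) =
        exp (\<i> * of_real (\<kappa> * (p_fun (U 0) (- L) - p_fun (U 0) L))) * exp (\<i> * of_real (\<kappa> * (J t (- L) - J t L)))" for L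
      unfolding pe exp_add[symmetric] by (simp add: algebra_simps)
  qed (assumption, rule norm_exp_i_times)
  then show "spectral_a (U t) (of_real \<kappa>) = spectral_a (U 0) (of_real \<kappa>)" by simp
qed

text \<open>The values agree on the real axis. The difference, continued by 0 below the axis, is
  therefore continuous, hence entire, and it vanishes at infinity.\<close>

lemma spectral_a_conserved:
  assumes t: "t \<ge> 0" and k: "Im k \<ge> 0"
  shows "spectral_a (U t) k = spectral_a (U 0) k"
proof -
  obtain C where "schwartz_potential (U t) C" using potential[OF t] .
  then interpret A: schwartz_potential "U t" C .
  obtain C' where "schwartz_potential (U 0) C'" using potential[of 0] by auto
  then interpret B: schwartz_potential "U 0" C' .
  define E where "E k = (if Im k \<ge> 0 then A.ja k - B.ja k else 0)" for k
  have real: "A.ja k = B.ja k" if "Im k = 0" for k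
  proof -
    obtain \<kappa> where \<kappa>: "k = of_real \<kappa>" using \<open>Im k = 0\<close> by (metis complex_is_Real_iff Reals_cases)
    show ?thesis
    proof (cases "\<kappa> = 0")
      case False
      then show ?thesis
        using spectral_a_evolution[OF t False] by (simp add: A.spectral_a_eq B.spectral_a_eq \<kappa>)
    qed (simp add: \<kappa> A.ja_0 B.ja_0)
  qed
  have "E k = 0"
  proof (rule Liouville_off_line[where E = E and l = 0])
    have "continuous_on ({k. Im k \<ge> 0} \<union> {k. Im k \<le> 0}) E"
      unfolding E_def
      by (intro continuous_on_cases closed_halfplanes continuous_on_diff A.ja_cont B.ja_cont continuous_on_const)
         (auto simp: real)
    moreover have "{k. Im k \<ge> 0} \<union> {k. Im k \<le> 0} = UNIV" by auto
    ultimately show "continuous_on UNIV E" by simp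
    show "E holomorphic_on {k. Im k > 0}"
      by (rule holomorphic_transform[OF holomorphic_on_diff[OF A.ja_hol B.ja_hol]]) (simp add: E_def)
    show "E holomorphic_on {k. Im k < 0}"
      by (rule holomorphic_transform[OF holomorphic_on_const[of 0]]) (simp add: E_def)
    have l: "((\<lambda>k. A.ja k - B.ja k) \<longlongrightarrow> 1 - 1) (inf at_infinity (principal {k. Im k \<ge> 0}))"
      by (intro tendsto_diff A.up_inf_tendsto B.up_inf_tendsto)
    show "(E \<longlongrightarrow> 0) (inf at_infinity (principal {k. Im k \<noteq> 0}))"
    proof (rule tendstoI)
      fix e :: real assume e: "e > 0"
      have "\<forall>\<^sub>F k in inf at_infinity (principal {k. Im k \<ge> 0}). dist (A.ja k - B.ja k) 0 < e"
        using tendstoD[OF l e] by simp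
      then show "\<forall>\<^sub>F k in inf at_infinity (principal {k. Im k \<noteq> 0}). dist (E k) 0 < e"
        unfolding eventually_inf_principal by eventually_elim (use e in \<open>auto simp: E_def\<close>)
    qed
  qed
  then show ?thesis using k by (simp add: E_def A.spectral_a_eq B.spectral_a_eq)
qed

text \<open>Away from 0 the factor gained by \<open>b\<close> is exactly the doubled phase
  \<open>t / (4 * \<kappa>)\<close>. At 0 both reflection coefficients vanish, so the convention for
  division is harmless.\<close>

lemma reflection_evolution:
  assumes t: "t \<ge> 0"
  shows "reflection u0 \<kappa> * exp (2 * \<i> * of_real (\<kappa> * y - t / (4 * \<kappa>))) = reflection (U t) \<kappa> * exp (2 * \<i> * of_real \<kappa> * of_real y)"
proof -
  have U0: "u0 = U 0" by (simp add: initial fun_eq_iff)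
  obtain C where "schwartz_potential (U t) C" using potential[OF t] .
  then interpret A: schwartz_potential "U t" C .
  obtain C' where "schwartz_potential (U 0) C'" using potential[of 0] by auto
  then interpret B: schwartz_potential "U 0" C' .
  show ?thesis
  proof (cases "\<kappa> = 0")
    case True
    then show ?thesis by (simp add: U0 A.reflection_eq B.reflection_eq A.jb_0 B.jb_0)
  next
    case False
    have "2 * \<i> * complex_of_real (\<kappa> * y - t / (4 * \<kappa>)) = 2 * \<i> * of_real \<kappa> * of_real y - \<i> * of_real (t / (2 * \<kappa>))"
      by (simp add: algebra_simps)
    then have e: "exp (\<i> * of_real (t / (2 * \<kappa>))) * exp (2 * \<i> * of_real (\<kappa> * y - t / (4 * \<kappa>))) = exp (2 * \<i> * of_real \<kappa> * of_real y)"
      by (simp only: exp_add[symmetric]) simp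
    have "reflection u0 \<kappa> = exp (\<i> * of_real (t / (2 * \<kappa>))) * reflection (U t) \<kappa>"
      unfolding U0 reflection_def spectral_b_evolution[OF t False, symmetric] spectral_a_evolution[OF t False] by simp
    then show ?thesis unfolding e[symmetric] by (simp only: mult_ac)
  qed
qed

end

theorem theorem3p1:
  fixes u0 :: "real \<Rightarrow> real" and u :: "real \<Rightarrow> real \<Rightarrow> real"
  assumes "schwartz u0"
    and "\<forall>k. Im k \<ge> 0 \<longrightarrow> spectral_a u0 k \<noteq> 0"
    and "short_pulse_solution u0 u"
  shows "\<exists>(M :: real \<Rightarrow> real \<Rightarrow> complex \<Rightarrow> complex^2^2)
          (M0 :: real \<Rightarrow> real \<Rightarrow> complex^2^2)
          (X :: real \<Rightarrow> real \<Rightarrow> real) (U :: real \<Rightarrow> real \<Rightarrow> real).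
     \<forall>t\<ge>0.
       (\<forall>y. rhp_unique_solution (reflection u0) y t (M y t) \<and>
            (M y t \<longlongrightarrow> M0 y t) (at 0 within {k. Im k \<noteq> 0}) \<and>
            invertible (M0 y t) \<and>
            ((\<lambda>k. ((matrix_inv (M0 y t) ** M y t k) $ 1 $ 1 - 1) / (\<i> * k))
               \<longlongrightarrow> of_real (X y t - y)) (at 0 within {k. Im k \<noteq> 0}) \<and>
            ((\<lambda>k. (matrix_inv (M0 y t) ** M y t k) $ 2 $ 1 / (\<i> * k))
               \<longlongrightarrow> of_real (U y t)) (at 0 within {k. Im k \<noteq> 0}) \<and>
            p_fun (\<lambda>x. u x t) (X y t) = y \<and>
            u (X y t) t = U y t) \<and>
       (\<forall>x. X (p_fun (\<lambda>x. u x t) x) t = x \<and>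
            u x t = U (p_fun (\<lambda>x. u x t) x) t)"
proof -
  interpret short_pulse u0 u by unfold_locales (rule assms(3))
  have nz: "spectral_a (U t) k \<noteq> 0" if "t \<ge> 0" "Im k \<ge> 0" for t k
  proof -
    have "U 0 = u0" by (simp add: initial fun_eq_iff)
    then show ?thesis using spectral_a_conserved[OF that] assms(2) that(2) by simp
  qed
  \<comment> \<open>All witnesses belonging to \<open>(y, t)\<close> form one tuple, so that a
    single choice yields the four functions.\<close>
  define Q where "Q y t W \<longleftrightarrow> (case W of (M, M0, X, V) \<Rightarrow>
      rhp_unique_solution (reflection u0) y t M \<and>
      (M \<longlongrightarrow> M0) (at 0 within {k. Im k \<noteq> 0}) \<and>
      invertible M0 \<and>
      ((\<lambda>k. ((matrix_inv M0 ** M k) $ 1 $ 1 - 1) / (\<i> * k)) \<longlongrightarrow> of_real (X - y)) (at 0 within {k. Im k \<noteq> 0}) \<and>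
      ((\<lambda>k. (matrix_inv M0 ** M k) $ 2 $ 1 / (\<i> * k)) \<longlongrightarrow> of_real V) (at 0 within {k. Im k \<noteq> 0}) \<and>
      p_fun (U t) X = y \<and> u X t = V)" for y t W
  have "\<exists>W. Q y t W" if t: "t \<ge> 0" for y t
  proof -
    obtain C where "schwartz_potential (U t) C" using potential[OF t] .
    then interpret A: schwartz_potential "U t" C .
    \<comment> \<open>The witness is the Jost matrix at the point \<open>x\<close> that corresponds
      to \<open>y\<close> at time \<open>t\<close>.\<close>
    obtain x where x: "p_fun (U t) x = y" using A.P_bij[of y] by blast
    have r: "reflection u0 \<kappa> * exp (2 * \<i> * of_real (\<kappa> * y - t / (4 * \<kappa>))) =
        reflection (U t) \<kappa> * exp (2 * \<i> * of_real \<kappa> * of_real (p_fun (U t) x))" for \<kappa>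
      unfolding x by (rule reflection_evolution[OF t])
    show ?thesis
      using A.rhp_summary[OF nz[OF t] r] x
      by (intro exI[of _ "(A.jM x, A.M0 x, x, u x t)"]) (simp add: Q_def)
  qed
  then have "\<forall>y t. \<exists>W. t \<ge> 0 \<longrightarrow> Q y t W" by blast
  then obtain W where W: "\<forall>y t. t \<ge> 0 \<longrightarrow> Q y t (W y t)" by metis
  \<comment> \<open>Injectivity of \<open>p_fun\<close> makes the chosen \<open>X\<close> its
    two-sided inverse.\<close>
  have inj: "X = x" if t: "t \<ge> 0" and X: "p_fun (U t) X = p_fun (U t) x" for t X x
  proof -
    obtain C where "schwartz_potential (U t) C" using potential[OF t] .
    then interpret A: schwartz_potential "U t" C .
    show ?thesis using A.P_bij[of "p_fun (U t) x"] X by blast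
  qed
  define M where "M y t = fst (W y t)" for y t
  define M0 where "M0 y t = fst (snd (W y t))" for y t
  define X where "X y t = fst (snd (snd (W y t)))" for y t
  define V where "V y t = snd (snd (snd (W y t)))" for y t
  have main: "rhp_unique_solution (reflection u0) y t (M y t) \<and>
      (M y t \<longlongrightarrow> M0 y t) (at 0 within {k. Im k \<noteq> 0}) \<and>
      invertible (M0 y t) \<and>
      ((\<lambda>k. ((matrix_inv (M0 y t) ** M y t k) $ 1 $ 1 - 1) / (\<i> * k)) \<longlongrightarrow> of_real (X y t - y)) (at 0 within {k. Im k \<noteq> 0}) \<and>
      ((\<lambda>k. (matrix_inv (M0 y t) ** M y t k) $ 2 $ 1 / (\<i> * k)) \<longlongrightarrow> of_real (V y t)) (at 0 within {k. Im k \<noteq> 0}) \<and>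
      p_fun (U t) (X y t) = y \<and> u (X y t) t = V y t" if "t \<ge> 0" for y t
    using W[rule_format, OF that, of y]
    unfolding Q_def case_prod_unfold M_def M0_def X_def V_def .
  have "X (p_fun (U t) x) t = x \<and> u x t = V (p_fun (U t) x) t" if t: "t \<ge> 0" for t x
  proof -
    have "X (p_fun (U t) x) t = x" by (rule inj[OF t]) (use main[OF t] in blast)
    then show ?thesis using main[OF t, of "p_fun (U t) x"] by simp
  qed
  with main show ?thesis
    by (intro exI[of _ M] exI[of _ M0] exI[of _ X] exI[of _ V] allI impI conjI[OF allI allI])
qed

end
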